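(* Let $q\in(-1,0)\cup(0,1)$. For every compactly supported probability measure $\mu$ on $\mathbb{R}$ there exist unique compactly supported probability measures $\nu$ and $\lambda$ on $\mathbb{R}$ such that \[ 1-G_\mu(z)=(1-qG_\nu(z))^{1/q}\qquad\text{and}\qquad 1+G_\mu(z-1)=(1-qG_\lambda(z))^{-1/q} \] for all $z\in\mathbb{C}$ with $|z|$ large enough (principal branches, equal to $1$ at $G=0$). The maps $\mathfrak P:\mu\mapsto\nu$ and $\mathfrak Q:\mu\mapsto\lambda$ are injective, and for all compactly supported probability measures $\nu_1,\nu_2$ the measures $\mathfrak P(\nu_1)\otimes_q\mathfrak P(\nu_2)$ and $\mathfrak Q(\nu_1)\otimes_q\mathfrak Q(\nu_2)$ exist and \[ \mathfrak P(\nu_1\boxplus\nu_2)=\mathfrak P(\nu_1)\otimes_q\mathfrak P(\nu_2),\qquad \mathfrak Q(\nu_1\boxplus\nu_2)=\mathfrak Q(\nu_1)\otimes_q\mathfrak Q(\nu_2). \]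
   Context: $G_\mu(z)=\int\frac{\mu(dt)}{z-t}$ is the Stieltjes transform. For a compactly supported probability measure $\mu$, the free cumulants $\kappa_n(\mu)$ are defined by $\int t^kd\mu=\sum_{\pi\in NC(k)}\prod_{V\in\pi}\kappa_{|V|}(\mu)$ ($NC(k)$ the non-crossing partitions of $\{1,\dots,k\}$) and the $R$-transform is $R_\mu(z)=\sum_{n\ge1}\kappa_n(\mu)z^{n-1}$; $\boxplus$ is free convolution, characterized by $R_{\mu_1\boxplus\mu_2}=R_{\mu_1}+R_{\mu_2}$. Let $e_q(z)=(1-qz)^{-1/q}$ and $\beta(1-q,1+q)$ the beta distribution with parameters $1-q,1+q$, whose $R$-transform is $R_{\beta(1-q,1+q)}(z)=\frac{e_q(z)}{e_q(z)-1}-\frac1z$. The $q$-deformed quantized $R$-transform is $R^{quant(q)}_\mu=R_\mu-R_{\beta(1-q,1+q)}$, and for compactly supported probability measures $\rho_1,\rho_2$, $\rho_1\otimes_q\rho_2$ denotes the (unique, if it exists) compactly supported probability measure $\rho$ with $R^{quant(q)}_\rho=R^{quant(q)}_{\rho_1}+R^{quant(q)}_{\rho_2}$. *)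

theory Defs
  imports "HOL-Probability.Probability" "HOL-Computational_Algebra.Formal_Power_Series"
begin

definition cs_prob :: "real measure \<Rightarrow> bool" where
  "cs_prob \<mu> \<longleftrightarrow> prob_space \<mu> \<and> sets \<mu> = sets borel \<and>
     (\<exists>K. compact K \<and> emeasure \<mu> (UNIV - K) = 0)"

definition stieltjes :: "real measure \<Rightarrow> complex \<Rightarrow> complex" where
  "stieltjes \<mu> z = (LINT t|\<mu>. 1 / (z - complex_of_real t))"

definition moment :: "real measure \<Rightarrow> nat \<Rightarrow> real" where
  "moment \<mu> k = (LINT t|\<mu>. t ^ k)"

definition noncrossing :: "nat set set \<Rightarrow> bool" where
  "noncrossing P \<longleftrightarrow> (\<forall>V\<in>P. \<forall>W\<in>P. V \<noteq> W \<longrightarrow>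
      \<not> (\<exists>a b c d. a < b \<and> b < c \<and> c < d \<and> a \<in> V \<and> c \<in> V \<and> b \<in> W \<and> d \<in> W))"

definition NC :: "nat \<Rightarrow> nat set set set" where
  "NC k = {P. partition_on {1..k} P \<and> noncrossing P}"

text \<open>Free cumulants kappa_n (n >= 1), defined by the moment-cumulant formula;
  the (irrelevant) value at 0 is fixed to 0.\<close>
definition free_cumulant :: "real measure \<Rightarrow> nat \<Rightarrow> real" where
  "free_cumulant \<mu> = (THE \<kappa>. \<kappa> 0 = 0 \<and>
      (\<forall>k\<ge>1. moment \<mu> k = (\<Sum>\<pi>\<in>NC k. \<Prod>V\<in>\<pi>. \<kappa> (card V))))"

definition R_transform :: "real measure \<Rightarrow> real fps" where
  "R_transform \<mu> = Abs_fps (\<lambda>n. free_cumulant \<mu> (Suc n))"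

definition free_conv :: "real measure \<Rightarrow> real measure \<Rightarrow> real measure" where
  "free_conv \<mu>1 \<mu>2 = (THE \<rho>. cs_prob \<rho> \<and> R_transform \<rho> = R_transform \<mu>1 + R_transform \<mu>2)"

definition beta_distr :: "real \<Rightarrow> real \<Rightarrow> real measure" where
  "beta_distr a b = density lborel (\<lambda>x. ennreal (indicator {0<..<1} x *
      x powr (a - 1) * (1 - x) powr (b - 1) / Beta a b))"

definition R_quant :: "real \<Rightarrow> real measure \<Rightarrow> real fps" where
  "R_quant q \<mu> = R_transform \<mu> - R_transform (beta_distr (1 - q) (1 + q))"

definition qconv_rel :: "real \<Rightarrow> real measure \<Rightarrow> real measure \<Rightarrow> real measure \<Rightarrow> bool" where
  "qconv_rel q \<rho>1 \<rho>2 \<rho> \<longleftrightarrow> cs_prob \<rho> \<and> R_quant q \<rho> = R_quant q \<rho>1 + R_quant q \<rho>2"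

definition qconv :: "real \<Rightarrow> real measure \<Rightarrow> real measure \<Rightarrow> real measure" where
  "qconv q \<rho>1 \<rho>2 = (THE \<rho>. qconv_rel q \<rho>1 \<rho>2 \<rho>)"

definition P_rel :: "real \<Rightarrow> real measure \<Rightarrow> real measure \<Rightarrow> bool" where
  "P_rel q \<mu> \<nu> \<longleftrightarrow> cs_prob \<nu> \<and> (\<forall>\<^sub>F z in at_infinity.
      1 - stieltjes \<mu> z = (1 - complex_of_real q * stieltjes \<nu> z) powr complex_of_real (1 / q))"

definition Q_rel :: "real \<Rightarrow> real measure \<Rightarrow> real measure \<Rightarrow> bool" where
  "Q_rel q \<mu> la \<longleftrightarrow> cs_prob la \<and> (\<forall>\<^sub>F z in at_infinity.
      1 + stieltjes \<mu> (z - 1) = (1 - complex_of_real q * stieltjes la z) powr complex_of_real (- 1 / q))"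

definition P_map :: "real \<Rightarrow> real measure \<Rightarrow> real measure" where
  "P_map q \<mu> = (THE \<nu>. P_rel q \<mu> \<nu>)"

definition Q_map :: "real \<Rightarrow> real measure \<Rightarrow> real measure" where
  "Q_map q \<mu> = (THE la. Q_rel q \<mu> la)"

end

theory Submission
  imports Defs "HOL-Complex_Analysis.Complex_Analysis"
begin

text \<open>
  Write \<open>g\<^sub>\<mu>(u) = G\<^sub>\<mu>(1/u)\<close> for the expansion of the Stieltjes transform at infinity. Decomposing a
  non-crossing partition along the block of its first element turns the moment-cumulant formula into
  \<open>g = u (1 + g R(g))\<close>, which determines \<open>R\<close> from \<open>g\<close> and conversely. Everything else is
  substitution into this relation: \<open>\<PP>\<close> is \<open>g \<mapsto> \<phi>(g)\<close> with \<open>\<phi>(w) = (1 - (1 - w)\<^sup>q)/q\<close>, the beta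
  distribution has \<open>g = \<phi>\<close>, and therefore \<open>R\<^bsub>\<PP>(\<mu>)\<^esub> - R\<^sub>\<beta> = R\<^sub>\<mu> \<circ> \<phi>\<^sup>-\<^sup>1\<close> is additive in \<open>R\<^sub>\<mu>\<close>.
  The map \<open>\<QQ>\<close> is \<open>\<PP>\<close> after \<open>G(z) \<mapsto> 1 - 1/(1 + G(z - 1))\<close>, whose effect on \<open>R\<close> is the
  substitution \<open>x \<mapsto> x/(1 - x)\<close>.

  All measures are produced by one representation theorem: a function mapping the upper half plane
  to the lower one, analytic near infinity with real coefficients and \<open>\<sim> 1/z\<close>, is the Stieltjes
  transform of a compactly supported probability measure (Stieltjes inversion on a half disc and
  Helly selection). For the free convolution the function is \<open>G\<^sub>\<mu> \<circ> \<omega>\<close>, where the subordination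
  function \<open>\<omega>\<close> solves \<open>\<omega> = z + h\<^sub>\<nu>(z + h\<^sub>\<mu>(\<omega>))\<close> with \<open>h = 1/G - z\<close>. The iterates of this equation
  contract near infinity, and Montel's theorem continues their limit to the upper half plane.
\<close>

unbundle no vec_syntax
unbundle fps_syntax

section \<open>Non-crossing partitions and the moment-cumulant relation\<close>

text \<open>A measure with compact support is determined by the germ of its Stieltjes transform at
  infinity, so every identity of the theorem becomes one of formal power series in u = 1/z. Analysis
  enters only where a measure has to be produced, because positivity is invisible on coefficients;
  there the sign of Im G on the upper half plane does the work. Hence the two-sided treatment of
  subordination: its equation is proved near infinity, where the expansions live, and on the rest of
  the upper half plane only \<open>Im \<omega> \<ge> Im z\<close> is kept. The function \<phi> is
  forced: solving 1 - G = (1 - q g)^(1/q) for g gives g = \<phi>(G). Moreover 1/\<phi>^-1(w) =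
  e_q(w)/(e_q(w) - 1), so the known R-transform of the beta distribution says exactly that its g is
  \<phi>. The formula with e_q itself never occurs; instead the moments of the beta density are
  matched with the coefficients of \<phi>. The bound |q| < 1 makes \<phi> respect half planes: an
  angle in (0, pi) times q stays in (-pi, pi).\<close>

definition NCon :: "nat set \<Rightarrow> nat set set set" where
  "NCon A = {P. partition_on A P \<and> noncrossing P}"

text \<open>Written as a union to avoid a choice; in a partition exactly one block
  contributes.\<close>

definition blk :: "nat set set \<Rightarrow> nat \<Rightarrow> nat set" where
  "blk P x = \<Union>{V\<in>P. x \<in> V}"

text \<open>Half-open intervals are closed under the cuts of the recursion: what lies between two
  consecutive elements of a block is again such an interval, possibly empty.\<close>

definition ncsum :: "(nat \<Rightarrow> 'a::comm_ring_1) \<Rightarrow> nat \<Rightarrow> nat \<Rightarrow> 'a" where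
  "ncsum \<kappa> a b = (\<Sum>P\<in>NCon {a..<b}. \<Prod>V\<in>P. \<kappa> (card V))"

text \<open>The shift \<open>j\<close> counts the elements already removed from the block of the first element.\<close>

definition ncsum_first :: "(nat \<Rightarrow> 'a::comm_ring_1) \<Rightarrow> nat \<Rightarrow> nat \<Rightarrow> nat \<Rightarrow> 'a" where
  "ncsum_first \<kappa> j a b =
     (\<Sum>P\<in>NCon {a..<b}. \<kappa> (card (blk P a) + j) * (\<Prod>V\<in>P - {blk P a}. \<kappa> (card V)))"

lemma partition_blk:
  assumes "partition_on A P" "x \<in> A"
  shows "blk P x \<in> P" "x \<in> blk P x"
proof -
  obtain V where V: "V \<in> P" "x \<in> V" using assms by (auto simp: partition_on_def)
  have "{W\<in>P. x \<in> W} = {V}"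
    using assms(1) V by (auto simp: partition_on_def disjoint_def)
  then show "blk P x \<in> P" "x \<in> blk P x" using V by (auto simp: blk_def)
qed

lemma partition_blkI:
  assumes "partition_on A P" "V \<in> P" "x \<in> V"
  shows "blk P x = V"
proof -
  have "{W\<in>P. x \<in> W} = {V}"
    using assms by (auto simp: partition_on_def disjoint_def)
  then show ?thesis by (auto simp: blk_def)
qed

lemma finite_NCon: "finite A \<Longrightarrow> finite (NCon A)"
  by (rule finite_subset[of _ "Pow (Pow A)"]) (auto simp: NCon_def partition_on_def)

lemma finite_partition: "finite A \<Longrightarrow> partition_on A P \<Longrightarrow> finite P"
  by (rule finite_subset[of _ "Pow A"]) (auto simp: partition_on_def)

lemma NCon_empty: "NCon {} = {{}}"
  by (auto simp: NCon_def partition_on_def noncrossing_def)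

lemma ncsum_empty [simp]: "ncsum \<kappa> a a = 1"
  by (simp add: ncsum_def NCon_empty)

lemma ncsum_eq_first:
  assumes "a < b" shows "ncsum \<kappa> a b = ncsum_first \<kappa> 0 a b"
  unfolding ncsum_def ncsum_first_def
proof (rule sum.cong[OF refl])
  fix P assume "P \<in> NCon {a..<b}"
  then have P: "partition_on {a..<b} P" by (simp add: NCon_def)
  have "blk P a \<in> P" using partition_blk[OF P, of a] assms by auto
  moreover have "finite P" using finite_partition[OF _ P] by simp
  ultimately show "(\<Prod>V\<in>P. \<kappa> (card V)) = \<kappa> (card (blk P a) + 0) * (\<Prod>V\<in>P - {blk P a}. \<kappa> (card V))"
    by (simp add: prod.remove)
qed

section \<open>Splitting a non-crossing partition along the block of its first element\<close>

lemma noncrossingD: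
  assumes "noncrossing P" "V \<in> P" "W \<in> P" "V \<noteq> W" "a < b" "b < c" "c < d" "a \<in> V" "c \<in> V" "b \<in> W" "d \<in> W"
  shows False
  using assms unfolding noncrossing_def by blast

lemma noncrossing_subset:
  assumes "noncrossing Q" "P \<subseteq> Q" shows "noncrossing P"
  unfolding noncrossing_def
proof (intro ballI impI notI, elim exE conjE)
  fix V W a b c d assume "V \<in> P" "W \<in> P" and rest: "V \<noteq> W" "a < b" "b < c" "c < d" "a \<in> V" "c \<in> V" "b \<in> W" "d \<in> W"
  then have "V \<in> Q" "W \<in> Q" using assms(2) by auto
  then show False using noncrossingD[OF assms(1) _ _ rest] by blast
qed

text \<open>A singleton block crosses nothing, so removing it is a bijection onto the non-crossing
  partitions of the remaining interval.\<close>

lemma ncsum_singleton_part: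
  assumes ab: "a < b"
  shows "(\<Sum>P\<in>{P\<in>NCon {a..<b}. blk P a = {a}}. \<kappa> (card (blk P a) + j) * (\<Prod>V\<in>P - {blk P a}. \<kappa> (card V)))
    = \<kappa> (Suc j) * ncsum \<kappa> (Suc a) b"
  unfolding ncsum_def sum_distrib_left
proof (rule sum.reindex_bij_witness[where i = "insert {a}" and j = "\<lambda>P. P - {{a}}"])
  fix P assume "P \<in> {P\<in>NCon {a..<b}. blk P a = {a}}"
  then have P: "partition_on {a..<b} P" "noncrossing P" "blk P a = {a}" by (auto simp: NCon_def)
  have aP: "{a} \<in> P" using partition_blk(1)[OF P(1), of a] ab P(3) by auto
  show "insert {a} (P - {{a}}) = P" using aP by auto
  have "partition_on {Suc a..<b} (P - {{a}})"
  proof -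
    have "V \<inter> {a} = {}" if "V \<in> P - {{a}}" for V
      using that aP by (intro disjointD[OF partition_onD2[OF P(1)]]) auto
    then have "\<Union>(P - {{a}}) = \<Union>P - {a}" by blast
    also have "\<dots> = {Suc a..<b}" using P(1) by (auto simp: partition_on_def)
    finally have "\<Union>(P - {{a}}) = {Suc a..<b}" .
    then show ?thesis using P(1) by (auto simp: partition_on_def disjoint_def)
  qed
  moreover have "noncrossing (P - {{a}})" by (rule noncrossing_subset[OF P(2)]) blast
  ultimately show "P - {{a}} \<in> NCon {Suc a..<b}" by (simp add: NCon_def)
  show "\<kappa> (Suc j) * (\<Prod>V\<in>P - {{a}}. \<kappa> (card V)) = \<kappa> (card (blk P a) + j) * (\<Prod>V\<in>P - {blk P a}. \<kappa> (card V))"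
    by (simp add: P(3))
next
  fix P assume "P \<in> NCon {Suc a..<b}"
  then have P: "partition_on {Suc a..<b} P" "noncrossing P" by (auto simp: NCon_def)
  have sub: "\<And>V. V \<in> P \<Longrightarrow> V \<subseteq> {Suc a..<b}" using P(1) by (auto simp: partition_on_def)
  have notin: "a \<notin> V" if "V \<in> P" for V using sub[OF that] by auto
  then show "insert {a} P - {{a}} = P" by auto
  have part: "partition_on {a..<b} (insert {a} P)"
  proof -
    have "\<Union>(insert {a} P) = {a..<b}" using P(1) ab by (auto simp: partition_on_def)
    then show ?thesis using P(1) notin by (auto simp: partition_on_def disjoint_def)
  qed
  moreover have "noncrossing (insert {a} P)"
    unfolding noncrossing_def
  proof (intro ballI impI notI, elim exE conjE)
    fix V W x y z t assume *: "V \<in> insert {a} P" "W \<in> insert {a} P" "V \<noteq> W"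
      "x < y" "y < z" "z < t" "x \<in> V" "z \<in> V" "y \<in> W" "t \<in> W"
    then have "V \<noteq> {a}" "W \<noteq> {a}" by auto
    then show False using noncrossingD[OF P(2), of V W x y z t] * by blast
  qed
  moreover have "blk (insert {a} P) a = {a}" by (rule partition_blkI[OF part]) auto
  ultimately show "insert {a} P \<in> {P \<in> NCon {a..<b}. blk P a = {a}}" by (simp add: NCon_def)
qed

text \<open>Here \<open>v\<close> is the second element of the first block B. A block with elements
  on both sides of \<open>v\<close> would cross B at \<open>a\<close> and \<open>v\<close>, so the
  partition falls apart into one of the gap between \<open>a\<close> and \<open>v\<close> and one of
  \<open>{v..<b}\<close>, in which B without \<open>a\<close> is the block of \<open>v\<close>. The
  lost element \<open>a\<close> reappears as the increment of the shift from \<open>j\<close> to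
  \<open>Suc j\<close>.\<close>

lemma ncsum_second_part:
  assumes av: "a < v" and vb: "v < b"
  shows "(\<Sum>P\<in>{P\<in>NCon {a..<b}. v \<in> blk P a \<and> blk P a \<inter> {a<..<v} = {}}.
       \<kappa> (card (blk P a) + j) * (\<Prod>V\<in>P - {blk P a}. \<kappa> (card V)))
    = ncsum \<kappa> (Suc a) v * ncsum_first \<kappa> (Suc j) v b"
  unfolding ncsum_def ncsum_first_def sum_product sum.cartesian_product
proof (rule sum.reindex_bij_witness[where
    i = "\<lambda>(P1,P2). insert (insert a (blk P2 v)) (P1 \<union> (P2 - {blk P2 v}))" and
    j = "\<lambda>P. (P \<inter> Pow {a<..<v}, insert (blk P a - {a}) (P - {blk P a} - Pow {a<..<v}))"])
  fix P assume "P \<in> {P\<in>NCon {a..<b}. v \<in> blk P a \<and> blk P a \<inter> {a<..<v} = {}}"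
  then have P: "partition_on {a..<b} P" "noncrossing P" "v \<in> blk P a" "blk P a \<inter> {a<..<v} = {}"
    by (auto simp: NCon_def)
  define B where "B = blk P a"
  define P1 where "P1 = P \<inter> Pow {a<..<v}"
  define P2 where "P2 = insert (B - {a}) (P - {B} - Pow {a<..<v})"
  have B: "B \<in> P" "a \<in> B" using partition_blk[OF P(1), of a] av vb by (auto simp: B_def)
  have vB: "v \<in> B" "B \<inter> {a<..<v} = {}" using P by (auto simp: B_def)
  have UP: "\<Union>P = {a..<b}" and dis: "\<And>V W. V \<in> P \<Longrightarrow> W \<in> P \<Longrightarrow> V \<noteq> W \<Longrightarrow> V \<inter> W = {}" and ne: "{} \<notin> P"
    using P(1) by (auto simp: partition_on_def disjoint_def)
  have Bsub: "B - {a} \<subseteq> {v..<b}"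
  proof
    fix x assume x: "x \<in> B - {a}"
    then have "x \<in> {a..<b}" "x \<notin> {a<..<v}" using UP B(1) vB(2) by blast+
    then show "x \<in> {v..<b}" using x by auto
  qed
  \<comment> \<open>A block violating this has elements y in the gap and x beyond \<open>v\<close>,
    and a < y < v < x is a crossing with \<open>B\<close>.\<close>
  have dich: "V \<subseteq> {a<..<v} \<or> V \<subseteq> {v..<b}" if V: "V \<in> P" "V \<noteq> B" for V
  proof (rule ccontr)
    assume *: "\<not> ?thesis"
    have disj: "V \<inter> B = {}" using dis V B by blast
    have sub: "V \<subseteq> {a..<b}" using V UP by blast
    have an: "a \<notin> V" "v \<notin> V" using disj B vB by auto
    obtain x y where "x \<in> V" "x \<notin> {a<..<v}" "y \<in> V" "y \<notin> {v..<b}" using * by blast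
    moreover from this have "x \<noteq> a" "x \<noteq> v" "y \<noteq> a" "y \<noteq> v" using an by auto
    moreover have "x \<in> {a..<b}" "y \<in> {a..<b}" using calculation(1,3) sub by blast+
    ultimately have "x > v" "a < y" "y < v" by auto
    then show False using noncrossingD[OF P(2) B(1) V(1), of a y v x] V B vB \<open>x \<in> V\<close> \<open>y \<in> V\<close> by auto
  qed
  have BnP1: "\<not> B \<subseteq> {a<..<v}" using B by auto
  have BaP: "B - {a} \<notin> P"
  proof
    assume "B - {a} \<in> P"
    moreover have "B - {a} \<noteq> B" using B by auto
    moreover have "v \<in> (B - {a}) \<inter> B" using vB av by auto
    ultimately show False using dis B(1) by blast
  qed
  have part1: "partition_on {Suc a..<v} P1"
  proof -
    have "\<Union>P1 = {Suc a..<v}"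
    proof (intro equalityI subsetI)
      fix x assume "x \<in> {Suc a..<v}"
      then have x: "x \<in> {a<..<v}" by auto
      then have "x \<in> \<Union>P" using UP vb by auto
      then obtain V where V: "V \<in> P" "x \<in> V" by auto
      then have "V \<noteq> B" using x vB by auto
      moreover have "\<not> V \<subseteq> {v..<b}" using x V by auto
      ultimately have "V \<subseteq> {a<..<v}" using dich[OF V(1)] by blast
      then show "x \<in> \<Union>P1" using V by (auto simp: P1_def)
    qed (auto simp: P1_def)
    then show ?thesis using P(1) by (auto simp: partition_on_def disjoint_def P1_def)
  qed
  have part2: "partition_on {v..<b} P2"
  proof -
    have "\<Union>P2 = {v..<b}"
    proof (intro equalityI subsetI)
      fix x assume x: "x \<in> {v..<b}"
      then have "x \<in> \<Union>P" using UP av by auto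
      then obtain V where V: "V \<in> P" "x \<in> V" by auto
      then have "V \<noteq> B \<Longrightarrow> \<not> V \<subseteq> {a<..<v}" using x by auto
      moreover have "x \<noteq> a" using x av by auto
      ultimately show "x \<in> \<Union>P2" using V by (auto simp: P2_def)
    next
      fix x assume "x \<in> \<Union>P2"
      then obtain V where "V \<in> P2" "x \<in> V" by blast
      then have "V \<subseteq> {v..<b}" using dich Bsub unfolding P2_def by blast
      then show "x \<in> {v..<b}" using \<open>x \<in> V\<close> by blast
    qed
    moreover have "disjoint P2" unfolding disjoint_def
    proof (intro ballI impI)
      fix V V' assume "V \<in> P2" "V' \<in> P2" "V \<noteq> V'"
      then consider "V = B - {a}" "V' \<in> P" "V' \<noteq> B" | "V' = B - {a}" "V \<in> P" "V \<noteq> B" | "V \<in> P" "V' \<in> P"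
        unfolding P2_def by blast
      then show "V \<inter> V' = {}" by cases (use dis B(1) \<open>V \<noteq> V'\<close> in blast)+
    qed
    moreover have "{} \<notin> P2" using ne vB av by (auto simp: P2_def)
    ultimately show ?thesis by (simp add: partition_on_def)
  qed
  have nc1: "noncrossing P1" by (rule noncrossing_subset[OF P(2)]) (simp add: P1_def)
  have nc2: "noncrossing P2"
    unfolding noncrossing_def
  proof (intro ballI impI notI, elim exE conjE)
    fix V W x y z t assume *: "V \<in> P2" "W \<in> P2" "V \<noteq> W" "x < y" "y < z" "z < t" "x \<in> V" "z \<in> V" "y \<in> W" "t \<in> W"
    \<comment> \<open>\<open>f\<close> puts \<open>a\<close> back into the shortened block; blocks
      only grow under it, so a crossing in \<open>P2\<close> is one in \<open>P\<close>.\<close>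
    define f where "f U = (if U = B - {a} then B else U)" for U
    have "f V \<in> P" "f W \<in> P" "V \<subseteq> f V" "W \<subseteq> f W" using * B by (auto simp: f_def P2_def)
    moreover have "f V \<noteq> f W" using * by (auto simp: f_def P2_def split: if_splits)
    ultimately show False using noncrossingD[OF P(2), of "f V" "f W" x y z t] * by blast
  qed
  have bl: "blk P2 v = B - {a}" by (rule partition_blkI[OF part2]) (use vB av in \<open>auto simp: P2_def\<close>)
  show "(case (P \<inter> Pow {a<..<v}, insert (blk P a - {a}) (P - {blk P a} - Pow {a<..<v})) of (P1, P2) \<Rightarrow>
         insert (insert a (blk P2 v)) (P1 \<union> (P2 - {blk P2 v}))) = P"
    unfolding B_def[symmetric] prod.case P1_def[symmetric] P2_def[symmetric] bl
    using B BnP1 BaP by (auto simp: P1_def P2_def insert_absorb)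
  show "(P \<inter> Pow {a<..<v}, insert (blk P a - {a}) (P - {blk P a} - Pow {a<..<v})) \<in> NCon {Suc a..<v} \<times> NCon {v..<b}"
    unfolding B_def[symmetric] P1_def[symmetric] P2_def[symmetric] using part1 part2 nc1 nc2 by (simp add: NCon_def)
  have fin: "finite P" using finite_partition[OF _ P(1)] by simp
  have finB: "finite B" using UP B(1) by (intro finite_subset[of B "{a..<b}"]) auto
  have card: "card (B - {a}) + Suc j = card B + j"
    using B finB by (metis add_Suc_right add_Suc card_Suc_Diff1)
  have rest: "P - {B} = P1 \<union> (P2 - {B - {a}})" "P1 \<inter> (P2 - {B - {a}}) = {}"
    using BnP1 BaP by (auto simp: P1_def P2_def)
  have "(\<Prod>V\<in>P - {B}. \<kappa> (card V)) = (\<Prod>V\<in>P1. \<kappa> (card V)) * (\<Prod>V\<in>P2 - {B - {a}}. \<kappa> (card V))"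
    unfolding rest(1) by (rule prod.union_disjoint) (use fin rest(2) in \<open>auto simp: P1_def P2_def\<close>)
  then show "(case (P \<inter> Pow {a<..<v}, insert (blk P a - {a}) (P - {blk P a} - Pow {a<..<v})) of (P1, P2) \<Rightarrow>
       (\<Prod>V\<in>P1. \<kappa> (card V)) * (\<kappa> (card (blk P2 v) + Suc j) * (\<Prod>V\<in>P2 - {blk P2 v}. \<kappa> (card V)))) =
       \<kappa> (card (blk P a) + j) * (\<Prod>V\<in>P - {blk P a}. \<kappa> (card V))"
    unfolding B_def[symmetric] prod.case P1_def[symmetric] P2_def[symmetric] bl card by (simp add: ac_simps)
next
  fix PP assume "PP \<in> NCon {Suc a..<v} \<times> NCon {v..<b}"
  then obtain P1 P2 where PP: "PP = (P1, P2)" and P1: "partition_on {Suc a..<v} P1" "noncrossing P1"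
    and P2: "partition_on {v..<b} P2" "noncrossing P2" by (auto simp: NCon_def)
  define W where "W = blk P2 v"
  define P where "P = insert (insert a W) (P1 \<union> (P2 - {W}))"
  have W: "W \<in> P2" "v \<in> W" using partition_blk[OF P2(1), of v] vb by (auto simp: W_def)
  have U1: "\<Union>P1 = {Suc a..<v}" and d1: "\<And>V W. V \<in> P1 \<Longrightarrow> W \<in> P1 \<Longrightarrow> V \<noteq> W \<Longrightarrow> V \<inter> W = {}" and ne1: "{} \<notin> P1"
    using P1(1) by (auto simp: partition_on_def disjoint_def)
  have U2: "\<Union>P2 = {v..<b}" and d2: "\<And>V W. V \<in> P2 \<Longrightarrow> W \<in> P2 \<Longrightarrow> V \<noteq> W \<Longrightarrow> V \<inter> W = {}" and ne2: "{} \<notin> P2"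
    using P2(1) by (auto simp: partition_on_def disjoint_def)
  have s1: "V \<subseteq> {Suc a..<v}" if "V \<in> P1" for V using that U1 by auto
  have s2: "V \<subseteq> {v..<b}" if "V \<in> P2" for V using that U2 by auto
  have d12: "V \<inter> V' = {}" if "V \<in> P1" "V' \<in> P2" for V V' using s1[OF that(1)] s2[OF that(2)] by fastforce
  have a1: "a \<notin> V" if "V \<in> P1" for V using s1[OF that] by auto
  have a2: "a \<notin> V" if "V \<in> P2" for V using s2[OF that] av by auto
  have UP: "\<Union>P = {a..<b}"
  proof -
    have "\<Union>P = insert a (\<Union>P1 \<union> \<Union>P2)" using W by (auto simp: P_def)
    then show ?thesis using U1 U2 av vb by auto
  qed
  have part: "partition_on {a..<b} P"
  proof -
    have dW: "insert a W \<inter> V = {}" if "V \<in> P1 \<union> (P2 - {W})" for V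
      using that d2[OF W(1)] d12[of V W] W a1[of V] a2[of V] by blast
    have dd: "V \<inter> V' = {}" if "V \<in> P1 \<union> (P2 - {W})" "V' \<in> P1 \<union> (P2 - {W})" "V \<noteq> V'" for V V'
      using that d1[of V V'] d2[of V V'] d12[of V V'] d12[of V' V] by blast
    have "disjoint P" unfolding disjoint_def
    proof (intro ballI impI)
      fix V V' assume "V \<in> P" "V' \<in> P" "V \<noteq> V'"
      then consider "V = insert a W" "V' \<in> P1 \<union> (P2 - {W})" | "V' = insert a W" "V \<in> P1 \<union> (P2 - {W})"
        | "V \<in> P1 \<union> (P2 - {W})" "V' \<in> P1 \<union> (P2 - {W})" unfolding P_def by blast
      then show "V \<inter> V' = {}"
        by cases (use dW dd[OF _ _ \<open>V \<noteq> V'\<close>] in blast)+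
    qed
    moreover have "{} \<notin> P" using ne1 ne2 by (auto simp: P_def)
    ultimately show ?thesis using UP by (simp add: partition_on_def)
  qed
  have bl: "blk P a = insert a W" by (rule partition_blkI[OF part]) (auto simp: P_def)
  have nc: "noncrossing P"
    unfolding noncrossing_def
  proof (intro ballI impI notI, elim exE conjE)
    fix V V' x y z t assume *: "V \<in> P" "V' \<in> P" "V \<noteq> V'" "x < y" "y < z" "z < t" "x \<in> V" "z \<in> V" "y \<in> V'" "t \<in> V'"
    have cases: "U \<in> P1 \<or> (U - {a} \<in> P2 \<and> (a \<in> U \<longrightarrow> U = insert a W))" if "U \<in> P" for U
      using that W a2 by (auto simp: P_def insert_absorb)
    have ge: "x \<ge> a" "y > a" "z > a" "t > a"
    proof -
      have "x \<in> {a..<b}" using * UP by blast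
      then show "x \<ge> a" "y > a" "z > a" "t > a" using *(4-6) by auto
    qed
    show False
    proof (cases "V \<in> P1")
      case True
      have "z \<in> {Suc a..<v}" using s1[OF True] *(8) by blast
      then have "y \<in> V' - {a}" "y \<notin> {v..<b}" using * ge by auto
      then have "V' \<in> P1" using cases[OF *(2)] s2[of "V' - {a}"] by blast
      then show False using noncrossingD[OF P1(2) True _ *(3), of x y z t] * by auto
    next
      case False
      then have V: "V - {a} \<in> P2" "a \<in> V \<longrightarrow> V = insert a W" using cases[OF *(1)] by auto
      have "z \<in> V - {a}" using * ge by auto
      then have zv: "z \<in> {v..<b}" using s2[OF V(1)] by blast
      then have "t \<notin> {Suc a..<v}" using * by auto
      then have "V' \<notin> P1" using s1[of V'] *(10) by blast
      then have V': "V' - {a} \<in> P2" using cases[OF *(2)] by auto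
      moreover have "y \<in> V' - {a}" using * ge by auto
      ultimately have "y \<in> {v..<b}" using s2[of "V' - {a}"] by blast
      then have yv: "y \<ge> v" by auto
      have VV: "V - {a} \<noteq> V' - {a}"
      proof
        assume e: "V - {a} = V' - {a}"
        moreover have "y \<in> V' - {a}" using * ge by auto
        ultimately have "y \<in> V" by blast
        then show False using *(9) disjointD[OF partition_onD2[OF part] *(1-3)] by blast
      qed
      show False
      proof (cases "x = a")
        case False
        then show False using noncrossingD[OF P2(2) V(1) V' VV, of x y z t] * ge by auto
      next
        case True
        then have "V = insert a W" using V * by auto
        then have "V - {a} = W" using a2[OF W(1)] by auto
        \<comment> \<open>When the crossing starts at \<open>a\<close>, the element \<open>v\<close>
          of the same block can replace it: y is not below \<open>v\<close>, and it differs from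
          \<open>v\<close> because the two blocks are disjoint.\<close>
        then have "v \<in> V - {a}" using W by auto
        moreover have "W \<inter> (V' - {a}) = {}" using d2[OF W(1) V'] VV \<open>V - {a} = W\<close> by blast
        then have "y \<noteq> v" using W(2) *(9) ge(2) by blast
        ultimately show False using noncrossingD[OF P2(2) V(1) V' VV, of v y z t] * ge yv by auto
      qed
    qed
  qed
  have Wi: "insert a W - {a} = W" using a2[OF W(1)] by auto
  have vW: "insert a W \<inter> {a<..<v} = {}" using s2[OF W(1)] by auto
  have nP1: "insert a W \<notin> P1" using a1 by auto
  have nP2: "insert a W \<notin> P2" using a2 by auto
  have nPow: "\<not> V \<subseteq> {a<..<v}" if "V \<in> P2" for V
  proof
    assume "V \<subseteq> {a<..<v}"
    then have "V = {}" using s2[OF that] by fastforce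
    then show False using ne2 that by blast
  qed
  have e1: "P \<inter> Pow {a<..<v} = P1"
  proof -
    have "V \<in> Pow {a<..<v}" if "V \<in> P1" for V using s1[OF that] by auto
    then show ?thesis using nPow by (auto simp: P_def)
  qed
  have e2: "P - {insert a W} - Pow {a<..<v} = P2 - {W}"
  proof -
    have "V \<in> Pow {a<..<v}" if "V \<in> P1" for V using s1[OF that] by auto
    then show ?thesis using nP2 nPow by (auto simp: P_def)
  qed
  have red: "(case PP of (P1, P2) \<Rightarrow> insert (insert a (blk P2 v)) (P1 \<union> (P2 - {blk P2 v}))) = P"
    by (simp add: PP P_def W_def)
  show "(\<lambda>P. (P \<inter> Pow {a<..<v}, insert (blk P a - {a}) (P - {blk P a} - Pow {a<..<v})))
      (case PP of (P1, P2) \<Rightarrow> insert (insert a (blk P2 v)) (P1 \<union> (P2 - {blk P2 v}))) = PP"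
    unfolding red bl e1 e2 Wi using W by (auto simp: PP)
  show "(case PP of (P1, P2) \<Rightarrow> insert (insert a (blk P2 v)) (P1 \<union> (P2 - {blk P2 v}))) \<in>
      {P \<in> NCon {a..<b}. v \<in> blk P a \<and> blk P a \<inter> {a<..<v} = {}}"
    unfolding red using part nc bl vW W by (auto simp: NCon_def)
qed

text \<open>The cases are sorted by the second element \<open>v\<close> of the first block; the
  leading term is the case of a singleton block.\<close>

lemma ncsum_first_rec:
  assumes ab: "a < b"
  shows "ncsum_first \<kappa> j a b = \<kappa> (Suc j) * ncsum \<kappa> (Suc a) b
    + (\<Sum>v\<in>{a<..<b}. ncsum \<kappa> (Suc a) v * ncsum_first \<kappa> (Suc j) v b)"
proof -
  define S0 where "S0 = {P\<in>NCon {a..<b}. blk P a = {a}}"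
  define S where "S v = {P\<in>NCon {a..<b}. v \<in> blk P a \<and> blk P a \<inter> {a<..<v} = {}}" for v
  have sub: "a \<in> blk P a" "blk P a \<subseteq> {a..<b}" if "P \<in> NCon {a..<b}" for P
  proof -
    have P: "partition_on {a..<b} P" using that by (simp add: NCon_def)
    show "a \<in> blk P a" "blk P a \<subseteq> {a..<b}"
      using partition_blk[OF P, of a] ab P by (auto simp: partition_on_def)
  qed
  have un: "NCon {a..<b} = S0 \<union> (\<Union>v\<in>{a<..<b}. S v)"
  proof (intro equalityI subsetI)
    fix P assume P: "P \<in> NCon {a..<b}"
    show "P \<in> S0 \<union> (\<Union>v\<in>{a<..<b}. S v)"
    proof (cases "blk P a = {a}")
      case False
      then have ex: "\<exists>v. v \<in> blk P a \<and> v \<noteq> a" using sub[OF P] by auto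
      define v where "v = (LEAST v. v \<in> blk P a \<and> v \<noteq> a)"
      have v: "v \<in> blk P a" "v \<noteq> a" using LeastI_ex[OF ex] by (auto simp: v_def)
      have "x \<notin> blk P a" if "a < x" "x < v" for x
        using not_less_Least[of x "\<lambda>v. v \<in> blk P a \<and> v \<noteq> a"] that unfolding v_def by blast
      then have "blk P a \<inter> {a<..<v} = {}" by auto
      moreover have "v \<in> {a..<b}" using v sub[OF P] by blast
      then have "v \<in> {a<..<b}" using v by auto
      ultimately show ?thesis using P v by (auto simp: S_def)
    qed (use P in \<open>auto simp: S0_def\<close>)
  qed (auto simp: S0_def S_def)
  have fin: "finite (NCon {a..<b})" by (simp add: finite_NCon)
  have "ncsum_first \<kappa> j a b =
      (\<Sum>P\<in>S0. \<kappa> (card (blk P a) + j) * (\<Prod>V\<in>P - {blk P a}. \<kappa> (card V))) +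
      (\<Sum>P\<in>(\<Union>v\<in>{a<..<b}. S v). \<kappa> (card (blk P a) + j) * (\<Prod>V\<in>P - {blk P a}. \<kappa> (card V)))"
    unfolding ncsum_first_def
    by (subst un, rule sum.union_disjoint) (use fin in \<open>auto simp: S0_def S_def intro: finite_subset\<close>)
  also have "(\<Sum>P\<in>(\<Union>v\<in>{a<..<b}. S v). \<kappa> (card (blk P a) + j) * (\<Prod>V\<in>P - {blk P a}. \<kappa> (card V))) =
    (\<Sum>v\<in>{a<..<b}. \<Sum>P\<in>S v. \<kappa> (card (blk P a) + j) * (\<Prod>V\<in>P - {blk P a}. \<kappa> (card V)))"
  proof (rule sum.UNION_disjoint)
    show "\<forall>v\<in>{a<..<b}. finite (S v)" using fin by (auto simp: S_def)
    show "\<forall>v\<in>{a<..<b}. \<forall>v'\<in>{a<..<b}. v \<noteq> v' \<longrightarrow> S v \<inter> S v' = {}"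
    proof (intro ballI impI)
      fix v v' assume "v \<in> {a<..<b}" "v' \<in> {a<..<b}" "v \<noteq> v'"
      then show "S v \<inter> S v' = {}" by (cases "v < v'") (auto simp: S_def)
    qed
  qed auto
  finally show ?thesis
    using ncsum_singleton_part[OF ab, of \<kappa> j] ncsum_second_part[of a _ b \<kappa> j]
    by (simp add: S0_def S_def)
qed

text \<open>Both claims are proved in one induction on the length, since the recursion for
  \<open>ncsum_first\<close> calls both sums on shorter intervals and \<open>ncsum\<close> is
  \<open>ncsum_first\<close> with shift 0.\<close>

lemma ncsum_shift:
  "(\<forall>a. ncsum \<kappa> a (a + d) = ncsum \<kappa> 0 d) \<and> (d > 0 \<longrightarrow> (\<forall>a j. ncsum_first \<kappa> j a (a + d) = ncsum_first \<kappa> j 0 d))"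
proof (induction d rule: less_induct)
  case (less d)
  show ?case
  proof (cases d)
    case (Suc n)
    have reindex: "(\<Sum>v\<in>{a<..<a + d}. h v) = (\<Sum>i<n. h (Suc a + i))" for a and h :: "nat \<Rightarrow> 'a"
      by (rule sum.reindex_bij_witness[of _ "\<lambda>i. Suc a + i" "\<lambda>v. v - Suc a"]) (auto simp: Suc)
    have step: "ncsum_first \<kappa> j a (a + d) = \<kappa> (Suc j) * ncsum \<kappa> 0 n
       + (\<Sum>i<n. ncsum \<kappa> 0 i * ncsum_first \<kappa> (Suc j) 0 (n - i))" for a j
    proof -
      have "ncsum_first \<kappa> j a (a + d) = \<kappa> (Suc j) * ncsum \<kappa> (Suc a) (Suc a + n)
         + (\<Sum>i<n. ncsum \<kappa> (Suc a) (Suc a + i) * ncsum_first \<kappa> (Suc j) (Suc a + i) (Suc a + i + (n - i)))"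
        by (subst ncsum_first_rec, use Suc in simp, subst reindex) (simp add: Suc)
      also have "\<dots> = \<kappa> (Suc j) * ncsum \<kappa> 0 n + (\<Sum>i<n. ncsum \<kappa> 0 i * ncsum_first \<kappa> (Suc j) 0 (n - i))"
      proof (intro arg_cong2[of _ _ _ _ "(+)"] arg_cong2[of _ _ _ _ "(*)"] sum.cong refl)
        show "ncsum \<kappa> (Suc a) (Suc a + n) = ncsum \<kappa> 0 n" using less.IH[of n] Suc by blast
        fix i assume i: "i \<in> {..<n}"
        show "ncsum \<kappa> (Suc a) (Suc a + i) = ncsum \<kappa> 0 i" using less.IH[of i] i Suc by (simp del: add_Suc)
        show "ncsum_first \<kappa> (Suc j) (Suc a + i) (Suc a + i + (n - i)) = ncsum_first \<kappa> (Suc j) 0 (n - i)"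
          using less.IH[of "n - i", THEN conjunct2] i Suc by (simp only: lessThan_iff)
      qed
      finally show ?thesis .
    qed
    have first: "ncsum_first \<kappa> j a (a + d) = ncsum_first \<kappa> j 0 d" for a j
      using step[of j a] step[of j 0] by simp
    moreover have "ncsum \<kappa> a (a + d) = ncsum \<kappa> 0 d" for a
      using first[of 0 a] Suc by (simp add: ncsum_eq_first)
    ultimately show ?thesis by blast
  qed simp
qed

lemma ncsum_first_Suc:
  "ncsum_first \<kappa> j 0 (Suc n) = \<kappa> (Suc j) * ncsum \<kappa> 0 n
       + (\<Sum>i<n. ncsum \<kappa> 0 i * ncsum_first \<kappa> (Suc j) 0 (n - i))"
proof -
  have "ncsum_first \<kappa> j 0 (Suc n) = \<kappa> (Suc j) * ncsum \<kappa> 1 (1 + n)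
     + (\<Sum>v\<in>{0<..<Suc n}. ncsum \<kappa> 1 v * ncsum_first \<kappa> (Suc j) v (Suc n))"
    by (subst ncsum_first_rec) auto
  also have "(\<Sum>v\<in>{0<..<Suc n}. ncsum \<kappa> 1 v * ncsum_first \<kappa> (Suc j) v (Suc n)) =
     (\<Sum>i<n. ncsum \<kappa> 1 (1 + i) * ncsum_first \<kappa> (Suc j) (Suc i) (Suc i + (n - i)))"
    by (rule sum.reindex_bij_witness[of _ "\<lambda>i. Suc i" "\<lambda>v. v - 1"]) auto
  also have "\<dots> = (\<Sum>i<n. ncsum \<kappa> 0 i * ncsum_first \<kappa> (Suc j) 0 (n - i))"
  proof (rule sum.cong[OF refl])
    fix i assume "i \<in> {..<n}"
    then have "ncsum \<kappa> 1 (1 + i) = ncsum \<kappa> 0 i"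
      "ncsum_first \<kappa> (Suc j) (Suc i) (Suc i + (n - i)) = ncsum_first \<kappa> (Suc j) 0 (n - i)"
      using ncsum_shift[of \<kappa> i] ncsum_shift[of \<kappa> "n - i"] by (blast, simp only: lessThan_iff zero_less_diff)
    then show "ncsum \<kappa> 1 (1 + i) * ncsum_first \<kappa> (Suc j) (Suc i) (Suc i + (n - i)) =
      ncsum \<kappa> 0 i * ncsum_first \<kappa> (Suc j) 0 (n - i)" by (simp only:)
  qed
  finally show ?thesis using ncsum_shift by metis
qed

text \<open>Let g = X M. Removing one element from the first block gives T_j = \<kappa>_(j+1) g + g
  T_(j+1); unrolling this from j = 0 produces the series of \<kappa>_j g^j.\<close>

lemma ncsum_fps_eq:
  fixes \<kappa> :: "nat \<Rightarrow> 'a::comm_ring_1"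
  defines "M \<equiv> Abs_fps (\<lambda>n. ncsum \<kappa> 0 n)" and "R \<equiv> Abs_fps (\<lambda>n. \<kappa> (Suc n))"
  shows "M = 1 + (fps_X * R) oo (fps_X * M)"
proof -
  \<comment> \<open>The constant coefficient is set to 0 because an empty interval has no first
    block, whereas \<open>ncsum_first\<close> would return \<kappa>_j there.\<close>
  define T where "T j = Abs_fps (\<lambda>n. if n = 0 then 0 else ncsum_first \<kappa> j 0 n)" for j
  have T: "T j = fps_const (\<kappa> (Suc j)) * (fps_X * M) + (fps_X * M) * T (Suc j)" for j
  proof (rule fps_ext)
    fix n
    show "T j $ n = (fps_const (\<kappa> (Suc j)) * (fps_X * M) + fps_X * M * T (Suc j)) $ n"
    proof (cases n)
      case (Suc k)
      have "(fps_X * M * T (Suc j)) $ Suc k = (\<Sum>i=0..k. ncsum \<kappa> 0 i * T (Suc j) $ (k - i))"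
        by (simp add: mult.assoc fps_mult_nth[of M]) (simp add: M_def)
      also have "\<dots> = (\<Sum>i<k. ncsum \<kappa> 0 i * T (Suc j) $ (k - i))"
        by (rule sum.mono_neutral_right) (auto simp: T_def)
      also have "\<dots> = (\<Sum>i<k. ncsum \<kappa> 0 i * ncsum_first \<kappa> (Suc j) 0 (k - i))"
        by (rule sum.cong) (auto simp: T_def)
      finally show ?thesis using Suc ncsum_first_Suc[of \<kappa> j k]
        by (simp add: T_def fps_mult_left_const_nth mult.assoc) (simp add: M_def)
    qed (simp add: T_def)
  qed
  define g where "g = fps_X * M"
  \<comment> \<open>The remainder \<open>g ^ k * T k\<close> has order at least \<open>k\<close>, so
    for each coefficient a finite unrolling is exact.\<close>
  have iter: "T 0 = (\<Sum>j<k. fps_const (\<kappa> (Suc j)) * g ^ Suc j) + g ^ k * T k" for k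
  proof (induction k)
    case (Suc k)
    show ?case by (subst Suc.IH, subst T) (simp add: g_def algebra_simps)
  qed simp
  have nth: "(g ^ k) $ n = 0" if "n < k" for k n
    using startsby_zero_power_prefix[of g k] that by (simp add: g_def)
  have "T 0 = (fps_X * R) oo g"
  proof (rule fps_ext)
    fix n
    have z: "(g ^ Suc n * T (Suc n)) $ n = 0" by (subst fps_mult_nth) (simp add: nth del: power_Suc)
    have "T 0 $ n = (\<Sum>j<Suc n. \<kappa> (Suc j) * (g ^ Suc j) $ n)"
      by (subst iter[of "Suc n"]) (simp only: fps_add_nth z fps_sum_nth fps_mult_left_const_nth add_0_right)
    also have "\<dots> = (\<Sum>j<n. \<kappa> (Suc j) * (g ^ Suc j) $ n)" using nth[of n "Suc n"] by simp
    also have "\<dots> = (\<Sum>i=0..n. (fps_X * R) $ i * (g ^ i) $ n)"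
      by (simp add: atLeast0AtMost[symmetric] sum.atLeast_Suc_atMost[of 0] sum.atLeast_Suc_atMost_Suc_shift
           sum.atLeast1_atMost_eq R_def atLeast0LessThan)
    finally show "T 0 $ n = ((fps_X * R) oo g) $ n" by (simp add: fps_compose_def)
  qed
  moreover have "M = 1 + T 0"
    by (rule fps_ext) (auto simp: M_def T_def ncsum_eq_first)
  ultimately show ?thesis by (simp add: g_def fps_compose_add_distrib)
qed

section \<open>Free cumulants and the functional equation of the R-transform\<close>

lemma sum_NC_eq_ncsum: "(\<Sum>P\<in>NC k. \<Prod>V\<in>P. \<kappa> (card V)) = ncsum \<kappa> 0 k"
proof -
  have "(\<Sum>P\<in>NC k. \<Prod>V\<in>P. \<kappa> (card V)) = ncsum \<kappa> 1 (1 + k)"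
    by (simp add: ncsum_def NC_def NCon_def atLeastLessThanSuc_atLeastAtMost)
  then show ?thesis using ncsum_shift by metis
qed

text \<open>The equation says that X/(1 + A) composed with g is X, so g is the compositional inverse
  of a fixed series.\<close>

lemma fps_functional_unique:
  fixes g g' A :: "'a::field fps"
  assumes "A $ 0 = 0" "g = fps_X * ((1 + A) oo g)" "g' = fps_X * ((1 + A) oo g')"
  shows "g = g'"
proof -
  define Q where "Q = fps_X * inverse (1 + A)"
  have Q: "Q $ 0 = 0" "Q $ 1 \<noteq> 0" using assms(1) by (simp_all add: Q_def)
  have QX: "Q oo h = fps_X" if h: "h = fps_X * ((1 + A) oo h)" for h
  proof -
    have h0: "h $ 0 = 0" by (subst h) simp
    have nz: "((1 + A) oo h) $ 0 \<noteq> 0" using assms(1) by simp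
    have "Q oo h = h * inverse ((1 + A) oo h)"
      unfolding Q_def fps_compose_mult_distrib[OF h0]
      by (subst fps_inverse_compose[OF h0]) (use assms(1) h0 in auto)
    also have "\<dots> = fps_X * (((1 + A) oo h) * inverse ((1 + A) oo h))" by (subst (1) h) (simp add: mult.assoc)
    also have "\<dots> = fps_X" using inverse_mult_eq_1'[OF nz] by simp
    finally show ?thesis .
  qed
  have *: "h = fps_inv Q" if h: "h = fps_X * ((1 + A) oo h)" for h
  proof -
    have h0: "h $ 0 = 0" by (subst h) simp
    have "h = (fps_inv Q oo Q) oo h" using fps_inv[OF Q] h0 by simp
    also have "\<dots> = fps_inv Q oo (Q oo h)" by (rule fps_compose_assoc[symmetric]) (use Q h0 in auto)
    also have "\<dots> = fps_inv Q" using QX[OF h] by simp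
    finally show ?thesis .
  qed
  show ?thesis using *[OF assms(2)] *[OF assms(3)] by simp
qed

lemma fps_compose_cancel_right:
  fixes g A B :: "'a::field fps"
  assumes "g $ 0 = 0" "g $ 1 \<noteq> 0" "A oo g = B oo g"
  shows "A = B"
proof -
  have gi: "fps_inv g $ 0 = 0" by (simp add: fps_inv_def)
  have "A = A oo (g oo fps_inv g)" "B = B oo (g oo fps_inv g)" using fps_inv_right[OF assms(1,2)] by simp_all
  moreover have "A oo (g oo fps_inv g) = B oo (g oo fps_inv g)"
    using assms(3) fps_compose_assoc[OF gi assms(1)] by metis
  ultimately show ?thesis by simp
qed

text \<open>\<open>mser \<mu>\<close> is the expansion of \<open>G\<^sub>\<mu>(1/u)\<close>; \<open>Rc\<close> is the R-transform with complex coefficients.\<close>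

definition mser :: "real measure \<Rightarrow> complex fps" where
  "mser \<mu> = fps_X * Abs_fps (\<lambda>n. of_real (moment \<mu> n))"

definition Rc :: "real measure \<Rightarrow> complex fps" where
  "Rc \<mu> = Abs_fps (\<lambda>n. of_real (R_transform \<mu> $ n))"

lemma mser_nth: "mser \<mu> $ n = (if n = 0 then 0 else of_real (moment \<mu> (n - 1)))"
  by (simp add: mser_def)

lemma ncsum_of_real: "ncsum (\<lambda>n. of_real (\<kappa> n) :: 'a::{real_algebra_1,comm_ring_1}) a b = of_real (ncsum \<kappa> a b)"
  by (simp add: ncsum_def)

text \<open>Justifies the definite description. By the functional equation the cumulant series
  composed with g is M - 1, and g is invertible under composition; this gives uniqueness and also
  the only candidate.\<close>

lemma free_cumulant_spec:
  assumes "moment \<mu> 0 = 1"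
  shows "free_cumulant \<mu> 0 = 0" "moment \<mu> k = ncsum (free_cumulant \<mu>) 0 k"
proof -
  define M where "M = Abs_fps (moment \<mu>)"
  define g where "g = fps_X * M"
  have g: "g $ 0 = 0" "g $ 1 \<noteq> 0" using assms by (simp_all add: g_def M_def)
  have gi: "fps_inv g $ 0 = 0" by (simp add: fps_inv_def)
  define Q where "Q \<kappa> \<longleftrightarrow> \<kappa> 0 = 0 \<and> (\<forall>k\<ge>1. moment \<mu> k = (\<Sum>\<pi>\<in>NC k. \<Prod>V\<in>\<pi>. \<kappa> (card V)))" for \<kappa> :: "nat \<Rightarrow> real"
  \<comment> \<open>The case k = 0 may be added: the empty partition contributes 1, which is the
    total mass.\<close>
  have Q_iff: "Q \<kappa> \<longleftrightarrow> \<kappa> 0 = 0 \<and> (\<forall>k. moment \<mu> k = ncsum \<kappa> 0 k)" for \<kappa>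
    using assms unfolding Q_def sum_NC_eq_ncsum by (metis ncsum_empty le_numeral_extra(3) less_one not_le)
  have sh: "fps_X * Abs_fps (\<lambda>n. \<kappa> (Suc n)) = Abs_fps \<kappa>" if "\<kappa> 0 = 0" for \<kappa> :: "nat \<Rightarrow> real"
    using that by (auto simp: fps_eq_iff)
  have eq: "M = 1 + Abs_fps \<kappa> oo g" if "Q \<kappa>" for \<kappa>
  proof -
    have "M = Abs_fps (\<lambda>n. ncsum \<kappa> 0 n)" using that by (auto simp: Q_iff M_def fps_eq_iff)
    then show ?thesis using ncsum_fps_eq[of \<kappa>] sh[of \<kappa>] that by (simp add: Q_iff g_def)
  qed
  have unique: "\<kappa> = \<kappa>'" if "Q \<kappa>" "Q \<kappa>'" for \<kappa> \<kappa>'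
  proof -
    have "Abs_fps \<kappa> oo g = Abs_fps \<kappa>' oo g" using eq[OF that(1)] eq[OF that(2)] by (simp add: fps_compose_add_distrib)
    then have "Abs_fps \<kappa> = Abs_fps \<kappa>'" by (rule fps_compose_cancel_right[OF g])
    then show ?thesis by (auto simp: fps_eq_iff fun_eq_iff)
  qed
  define A where "A = (M - 1) oo fps_inv g"
  have A0: "A $ 0 = 0" using assms by (simp add: A_def M_def)
  have Ag: "A oo g = M - 1"
  proof -
    have "A oo g = (M - 1) oo (fps_inv g oo g)"
      unfolding A_def by (rule fps_compose_assoc[symmetric]) (use g gi in auto)
    then show ?thesis using fps_inv[OF g] by simp
  qed
  \<comment> \<open>To see that the candidate \<open>A\<close> works, the moments \<open>M'\<close>
    it generates are shown to solve the functional equation that \<open>M\<close> solves.\<close>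
  define M' where "M' = Abs_fps (\<lambda>n. ncsum (fps_nth A) 0 n)"
  have M': "M' = 1 + A oo (fps_X * M')"
    using ncsum_fps_eq[of "fps_nth A"] sh[of "fps_nth A"] A0 by (simp add: M'_def fps_nth_inverse)
  have "g = fps_X * M'"
  proof (rule fps_functional_unique[OF A0])
    show "g = fps_X * ((1 + A) oo g)" using Ag by (simp add: fps_compose_add_distrib g_def)
    show "fps_X * M' = fps_X * ((1 + A) oo (fps_X * M'))"
      using M' by (simp add: fps_compose_add_distrib)
  qed
  then have "M = M'" by (simp add: g_def)
  then have "Q (fps_nth A)" using A0 by (auto simp: Q_iff M_def M'_def fps_eq_iff)
  then have "Q (free_cumulant \<mu>)"
    unfolding free_cumulant_def Q_def[symmetric] using unique theI[of Q] by blast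
  then show "free_cumulant \<mu> 0 = 0" "moment \<mu> k = ncsum (free_cumulant \<mu>) 0 k" by (auto simp: Q_iff)
qed

lemma mser_R_eq:
  assumes "moment \<mu> 0 = 1"
  shows "mser \<mu> = fps_X * ((1 + fps_X * Rc \<mu>) oo mser \<mu>)"
proof -
  have "ncsum (\<lambda>n. complex_of_real (free_cumulant \<mu> n)) 0 k = of_real (moment \<mu> k)" for k
    by (simp only: ncsum_of_real free_cumulant_spec(2)[OF assms, symmetric])
  then have "Abs_fps (\<lambda>n. complex_of_real (moment \<mu> n)) = 1 + (fps_X * Rc \<mu>) oo mser \<mu>"
    using ncsum_fps_eq[of "\<lambda>n. complex_of_real (free_cumulant \<mu> n)"]
    by (simp add: mser_def Rc_def R_transform_def)
  then show ?thesis by (simp add: mser_def fps_compose_add_distrib)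
qed

text \<open>The means of computing R-transforms later on: it suffices to exhibit a series solving
  the relation. Total mass one is the form of the assumption that is also at hand for the beta
  distribution.\<close>

lemma mser_R_unique:
  assumes "moment \<mu> 0 = 1" "mser \<mu> = fps_X * ((1 + fps_X * S) oo mser \<mu>)"
  shows "S = Rc \<mu>"
proof -
  have g: "mser \<mu> $ 0 = 0" "mser \<mu> $ 1 \<noteq> 0" using assms(1) by (simp_all add: mser_nth)
  have "(1 + fps_X * S) oo mser \<mu> = (1 + fps_X * Rc \<mu>) oo mser \<mu>"
    using assms(2) mser_R_eq[OF assms(1)] by (metis fps_X_neq_zero mult_left_cancel)
  then have "1 + fps_X * S = 1 + fps_X * Rc \<mu>" by (rule fps_compose_cancel_right[OF g])
  then show ?thesis by simp
qed

section \<open>Stieltjes transforms of compactly supported measures\<close>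

definition supp_le :: "real measure \<Rightarrow> real \<Rightarrow> bool" where
  "supp_le \<mu> K \<longleftrightarrow> K > 0 \<and> (AE t in \<mu>. \<bar>t\<bar> \<le> K)"

lemma cs_probD:
  assumes "cs_prob \<mu>"
  shows "real_distribution \<mu>" "prob_space \<mu>" "sets \<mu> = sets borel" "space \<mu> = UNIV"
proof -
  show *: "prob_space \<mu>" "sets \<mu> = sets borel" using assms by (auto simp: cs_prob_def)
  then show sp: "space \<mu> = UNIV" using sets_eq_imp_space_eq[OF *(2)] by simp
  show "real_distribution \<mu>"
    using * sp by (simp add: real_distribution_def real_distribution_axioms_def)
qed

lemma cs_prob_supp:
  assumes "cs_prob \<mu>"
  obtains K where "supp_le \<mu> K"
proof -
  obtain C where C: "compact C" "emeasure \<mu> (UNIV - C) = 0" using assms by (auto simp: cs_prob_def)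
  obtain K where K: "K > 0" "\<And>x. x \<in> C \<Longrightarrow> norm x \<le> K"
    using compact_imp_bounded[OF C(1)] by (auto simp: bounded_pos)
  have "UNIV - C \<in> sets \<mu>"
    using cs_probD(3)[OF assms] compact_imp_closed[OF C(1)] by auto
  then have "AE t in \<mu>. t \<notin> UNIV - C" using C(2) by (intro AE_not_in) (auto simp: null_sets_def)
  then have "AE t in \<mu>. \<bar>t\<bar> \<le> K" by eventually_elim (use K in auto)
  then show ?thesis using that K by (auto simp: supp_le_def)
qed

lemma cs_probI:
  assumes "real_distribution \<mu>" "AE t in \<mu>. \<bar>t\<bar> \<le> K"
  shows "cs_prob \<mu>"
proof -
  interpret real_distribution \<mu> by fact
  have "emeasure \<mu> (UNIV - {-K..K}) = 0"
  proof (subst AE_iff_measurable[symmetric, where P = "\<lambda>t. t \<in> {-K..K}" and M = \<mu>])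
    show "AE t in \<mu>. t \<in> {-K..K}" using assms(2) by eventually_elim auto
  qed (auto simp: events_eq_borel space_eq_univ)
  then show ?thesis unfolding cs_prob_def using prob_space_axioms events_eq_borel
    by (metis compact_Icc)
qed

lemma integrable_power:
  assumes "cs_prob \<mu>"
  shows "integrable \<mu> (\<lambda>t. t ^ k)"
proof -
  obtain K where K: "supp_le \<mu> K" using cs_prob_supp[OF assms] .
  interpret real_distribution \<mu> using cs_probD[OF assms] by simp
  show ?thesis
  proof (rule integrable_const_bound[where B = "K ^ k"])
    show "AE t in \<mu>. norm (t ^ k) \<le> K ^ k"
      using K unfolding supp_le_def by (auto simp: power_abs elim!: eventually_mono intro!: power_mono)
  qed simp
qed

lemma moment_0:
  assumes "cs_prob \<mu>" shows "moment \<mu> 0 = 1"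
  using prob_space.prob_space[OF cs_probD(2)[OF assms]] by (simp add: moment_def)

text \<open>Dominated summation on the support. It serves twice: with the exponential series for
  characteristic functions and with the geometric series for Stieltjes transforms.\<close>

lemma integral_power_series:
  fixes a :: "nat \<Rightarrow> complex"
  assumes \<mu>: "cs_prob \<mu>" and K: "supp_le \<mu> K" and summ: "summable (\<lambda>k. norm (a k) * K ^ k)"
  shows "(\<lambda>k. a k * of_real (moment \<mu> k)) sums (LINT t|\<mu>. (\<Sum>k. a k * of_real t ^ k))"
proof -
  interpret real_distribution \<mu> using cs_probD[OF \<mu>] by simp
  have int: "integrable \<mu> (\<lambda>t. a k * of_real t ^ k)" for k
  proof -
    have "integrable \<mu> (\<lambda>t. a k * complex_of_real (t ^ k))"
      using integrable_power[OF \<mu>, of k] by (intro integrable_mult_right integrable_of_real)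
    then show ?thesis by simp
  qed
  have le: "AE t in \<mu>. \<forall>k. norm (a k * of_real t ^ k) \<le> norm (a k) * K ^ k"
    using K unfolding supp_le_def
    by (auto simp: norm_mult norm_power elim!: eventually_mono intro!: mult_left_mono power_mono)
  have "(\<lambda>k. LINT t|\<mu>. a k * of_real t ^ k) sums (LINT t|\<mu>. (\<Sum>k. a k * of_real t ^ k))"
  proof (rule sums_integral[OF int])
    show "AE t in \<mu>. summable (\<lambda>k. norm (a k * complex_of_real t ^ k))"
      using le by eventually_elim (rule summable_comparison_test[OF _ summ], auto)
    show "summable (\<lambda>k. LINT t|\<mu>. norm (a k * complex_of_real t ^ k))"
    proof (rule summable_comparison_test[OF _ summ], intro exI allI impI)
      fix k
      have "(LINT t|\<mu>. norm (a k * complex_of_real t ^ k)) \<le> (LINT t|\<mu>. norm (a k) * K ^ k)"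
        by (rule integral_mono_AE) (use int le in \<open>auto elim!: eventually_mono\<close>)
      then show "norm (LINT t|\<mu>. norm (a k * complex_of_real t ^ k)) \<le> norm (a k) * K ^ k"
        using prob_space by simp
    qed
  qed
  moreover have "(LINT t|\<mu>. a k * of_real t ^ k) = a k * of_real (moment \<mu> k)" for k
    unfolding moment_def of_real_power[symmetric] by (simp only: integral_mult_right_zero integral_complex_of_real)
  ultimately show ?thesis by (simp only:)
qed

text \<open>The moments give the Taylor coefficients of the characteristic function.\<close>

lemma cs_prob_moments_unique:
  assumes "cs_prob \<mu>" "cs_prob \<nu>" "\<And>k. moment \<mu> k = moment \<nu> k"
  shows "\<mu> = \<nu>"
proof (rule Levy_uniqueness[OF cs_probD(1)[OF assms(1)] cs_probD(1)[OF assms(2)]], rule ext)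
  fix x
  have *: "(\<lambda>k. (\<i> * of_real x) ^ k / fact k * of_real (moment \<rho> k)) sums char \<rho> x" if \<rho>: "cs_prob \<rho>" for \<rho>
  proof -
    obtain K where K: "supp_le \<rho> K" using cs_prob_supp[OF \<rho>] .
    have "(LINT t|\<rho>. (\<Sum>k. (\<i> * of_real x) ^ k / fact k * of_real t ^ k)) = char \<rho> x"
      unfolding char_def
    proof (intro Bochner_Integration.integral_cong refl)
      fix t
      have "(\<lambda>k. (\<i> * of_real x) ^ k / fact k * of_real t ^ k) sums exp (\<i> * of_real (x * t))"
        using exp_converges[of "\<i> * complex_of_real (x * t)"]
        by (simp add: scaleR_conv_of_real power_mult_distrib field_simps)
      then show "(\<Sum>k. (\<i> * of_real x) ^ k / fact k * of_real t ^ k) = iexp (x * t)"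
        by (simp add: sums_iff)
    qed
    moreover have "summable (\<lambda>k. norm ((\<i> * of_real x) ^ k / fact k :: complex) * K ^ k)"
    proof -
      have "summable (\<lambda>k. (\<bar>x\<bar> * K) ^ k / fact k)"
        using summable_exp[of "\<bar>x\<bar> * K"] by (simp add: field_simps)
      then show ?thesis by (simp add: norm_mult norm_power norm_divide power_mult_distrib)
    qed
    ultimately show ?thesis using integral_power_series[OF \<rho> K] by metis
  qed
  show "char \<mu> x = char \<nu> x"
    using *[OF assms(1)] *[OF assms(2)] assms(3) by (simp add: sums_iff)
qed

section \<open>Expansion, holomorphy and sign of the Stieltjes transform\<close>

lemma stieltjes_sums:
  assumes \<mu>: "cs_prob \<mu>" and K: "supp_le \<mu> K" and z: "norm z > K"
  shows "(\<lambda>k. of_real (moment \<mu> k) / z ^ Suc k) sums stieltjes \<mu> z"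
proof -
  have K0: "K > 0" and z0: "z \<noteq> 0" using K z by (auto simp: supp_le_def)
  have "(\<lambda>k. 1 / z ^ Suc k * of_real (moment \<mu> k)) sums (LINT t|\<mu>. (\<Sum>k. 1 / z ^ Suc k * of_real t ^ k))"
  proof (rule integral_power_series[OF \<mu> K])
    have "summable (\<lambda>k. 1 / norm z * (K / norm z) ^ k)"
      using K0 z by (intro summable_mult summable_geometric) (auto simp: divide_less_eq)
    then show "summable (\<lambda>k. norm (1 / z ^ Suc k) * K ^ k)"
      by (simp add: norm_divide norm_mult norm_power power_divide field_simps)
  qed
  moreover have "(LINT t|\<mu>. (\<Sum>k. 1 / z ^ Suc k * of_real t ^ k)) = stieltjes \<mu> z"
    unfolding stieltjes_def
  proof (rule integral_cong_AE)
    show "AE t in \<mu>. (\<Sum>k. 1 / z ^ Suc k * complex_of_real t ^ k) = 1 / (z - complex_of_real t)"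
      using K unfolding supp_le_def
    proof (elim conjE, elim eventually_mono)
      fix t assume "\<bar>t\<bar> \<le> K"
      then have lt: "norm (of_real t / z) < 1" using z K0 by (simp add: norm_divide divide_simps)
      have "(\<lambda>k. 1 / z * (of_real t / z) ^ k) sums (1 / z * (1 / (1 - of_real t / z)))"
        by (intro sums_mult geometric_sums lt)
      also have "1 / z * (1 / (1 - of_real t / z)) = 1 / (z - of_real t)" using z0 by (simp add: field_simps)
      also have "(\<lambda>k. 1 / z * (of_real t / z) ^ k) = (\<lambda>k. 1 / z ^ Suc k * of_real t ^ k)"
        by (simp add: power_divide)
      finally show "(\<Sum>k. 1 / z ^ Suc k * complex_of_real t ^ k) = 1 / (z - complex_of_real t)"
        by (simp add: sums_iff)
    qed
  qed (use cs_probD(3)[OF \<mu>] in \<open>simp_all cong: measurable_cong_sets\<close>)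
  ultimately show ?thesis by simp
qed

text \<open>The upper half plane joined to a neighbourhood of infinity: signs of imaginary parts are
  controlled on the first piece, power series on the second.\<close>

definition OmegaR :: "real \<Rightarrow> complex set" where
  "OmegaR R = {z. Im z > 0} \<union> {z. norm z > R}"

lemma open_OmegaR: "open (OmegaR R)"
  unfolding OmegaR_def
  by (intro open_Un open_Collect_less continuous_intros)

lemma dist_support:
  assumes z: "z \<in> OmegaR K"
  obtains d where "d > 0" "\<forall>t. \<bar>t\<bar> \<le> K \<longrightarrow> norm (z - complex_of_real t) \<ge> d"
proof (cases "Im z > 0")
  case True
  have "norm (z - complex_of_real t) \<ge> Im z" for t using abs_Im_le_cmod[of "z - of_real t"] by simp
  then show ?thesis using that True by blast
next
  case False
  then have "norm z > K" using z by (auto simp: OmegaR_def)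
  moreover have "norm (z - complex_of_real t) \<ge> norm z - K" if "\<bar>t\<bar> \<le> K" for t
    using norm_triangle_ineq2[of z "of_real t"] that by simp
  ultimately show ?thesis using that[of "norm z - K"] by auto
qed

lemma stieltjes_integrable:
  assumes \<mu>: "cs_prob \<mu>" and K: "supp_le \<mu> K" and z: "z \<in> OmegaR K"
  shows "integrable \<mu> (\<lambda>t. 1 / (z - complex_of_real t))"
proof -
  interpret real_distribution \<mu> using cs_probD[OF \<mu>] by simp
  obtain d where d: "d > 0" "\<forall>t. \<bar>t\<bar> \<le> K \<longrightarrow> norm (z - complex_of_real t) \<ge> d"
    using dist_support[OF z] by blast
  show ?thesis
  proof (rule integrable_const_bound[where B = "1 / d"])
    show "AE t in \<mu>. norm (1 / (z - complex_of_real t)) \<le> 1 / d"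
      using K unfolding supp_le_def
    proof (elim conjE, elim eventually_mono)
      fix t assume "\<bar>t\<bar> \<le> K"
      then have "norm (z - complex_of_real t) \<ge> d" using d by simp
      then show "norm (1 / (z - complex_of_real t)) \<le> 1 / d"
        unfolding norm_divide norm_one by (intro frac_le) (use d in auto)
    qed
  qed simp
qed

lemma diff_quotient_inverse:
  fixes A B :: "'a::field"
  assumes "A \<noteq> 0" "B \<noteq> 0" "A \<noteq> B"
  shows "(1 / A - 1 / B) / (A - B) + 1 / B ^ 2 = (A - B) / (A * B ^ 2)"
proof -
  have "1 / A - 1 / B = - (A - B) / (A * B)" using assms by (simp add: field_simps)
  moreover have "A - B \<noteq> 0" using assms by simp
  ultimately have "(1 / A - 1 / B) / (A - B) = - 1 / (A * B)" by (simp del: right_minus_eq minus_diff_eq)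
  then show ?thesis using assms by (simp add: field_simps power2_eq_square)
qed

text \<open>Used with A = w - t and B = z - t. Points w closer to z than d/2 keep the distance d/2
  from the support, which makes the bound uniform in t.\<close>

lemma diff_quotient_inverse_bound:
  fixes A B :: complex
  assumes "d > 0" "norm B \<ge> d" "norm A \<ge> d / 2" "A \<noteq> B"
  shows "norm ((1 / A - 1 / B) / (A - B) + 1 / B ^ 2) \<le> norm (A - B) * (2 / d ^ 3)"
proof -
  have nz: "A \<noteq> 0" "B \<noteq> 0" using assms by auto
  have "norm ((1 / A - 1 / B) / (A - B) + 1 / B ^ 2) = norm (A - B) / (norm A * norm B ^ 2)"
    by (simp only: diff_quotient_inverse[OF nz assms(4)] norm_divide norm_mult norm_power)
  also have "\<dots> \<le> norm (A - B) / (d / 2 * d ^ 2)"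
    using assms by (intro divide_left_mono mult_mono power_mono mult_pos_pos zero_less_power) auto
  also have "\<dots> = norm (A - B) * (2 / d ^ 3)" by (simp add: power3_eq_cube power2_eq_square)
  finally show ?thesis .
qed

text \<open>Differentiation under the integral: the error of the difference quotient is at most a
  constant times |w - z|, uniformly on the support.\<close>

lemma stieltjes_holomorphic:
  assumes \<mu>: "cs_prob \<mu>" and K: "supp_le \<mu> K"
  shows "stieltjes \<mu> holomorphic_on OmegaR K"
proof (rule holomorphic_onI)
  fix z assume z: "z \<in> OmegaR K"
  interpret real_distribution \<mu> using cs_probD[OF \<mu>] by simp
  obtain d where d: "d > 0" "\<forall>t. \<bar>t\<bar> \<le> K \<longrightarrow> norm (z - complex_of_real t) \<ge> d"
    using dist_support[OF z] by blast
  have AEK: "AE t in \<mu>. \<bar>t\<bar> \<le> K" using K by (simp add: supp_le_def)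
  have int2: "integrable \<mu> (\<lambda>t. 1 / (z - complex_of_real t) ^ 2)"
  proof (rule integrable_const_bound[where B = "1 / d ^ 2"])
    show "AE t in \<mu>. norm (1 / (z - complex_of_real t) ^ 2) \<le> 1 / d ^ 2"
      using K unfolding supp_le_def
    proof (elim conjE, elim eventually_mono)
      fix t assume "\<bar>t\<bar> \<le> K"
      then have "norm (z - complex_of_real t) \<ge> d" using d by simp
      then show "norm (1 / (z - complex_of_real t) ^ 2) \<le> 1 / d ^ 2"
        unfolding norm_divide norm_power norm_one by (intro frac_le power_mono) (use d in auto)
    qed
  qed simp
  define D where "D = - (LINT t|\<mu>. 1 / (z - complex_of_real t) ^ 2)"
  have est: "norm ((stieltjes \<mu> w - stieltjes \<mu> z) / (w - z) - D) \<le> norm (w - z) * (2 / d ^ 3)"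
    if w: "w \<noteq> z" "norm (w - z) < d / 2" "w \<in> OmegaR K" for w
  proof -
    have eq: "(stieltjes \<mu> w - stieltjes \<mu> z) / (w - z) - D =
       (LINT t|\<mu>. (1 / (w - of_real t) - 1 / (z - of_real t)) / (w - z) + 1 / (z - of_real t) ^ 2)"
      unfolding stieltjes_def D_def using stieltjes_integrable[OF \<mu> K w(3)] stieltjes_integrable[OF \<mu> K z] int2
      by simp
    have "norm ((stieltjes \<mu> w - stieltjes \<mu> z) / (w - z) - D) \<le> (LINT t|\<mu>. norm ((1 / (w - of_real t) - 1 / (z - of_real t)) / (w - z) + 1 / (z - of_real t) ^ 2))"
      unfolding eq by (rule integral_norm_bound)
    also have "\<dots> \<le> (LINT t|\<mu>. norm (w - z) * (2 / d ^ 3))"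
    proof (rule integral_mono_AE)
      show "AE t in \<mu>. norm ((1 / (w - of_real t) - 1 / (z - of_real t)) / (w - z) + 1 / (z - of_real t) ^ 2) \<le> norm (w - z) * (2 / d ^ 3)"
        using AEK
      proof eventually_elim
        case (elim t)
        have zt: "norm (z - of_real t) \<ge> d" using d(2) elim by blast
        have "norm (z - of_real t) \<le> norm (w - of_real t) + norm (w - z)"
          using norm_triangle_ineq4[of "w - of_real t" "w - z"] by simp
        then have wt: "norm (w - of_real t) \<ge> d / 2" using w zt by linarith
        show "norm ((1 / (w - of_real t) - 1 / (z - of_real t)) / (w - z) + 1 / (z - of_real t) ^ 2) \<le> norm (w - z) * (2 / d ^ 3)"
          using diff_quotient_inverse_bound[OF d(1) zt wt] w(1) by simp
      qed
    qed (use stieltjes_integrable[OF \<mu> K w(3)] stieltjes_integrable[OF \<mu> K z] int2 in auto)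
    also have "\<dots> = norm (w - z) * (2 / d ^ 3)" using prob_space by simp
    finally show ?thesis .
  qed
  have "((\<lambda>w. (stieltjes \<mu> w - stieltjes \<mu> z) / (w - z) - D) \<longlongrightarrow> 0) (at z)"
  proof (rule Lim_null_comparison)
    show "\<forall>\<^sub>F w in at z. norm ((stieltjes \<mu> w - stieltjes \<mu> z) / (w - z) - D) \<le> norm (w - z) * (2 / d ^ 3)"
    proof -
      have "\<forall>\<^sub>F w in at z. w \<in> OmegaR K" using eventually_at_in_open'[OF open_OmegaR z] .
      moreover have "\<forall>\<^sub>F w in at z. dist w z < d / 2 \<and> w \<noteq> z"
        using d unfolding eventually_at by (intro exI[of _ "d / 2"]) auto
      ultimately show ?thesis by eventually_elim (use est in \<open>auto simp: dist_norm\<close>)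
    qed
    have "((\<lambda>w. norm (w - z) * (2 / d ^ 3)) \<longlongrightarrow> norm (z - z) * (2 / d ^ 3)) (at z)"
      by (intro tendsto_intros)
    then show "((\<lambda>w. norm (w - z) * (2 / d ^ 3)) \<longlongrightarrow> 0) (at z)" by simp
  qed
  then have "(stieltjes \<mu> has_field_derivative D) (at z)"
    unfolding has_field_derivative_iff using Lim_null by blast
  then show "stieltjes \<mu> field_differentiable at z within OmegaR K"
    using field_differentiable_at_within field_differentiable_def by blast
qed

lemma stieltjes_cnj: "stieltjes \<mu> (cnj z) = cnj (stieltjes \<mu> z)"
  by (simp add: stieltjes_def Bochner_Integration.integral_cnj[symmetric] del: Bochner_Integration.integral_cnj)

text \<open>By Cauchy-Schwarz; the first inequality says \<open>Im (1/G) \<ge> Im z\<close>.\<close>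

lemma stieltjes_Im_le:
  assumes \<mu>: "cs_prob \<mu>" and z: "Im z > 0"
  shows "Im z * norm (stieltjes \<mu> z) ^ 2 \<le> - Im (stieltjes \<mu> z)" and "Im (stieltjes \<mu> z) < 0"
proof -
  interpret real_distribution \<mu> using cs_probD[OF \<mu>] by simp
  obtain K where K: "supp_le \<mu> K" using cs_prob_supp[OF \<mu>] .
  have zO: "z \<in> OmegaR K" using z by (simp add: OmegaR_def)
  note int = stieltjes_integrable[OF \<mu> K zO]
  have intn: "integrable \<mu> (\<lambda>t. norm (1 / (z - complex_of_real t)))" using int by (rule integrable_norm)
  have Imeq: "Im (1 / (z - complex_of_real t)) = - Im z * norm (1 / (z - complex_of_real t)) ^ 2" for t
    by (simp add: Im_divide norm_divide power_divide cmod_power2)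
  have ImI: "Im (stieltjes \<mu> z) = (LINT t|\<mu>. - Im z * norm (1 / (z - complex_of_real t)) ^ 2)"
    unfolding stieltjes_def by (subst integral_Im[OF int, symmetric]) (simp only: Imeq)
  have int2: "integrable \<mu> (\<lambda>t. norm (1 / (z - complex_of_real t)) ^ 2)"
  proof -
    have "integrable \<mu> (\<lambda>t. Im (1 / (z - complex_of_real t)))" using int by (rule integrable_Im)
    then have "integrable \<mu> (\<lambda>t. - Im z * norm (1 / (z - complex_of_real t)) ^ 2)" by (simp only: Imeq)
    then show ?thesis using z by simp
  qed
  \<comment> \<open>Cauchy-Schwarz in the form that a variance is nonnegative.\<close>
  have CS: "expectation (\<lambda>t. norm (1 / (z - complex_of_real t))) ^ 2 \<le> (LINT t|\<mu>. norm (1 / (z - complex_of_real t)) ^ 2)"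
  proof -
    have "0 \<le> variance (\<lambda>t. norm (1 / (z - complex_of_real t)))" by (rule variance_positive)
    then show ?thesis using variance_eq[OF intn int2] by simp
  qed
  have "norm (stieltjes \<mu> z) ^ 2 \<le> expectation (\<lambda>t. norm (1 / (z - complex_of_real t))) ^ 2"
    unfolding stieltjes_def by (intro power_mono integral_norm_bound) simp
  also note CS
  finally have "norm (stieltjes \<mu> z) ^ 2 \<le> (LINT t|\<mu>. norm (1 / (z - complex_of_real t)) ^ 2)" .
  then show "Im z * norm (stieltjes \<mu> z) ^ 2 \<le> - Im (stieltjes \<mu> z)"
    unfolding ImI using z by simp
  \<comment> \<open>Strictness: a vanishing integral would force 1/(z - t) = 0 almost everywhere,
    which in the convention 1/0 = 0 means z = t, impossible off the real line.\<close>
  have pos: "expectation (\<lambda>t. norm (1 / (z - complex_of_real t))) > 0"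
  proof -
    have "expectation (\<lambda>t. norm (1 / (z - complex_of_real t))) \<noteq> 0"
    proof
      assume "expectation (\<lambda>t. norm (1 / (z - complex_of_real t))) = 0"
      then have "AE t in \<mu>. norm (1 / (z - complex_of_real t)) = 0"
        by (subst (asm) integral_nonneg_eq_0_iff_AE[OF intn]) auto
      then have "AE t in \<mu>. False"
      proof eventually_elim
        fix t assume "norm (1 / (z - complex_of_real t)) = 0"
        then have "z = of_real t" by simp
        then show False using z by simp
      qed
      then show False by (simp add: AE_False)
    qed
    moreover have "expectation (\<lambda>t. norm (1 / (z - complex_of_real t))) \<ge> 0" by simp
    ultimately show ?thesis by linarith
  qed
  have "0 < (LINT t|\<mu>. norm (1 / (z - complex_of_real t)) ^ 2)"
    by (rule less_le_trans[OF zero_less_power[OF pos] CS])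
  then show "Im (stieltjes \<mu> z) < 0" unfolding ImI using z by simp
qed

section \<open>Expansions at infinity\<close>

text \<open>The value at \<open>u = 0\<close> is prescribed because \<open>inverse 0 = 0\<close> would otherwise put \<open>f 0\<close> there.\<close>

definition has_inf_exp :: "(complex \<Rightarrow> complex) \<Rightarrow> complex fps \<Rightarrow> bool" where
  "has_inf_exp f F \<longleftrightarrow> (\<lambda>u. if u = 0 then F $ 0 else f (inverse u)) has_fps_expansion F"

lemma eventually_at_infinity_inverse:
  "eventually P (at_infinity :: complex filter) \<longleftrightarrow> eventually (\<lambda>u. P (inverse u)) (at 0)"
  by (simp add: at_to_infinity eventually_filtermap)

lemma has_inf_exp_iff:
  "has_inf_exp f F \<longleftrightarrow> fps_conv_radius F > 0 \<and> (\<forall>\<^sub>F z in at_infinity. f z = eval_fps F (inverse z))"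
proof -
  have "(\<forall>\<^sub>F u in nhds 0. eval_fps F u = (if u = 0 then F $ 0 else f (inverse u))) \<longleftrightarrow>
    (\<forall>\<^sub>F u in at 0. f (inverse u) = eval_fps F u)"
    by (simp add: eventually_nhds_conv_at eval_fps_at_0)
       (auto simp: eventually_at_filter elim: eventually_mono)
  then show ?thesis
    by (simp add: has_inf_exp_def has_fps_expansion_def eventually_at_infinity_inverse)
qed

lemma has_inf_exp_cong:
  assumes "has_inf_exp f F" "\<forall>\<^sub>F z in at_infinity. f z = f' z"
  shows "has_inf_exp f' F"
  using assms unfolding has_inf_exp_iff by (auto elim: eventually_elim2)

lemma has_inf_exp_unique:
  assumes "has_inf_exp f F" "has_inf_exp f' F'" "\<forall>\<^sub>F z in at_infinity. f z = f' z"
  shows "F = F'"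
proof -
  have "has_inf_exp f' F" using has_inf_exp_cong assms by blast
  then have "\<forall>\<^sub>F z in at_infinity. eval_fps F (inverse z) = eval_fps F' (inverse z)"
    using assms(2) unfolding has_inf_exp_iff by (auto elim: eventually_elim2)
  then have ev: "\<forall>\<^sub>F u in at 0. eval_fps F u = eval_fps F' u"
    by (simp add: eventually_at_infinity_inverse)
  have F: "fps_conv_radius F > 0" "fps_conv_radius F' > 0" using assms by (auto simp: has_inf_exp_iff)
  \<comment> \<open>The functions agree only on a punctured neighbourhood of u = 0; continuity
    supplies the missing point.\<close>
  have "(eval_fps F \<longlongrightarrow> eval_fps F 0) (at 0)" and lim': "(eval_fps F' \<longlongrightarrow> eval_fps F' 0) (at 0)"
    unfolding isCont_def[symmetric]
    using F by (auto intro!: continuous_eval_fps simp: zero_ereal_def)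
  from Lim_transform_eventually[OF this(1) ev] have "eval_fps F 0 = eval_fps F' 0"
    using lim' by (rule tendsto_unique[OF trivial_limit_at])
  then have "\<forall>\<^sub>F u in nhds 0. eval_fps F u = eval_fps F' u"
    using ev by (simp add: eventually_nhds_conv_at)
  then show ?thesis using eval_fps_eqD[OF F] by blast
qed

lemma has_inf_exp_eq_iff:
  assumes "has_inf_exp f F" "has_inf_exp f' F'"
  shows "(\<forall>\<^sub>F z in at_infinity. f z = f' z) \<longleftrightarrow> F = F'"
proof
  assume "F = F'"
  then show "\<forall>\<^sub>F z in at_infinity. f z = f' z"
    using assms unfolding has_inf_exp_iff by (auto elim: eventually_elim2)
qed (use has_inf_exp_unique[OF assms] in blast)

lemma has_inf_exp_compose:
  assumes "has_inf_exp f F" "F $ 0 = 0" "\<phi> has_fps_expansion \<Phi>"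
  shows "has_inf_exp (\<lambda>z. \<phi> (f z)) (\<Phi> oo F)"
proof -
  have "(\<phi> \<circ> (\<lambda>u. if u = 0 then F $ 0 else f (inverse u))) has_fps_expansion (\<Phi> oo F)"
    using assms by (intro has_fps_expansion_compose) (auto simp: has_inf_exp_def)
  moreover have "\<phi> 0 = \<Phi> $ 0" using has_fps_expansion_imp_0_eq_fps_nth_0[OF assms(3)] by simp
  ultimately show ?thesis unfolding has_inf_exp_def
    by (elim has_fps_expansion_cong[THEN iffD1, rotated -1]) (auto simp: assms)
qed

text \<open>Substitution of a function tending to infinity, for which only 1/w has a power series.
  Where w vanished, 1/w would be 0 and the prescribed value at u = 0 would be taken instead of
  f(w).\<close>

lemma has_inf_exp_compose_inf:
  assumes "has_inf_exp f F" "has_inf_exp (\<lambda>z. inverse (w z)) P" "P $ 0 = 0"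
    "\<forall>\<^sub>F z in at_infinity. w z \<noteq> 0"
  shows "has_inf_exp (\<lambda>z. f (w z)) (F oo P)"
proof -
  have "has_inf_exp (\<lambda>z. (\<lambda>u. if u = 0 then F $ 0 else f (inverse u)) (inverse (w z))) (F oo P)"
    by (rule has_inf_exp_compose[OF assms(2,3)]) (use assms(1) in \<open>simp add: has_inf_exp_def\<close>)
  then show ?thesis by (rule has_inf_exp_cong) (rule eventually_mono[OF assms(4)], simp)
qed

lemma has_inf_exp_tendsto:
  assumes "has_inf_exp f F" shows "(f \<longlongrightarrow> F $ 0) at_infinity"
proof -
  have "isCont (\<lambda>u. if u = 0 then F $ 0 else f (inverse u)) 0"
    using assms has_fps_expansion_imp_continuous[of _ F UNIV] by (simp add: has_inf_exp_def)
  then have "((\<lambda>u. if u = 0 then F $ 0 else f (inverse u)) \<longlongrightarrow> F $ 0) (at 0)"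
    by (simp add: isCont_def)
  then have "((\<lambda>u. f (inverse u)) \<longlongrightarrow> F $ 0) (at 0)"
    by (rule Lim_transform_eventually) (auto simp: eventually_at_filter)
  then show ?thesis by (simp add: at_to_infinity filterlim_filtermap)
qed

lemma stieltjes_inf_exp:
  assumes \<mu>: "cs_prob \<mu>"
  shows "has_inf_exp (stieltjes \<mu>) (mser \<mu>)"
proof -
  obtain K where K: "supp_le \<mu> K" using cs_prob_supp[OF \<mu>] .
  have K0: "K > 0" using K by (simp add: supp_le_def)
  have sums: "(\<lambda>n. mser \<mu> $ n * inverse z ^ n) sums stieltjes \<mu> z" if "norm z > K" for z
  proof -
    have "(\<lambda>k. mser \<mu> $ Suc k * inverse z ^ Suc k) sums stieltjes \<mu> z"
      using stieltjes_sums[OF \<mu> K that] by (simp add: mser_nth divide_inverse power_inverse)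
    then show ?thesis using sums_Suc[of "\<lambda>n. mser \<mu> $ n * inverse z ^ n"] by (simp add: mser_nth)
  qed
  have "summable (\<lambda>n. mser \<mu> $ n * inverse (of_real (K + 1)) ^ n)"
    using sums[of "of_real (K + 1)"] K0 by (auto simp: sums_iff simp del: of_real_add)
  then have "fps_conv_radius (mser \<mu>) \<ge> norm (inverse (of_real (K + 1)) :: complex)"
    unfolding fps_conv_radius_def by (rule conv_radius_geI)
  moreover have "ereal (norm (inverse (of_real (K + 1)) :: complex)) > 0"
    using K0 by (simp add: norm_inverse del: of_real_add)
  ultimately have "fps_conv_radius (mser \<mu>) > 0" by (meson less_le_trans)
  moreover have "\<forall>\<^sub>F z in at_infinity. stieltjes \<mu> z = eval_fps (mser \<mu>) (inverse z)"
  proof (unfold eventually_at_infinity, intro exI[of _ "K + 1"] allI impI)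
    fix z :: complex assume "norm z \<ge> K + 1"
    then show "stieltjes \<mu> z = eval_fps (mser \<mu>) (inverse z)"
      using sums[of z] by (simp add: eval_fps_def sums_iff)
  qed
  ultimately show ?thesis by (simp add: has_inf_exp_iff)
qed

lemma mser_0 [simp]: "mser \<mu> $ 0 = 0"
  by (simp add: mser_nth)

lemma mser_1: "cs_prob \<mu> \<Longrightarrow> mser \<mu> $ 1 = 1"
  by (simp add: mser_nth moment_0)

lemma mser_inject:
  assumes "cs_prob \<mu>" "cs_prob \<nu>" "mser \<mu> = mser \<nu>" shows "\<mu> = \<nu>"
proof (rule cs_prob_moments_unique[OF assms(1,2)])
  fix k show "moment \<mu> k = moment \<nu> k"
    using arg_cong[OF assms(3), of "\<lambda>F. F $ Suc k"] by (simp add: mser_nth)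
qed

section \<open>The representation theorem\<close>

text \<open>The masses only tend to 1, so the densities are normalised first. The resulting
  probability measures all live on one compact interval, hence are tight, and moments over that
  interval pass to a weak limit.\<close>

lemma density_limit_measure:
  fixes \<rho> :: "nat \<Rightarrow> real \<Rightarrow> real" and m :: "nat \<Rightarrow> real"
  assumes r: "r > 0" and cont: "\<And>n. continuous_on {-r..r} (\<rho> n)"
    and nonneg: "\<And>n x. x \<in> {-r..r} \<Longrightarrow> \<rho> n x \<ge> 0"
    and lim: "\<And>k. (\<lambda>n. integral {-r..r} (\<lambda>x. \<rho> n x * x ^ k)) \<longlonglongrightarrow> m k" and m0: "m 0 = 1"
  shows "\<exists>\<nu>. cs_prob \<nu> \<and> (\<forall>k. moment \<nu> k = m k)"
proof -
  define c where "c n = integral {-r..r} (\<rho> n)" for n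
  have c_lim: "c \<longlonglongrightarrow> 1" using lim[of 0] m0 by (simp add: c_def[abs_def])
  then have "\<forall>\<^sub>F n in sequentially. c n > 0" by (rule order_tendstoD) simp
  then obtain N where N: "\<And>n. n \<ge> N \<Longrightarrow> c n > 0" by (auto simp: eventually_sequentially)
  \<comment> \<open>The index is moved by \<open>N\<close> because the normalising masses are known
    to be positive only from there on.\<close>
  define d where "d n x = indicator {-r..r} x *\<^sub>R \<rho> (n + N) x / c (n + N)" for n x
  have d_meas: "d n \<in> borel_measurable lborel" for n
  proof -
    have "(\<lambda>x. indicator {-r..r} x *\<^sub>R \<rho> (n + N) x) \<in> borel_measurable borel"
      by (rule borel_measurable_continuous_on_indicator) (auto intro: cont)
    then show ?thesis unfolding d_def by measurable
  qed
  have d_nonneg: "d n x \<ge> 0" for n x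
    using nonneg[of x "n + N"] N[of "n + N"] by (auto simp: d_def indicator_def)
  define \<mu> where "\<mu> n = density lborel (\<lambda>x. ennreal (d n x))" for n
  have [simp]: "sets (\<mu> n) = sets borel" "space (\<mu> n) = UNIV" for n by (simp_all add: \<mu>_def)
  have int_d: "integrable lborel (\<lambda>x. d n x * f x)"
     "(LINT x|lborel. d n x * f x) = integral {-r..r} (\<lambda>x. \<rho> (n + N) x * f x) / c (n + N)"
    if f: "continuous_on {-r..r} f" for f :: "real \<Rightarrow> real" and n
  proof -
    have si: "set_integrable lborel {-r..r} (\<lambda>x. \<rho> (n + N) x * f x)"
      by (rule borel_integrable_atLeastAtMost') (intro continuous_intros cont f)
    have eq: "d n x * f x = (indicator {-r..r} x *\<^sub>R (\<rho> (n + N) x * f x)) / c (n + N)" for x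
      by (simp add: d_def)
    show "integrable lborel (\<lambda>x. d n x * f x)" unfolding eq
      using si unfolding set_integrable_def by (rule integrable_divide_zero)
    show "(LINT x|lborel. d n x * f x) = integral {-r..r} (\<lambda>x. \<rho> (n + N) x * f x) / c (n + N)"
      unfolding eq using set_borel_integral_eq_integral(2)[OF si]
      by (simp add: set_lebesgue_integral_def)
  qed
  have prob: "prob_space (\<mu> n)" for n
  proof
    have i: "integrable lborel (d n)" "(LINT x|lborel. d n x) = 1"
      using int_d[of "\<lambda>_. 1" n] N[of "n + N"] by (simp_all add: c_def)
    have "emeasure (\<mu> n) (space (\<mu> n)) = (\<integral>\<^sup>+ x. ennreal (d n x) \<partial>lborel)"
      using d_meas[of n] by (simp add: \<mu>_def emeasure_density)
    also have "\<dots> = ennreal 1"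
      using nn_integral_eq_integral[OF i(1)] d_nonneg i(2) by simp
    finally show "emeasure (\<mu> n) (space (\<mu> n)) = 1" by simp
  qed
  have rd: "real_distribution (\<mu> n)" for n
    using prob by (simp add: real_distribution_def real_distribution_axioms_def)
  have int_\<mu>: "integral\<^sup>L (\<mu> n) f = integral {-r..r} (\<lambda>x. \<rho> (n + N) x * f x) / c (n + N)"
    if f: "continuous_on {-r..r} f" "f \<in> borel_measurable borel" for f :: "real \<Rightarrow> real" and n
  proof -
    have "integral\<^sup>L (\<mu> n) f = (LINT x|lborel. d n x *\<^sub>R f x)"
      unfolding \<mu>_def by (rule integral_density) (use d_meas[of n] d_nonneg f in auto)
    then show ?thesis using int_d(2)[OF f(1)] by simp
  qed
  have AE_\<mu>: "AE x in \<mu> n. x \<in> {-r..r}" for n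
  proof -
    have m: "(\<lambda>x. ennreal (d n x)) \<in> borel_measurable lborel" using d_meas[of n] by simp
    show ?thesis unfolding \<mu>_def AE_density[OF m] by (auto simp: d_def indicator_def)
  qed
  have tight: "tight \<mu>"
    unfolding tight_def
  proof (intro conjI allI impI rd)
    fix \<epsilon> :: real assume e: "\<epsilon> > 0"
    \<comment> \<open>Tightness is tested on intervals open at the left, hence the margin of
      1.\<close>
    have "measure (\<mu> n) {-r - 1<..r} = 1" for n
    proof -
      interpret prob_space "\<mu> n" by (rule prob)
      have "AE x in \<mu> n. x \<in> {-r - 1<..r}" using AE_\<mu>[of n] by eventually_elim auto
      then show ?thesis by (subst prob_eq_1) auto
    qed
    then show "\<exists>a b. a < b \<and> (\<forall>n. 1 - \<epsilon> < measure (\<mu> n) {a<..b})"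
      using e r by (intro exI[of _ "-r - 1"] exI[of _ r]) auto
  qed
  obtain s \<nu> where s: "strict_mono s" and \<nu>: "real_distribution \<nu>" and wc: "weak_conv_m (\<mu> \<circ> id \<circ> s) \<nu>"
    using tight_imp_convergent_subsubsequence[OF tight, of id] strict_mono_id by auto
  interpret \<nu>: real_distribution \<nu> by fact
  have conv: "(\<lambda>n. integral\<^sup>L (\<mu> (s n)) f) \<longlonglongrightarrow> integral\<^sup>L \<nu> f"
    if "continuous_on UNIV f" "\<And>x. norm (f x) \<le> B" for f :: "real \<Rightarrow> real" and B
  proof -
    have "(\<lambda>n. integral\<^sup>L ((\<mu> \<circ> id \<circ> s) n) f) \<longlonglongrightarrow> integral\<^sup>L \<nu> f"
      by (rule weak_conv_imp_integral_bdd_continuous_conv[OF _ \<nu> wc])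
         (use that rd in \<open>auto simp: continuous_on_eq_continuous_at\<close>)
    then show ?thesis by simp
  qed
  have AE_\<nu>: "AE x in \<nu>. \<bar>x\<bar> \<le> r"
  proof -
    \<comment> \<open>A bounded continuous test function whose zero set is exactly the interval
      [-r, r].\<close>
    define f where "f x = min 1 (max 0 (\<bar>x\<bar> - r))" for x
    have fc: "continuous_on UNIV f" unfolding f_def by (intro continuous_intros)
    have fm: "f \<in> borel_measurable borel" using fc by (rule borel_measurable_continuous_onI)
    have fb: "norm (f x) \<le> 1" "f x \<ge> 0" for x by (auto simp: f_def)
    have "integral\<^sup>L (\<mu> n) f = 0" for n
    proof -
      have "integral\<^sup>L (\<mu> n) f = integral\<^sup>L (\<mu> n) (\<lambda>_. 0)"
      proof (rule integral_cong_AE)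
        show "AE x in \<mu> n. f x = 0" using AE_\<mu>[of n] by eventually_elim (auto simp: f_def)
      qed (use fm in \<open>simp_all cong: measurable_cong_sets\<close>)
      then show ?thesis by simp
    qed
    then have "integral\<^sup>L \<nu> f = 0" using conv[OF fc fb(1)] LIMSEQ_unique by (simp add: LIMSEQ_const_iff)
    moreover have "integrable \<nu> f"
      by (rule \<nu>.integrable_const_bound[where B = 1]) (use fb fm in auto)
    ultimately have "AE x in \<nu>. f x = 0" using fb by (subst (asm) integral_nonneg_eq_0_iff_AE) auto
    then show ?thesis by eventually_elim (auto simp: f_def min_def max_def split: if_splits)
  qed
  have "moment \<nu> k = m k" for k
  proof -
    \<comment> \<open>Weak convergence tests only bounded functions, so the power is clamped outside
      the common support.\<close>
    define f where "f x = (max (-r) (min r x)) ^ k" for x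
    have fc: "continuous_on A f" for A unfolding f_def by (intro continuous_intros)
    have fm: "f \<in> borel_measurable borel" by (rule borel_measurable_continuous_onI[OF fc])
    have fb: "norm (f x) \<le> r ^ k" for x unfolding f_def norm_power using r by (intro power_mono) auto
    have eq: "f x = x ^ k" if "\<bar>x\<bar> \<le> r" for x
    proof -
      have "max (- r) (min r x) = x" using that by auto
      then show ?thesis by (simp add: f_def)
    qed
    have "integral\<^sup>L (\<mu> n) f = integral {-r..r} (\<lambda>x. \<rho> (n + N) x * x ^ k) / c (n + N)" for n
    proof -
      have "integral {-r..r} (\<lambda>x. \<rho> (n + N) x * f x) = integral {-r..r} (\<lambda>x. \<rho> (n + N) x * x ^ k)"
        by (rule integral_cong) (use eq in auto)
      then show ?thesis using int_\<mu>[OF fc fm, of n] by simp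
    qed
    moreover have "(\<lambda>n. integral {-r..r} (\<lambda>x. \<rho> (n + N) x * x ^ k) / c (n + N)) \<longlonglongrightarrow> m k / 1"
      by (intro tendsto_divide LIMSEQ_ignore_initial_segment[OF lim] LIMSEQ_ignore_initial_segment[OF c_lim]) simp
    ultimately have "(\<lambda>n. integral\<^sup>L (\<mu> n) f) \<longlonglongrightarrow> m k" by simp
    then have "(\<lambda>n. integral\<^sup>L (\<mu> (s n)) f) \<longlonglongrightarrow> m k"
      using LIMSEQ_subseq_LIMSEQ[OF _ s] by (simp add: o_def)
    then have "integral\<^sup>L \<nu> f = m k" using conv[OF fc fb] LIMSEQ_unique by blast
    moreover have "integral\<^sup>L \<nu> f = moment \<nu> k" unfolding moment_def
      by (rule integral_cong_AE) (use AE_\<nu> fm eq in \<open>auto elim!: eventually_mono\<close>)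
    ultimately show ?thesis by simp
  qed
  moreover have "cs_prob \<nu>" by (rule cs_probI[OF \<nu> AE_\<nu>])
  ultimately show ?thesis by blast
qed

text \<open>The endpoints of the half circle are real, so only \<open>1/z\<close> contributes an imaginary part.\<close>

lemma Im_contour_integral_half_circle_power:
  assumes r: "r > 0"
  shows "(\<lambda>z. z ^ k * inverse z ^ n) contour_integrable_on part_circlepath 0 r 0 pi"
    "Im (contour_integral (part_circlepath 0 r 0 pi) (\<lambda>z. z ^ k * inverse z ^ n)) = (if n = Suc k then pi else 0)"
proof -
  let ?\<gamma> = "part_circlepath 0 r 0 pi"
  have img: "path_image ?\<gamma> \<subseteq> - {0}"
    using path_image_part_circlepath_subset[of 0 pi r 0] r by (auto simp: sphere_def)
  have cont: "continuous_on (path_image ?\<gamma>) (\<lambda>z. z ^ k * inverse z ^ n)"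
    using img by (intro continuous_intros) auto
  then show int: "(\<lambda>z. z ^ k * inverse z ^ n) contour_integrable_on ?\<gamma>"
    by (rule contour_integrable_continuous_part_circlepath)
  show "Im (contour_integral ?\<gamma> (\<lambda>z. z ^ k * inverse z ^ n)) = (if n = Suc k then pi else 0)"
  proof (cases "n = Suc k")
    case True
    have "contour_integral ?\<gamma> (\<lambda>z. z ^ k * inverse z ^ n) =
        integral {0..pi} (\<lambda>t. (0 + r * cis t) ^ k * inverse (0 + r * cis t) ^ n * r * \<i> * cis t)"
      by (rule contour_integral_part_circlepath_eq) simp
    also have "\<dots> = integral {0..pi} (\<lambda>t. \<i>)"
      by (rule integral_cong) (use r True in \<open>simp add: field_simps\<close>)
    also have "\<dots> = pi * \<i>" by (simp add: scaleR_conv_of_real)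
    finally show ?thesis using True by simp
  next
    case False
    \<comment> \<open>The exponent of the primitive z^j / j, which is nonzero except for the
      integrand 1/z; its values at the real endpoints are real.\<close>
    define j :: int where "j = int k - int n + 1"
    have j: "j \<noteq> 0" using False by (auto simp: j_def)
    have "((\<lambda>z. z ^ k * inverse z ^ n) has_contour_integral
        ((\<lambda>z. z powi j / of_int j) (pathfinish ?\<gamma>) - (\<lambda>z. z powi j / of_int j) (pathstart ?\<gamma>))) ?\<gamma>"
    proof (rule contour_integral_primitive[of "- {0}"])
      fix z :: complex assume z: "z \<in> - {0}"
      have "((\<lambda>z. z powi j / of_int j) has_field_derivative (of_int j * z powi (j - 1) * 1 / of_int j)) (at z within - {0})"
        by (rule DERIV_cdivide[OF DERIV_power_int[OF DERIV_ident]]) (use z in auto)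
      moreover have "of_int j * z powi (j - 1) * 1 / of_int j = z ^ k * inverse z ^ n"
      proof -
        have "z powi (j - 1) = z powi (int k - int n)" by (simp add: j_def)
        also have "\<dots> = z ^ k * inverse z ^ n"
          using z by (simp add: power_int_diff divide_inverse power_inverse)
        finally show ?thesis using j by simp
      qed
      ultimately show "((\<lambda>z. z powi j / of_int j) has_field_derivative z ^ k * inverse z ^ n) (at z within - {0})" by simp
    qed (use img in auto)
    then have "contour_integral ?\<gamma> (\<lambda>z. z ^ k * inverse z ^ n) =
       (\<lambda>z. z powi j / of_int j) (pathfinish ?\<gamma>) - (\<lambda>z. z powi j / of_int j) (pathstart ?\<gamma>)"
      by (rule contour_integral_unique)
    also have "\<dots> = of_real ((- r) powi j / of_int j - r powi j / of_int j)"
      by (simp add: exp_eq_polar)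
    finally show ?thesis using False by (simp only: Im_complex_of_real if_False)
  qed
qed

text \<open>Termwise integration, uniform on the half circle. As the coefficients are real, only the
  term z^k z^-(k+1) leaves an imaginary part; thus a moment is read off the far half circle.\<close>

lemma Im_contour_integral_half_circle_expansion:
  assumes r: "r > 0" "ereal (1 / r) < fps_conv_radius F" and real: "\<And>n. F $ n \<in> \<real>"
    and eq: "\<And>z. norm z = r \<Longrightarrow> G z = eval_fps F (inverse z)"
  shows "Im (contour_integral (part_circlepath 0 r 0 pi) (\<lambda>z. z ^ k * G z)) = pi * Re (F $ Suc k)"
proof -
  let ?\<gamma> = "part_circlepath 0 r 0 pi"
  have img: "path_image ?\<gamma> \<subseteq> sphere 0 r"
    using path_image_part_circlepath_subset[of 0 pi r 0] r by auto
  define S where "S N z = (\<Sum>n<N. F $ n * (z ^ k * inverse z ^ n))" for N and z :: complex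
  have intS: "S N contour_integrable_on ?\<gamma>" for N
    unfolding S_def by (intro contour_integrable_sum contour_integrable_lmul
      Im_contour_integral_half_circle_power(1) r) auto
  have valS: "Im (contour_integral ?\<gamma> (S N)) = pi * Re (F $ Suc k)" if "N > Suc k" for N
  proof -
    have "contour_integral ?\<gamma> (S N) = (\<Sum>n<N. F $ n * contour_integral ?\<gamma> (\<lambda>z. z ^ k * inverse z ^ n))"
      unfolding S_def
      by (subst contour_integral_sum)
         (auto intro!: contour_integrable_lmul Im_contour_integral_half_circle_power(1) r simp: contour_integral_lmul Im_contour_integral_half_circle_power(1)[OF r(1)])
    then have "Im (contour_integral ?\<gamma> (S N)) = (\<Sum>n<N. Im (F $ n * contour_integral ?\<gamma> (\<lambda>z. z ^ k * inverse z ^ n)))"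
      by simp
    also have "\<dots> = (\<Sum>n<N. if n = Suc k then pi * Re (F $ Suc k) else 0)"
    proof (rule sum.cong[OF refl])
      fix n
      have "Im (F $ n) = 0" using real[of n] by (simp add: complex_is_Real_iff)
      then show "Im (F $ n * contour_integral ?\<gamma> (\<lambda>z. z ^ k * inverse z ^ n)) = (if n = Suc k then pi * Re (F $ Suc k) else 0)"
        using Im_contour_integral_half_circle_power(2)[OF r(1), of k n] by simp
    qed
    also have "\<dots> = pi * Re (F $ Suc k)" using that by simp
    finally show ?thesis .
  qed
  have ul: "uniform_limit (path_image ?\<gamma>) S (\<lambda>z. z ^ k * G z) sequentially"
  proof -
    have summ: "summable (\<lambda>n. norm (F $ n) * (1 / r) ^ n)"
      using abs_summable_in_conv_radius[of "of_real (1 / r)" "fps_nth F"] r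
      by (simp add: fps_conv_radius_def norm_mult norm_power norm_divide)
    have "uniform_limit (path_image ?\<gamma>) (\<lambda>N z. \<Sum>n<N. F $ n * (z ^ k * inverse z ^ n)) (\<lambda>z. \<Sum>n. F $ n * (z ^ k * inverse z ^ n)) sequentially"
    proof (rule Weierstrass_m_test)
      fix n z assume "z \<in> path_image ?\<gamma>"
      then have "norm z = r" using img by auto
      then show "norm (F $ n * (z ^ k * inverse z ^ n)) \<le> r ^ k * (norm (F $ n) * (1 / r) ^ n)"
        by (simp add: norm_mult norm_power norm_inverse divide_inverse)
    qed (use summ in \<open>rule summable_mult\<close>)
    moreover have "(\<Sum>n. F $ n * (z ^ k * inverse z ^ n)) = z ^ k * G z" if "z \<in> path_image ?\<gamma>" for z
    proof -
      have nz: "norm z = r" using img that by auto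
      have "(\<lambda>n. F $ n * inverse z ^ n) sums eval_fps F (inverse z)"
        by (rule sums_eval_fps) (use nz r in \<open>simp add: norm_inverse divide_inverse\<close>)
      then have "(\<lambda>n. z ^ k * (F $ n * inverse z ^ n)) sums (z ^ k * eval_fps F (inverse z))"
        by (rule sums_mult)
      then show ?thesis using eq[OF nz] by (simp add: sums_iff mult_ac)
    qed
    ultimately show ?thesis unfolding S_def[abs_def] uniform_limit_iff by (simp cong: ball_cong)
  qed
  have "((\<lambda>N. contour_integral ?\<gamma> (S N)) \<longlongrightarrow> contour_integral ?\<gamma> (\<lambda>z. z ^ k * G z)) sequentially"
  proof (rule contour_integral_uniform_limit(2)[OF _ ul])
    show "norm (vector_derivative ?\<gamma> (at t)) \<le> r * pi" for t
      using r by (simp add: vector_derivative_part_circlepath norm_mult)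
  qed (use intS in auto)
  then have "(\<lambda>N. Im (contour_integral ?\<gamma> (S N))) \<longlonglongrightarrow> Im (contour_integral ?\<gamma> (\<lambda>z. z ^ k * G z))"
    by (rule tendsto_Im)
  moreover have "(\<lambda>N. Im (contour_integral ?\<gamma> (S N))) \<longlonglongrightarrow> pi * Re (F $ Suc k)"
    by (rule tendsto_eventually) (use valS in \<open>auto simp: eventually_sequentially intro!: exI[of _ "Suc (Suc k)"]\<close>)
  ultimately show ?thesis by (rule LIMSEQ_unique)
qed

text \<open>The densities are -Im G(x + i e)/pi. Nothing is known of G at the real axis as e tends
  to 0, so Cauchy's theorem moves the moment integrals to a half circle lying in the domain of the
  expansion, where the limit is harmless.\<close>

lemma stieltjes_representation:
  assumes hol: "G holomorphic_on OmegaR R" and Im: "\<And>z. Im z > 0 \<Longrightarrow> Im (G z) \<le> 0"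
    and expn: "has_inf_exp G F" and F1: "F $ 0 = 0" "F $ 1 = 1" and real: "\<And>n. F $ n \<in> \<real>"
  shows "\<exists>\<nu>. cs_prob \<nu> \<and> mser \<nu> = F"
proof -
  obtain b where b: "\<And>z. norm z \<ge> b \<Longrightarrow> G z = eval_fps F (inverse z)"
    using expn unfolding has_inf_exp_iff eventually_at_infinity by blast
  obtain s :: real where s: "s > 0" "ereal s < fps_conv_radius F"
    using expn ereal_dense2[of 0 "fps_conv_radius F"] unfolding has_inf_exp_iff by auto
  \<comment> \<open>The radius puts the circle inside the domain of holomorphy and in the region
    where G equals its series, with 1/r below the radius of convergence.\<close>
  define r where "r = max (max 1 b) (max (R + 1) (1 / s))"
  have rs1: "r \<ge> 1 / s" "r \<ge> 1" by (auto simp: r_def)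
  then have "1 / r \<le> s" using s(1) by (simp add: divide_le_eq mult.commute)
  then have rs: "ereal (1 / r) < fps_conv_radius F" using s(2) by (meson ereal_less_eq(3) le_less_trans)
  have r: "r > 0" "r > R" "\<And>z. norm z = r \<Longrightarrow> G z = eval_fps F (inverse z)"
    using b by (auto simp: r_def)
  let ?\<gamma> = "part_circlepath 0 r 0 pi"
  have img: "path_image ?\<gamma> \<subseteq> {z. norm z = r \<and> Im z \<ge> 0}"
  proof
    fix z assume z: "z \<in> path_image ?\<gamma>"
    then obtain t where t: "t \<in> {0..pi}" "z = r * cis t"
      using r by (auto simp: path_image_part_circlepath cis_conv_exp)
    then show "z \<in> {z. norm z = r \<and> Im z \<ge> 0}" using r by (auto simp: norm_mult sin_ge_zero)
  qed
  define e where "e n = 1 / real (Suc n)" for n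
  have e: "e n > 0" "e n \<le> 1" for n by (auto simp: e_def)
  define \<rho> where "\<rho> n x = - Im (G (of_real x + \<i> * of_real (e n))) / pi" for n x
  \<comment> \<open>Only the argument of G is raised; the factor z^k stays real on the real axis, so
    that Im \<open>H\<close> there is -pi times density times x^k.\<close>
  define H where "H n k z = z ^ k * G (z + \<i> * of_real (e n))" for n k z
  have holH: "H n k holomorphic_on {z. Im z > - e n}" for n k
  proof -
    have "(G \<circ> (\<lambda>z. z + \<i> * of_real (e n))) holomorphic_on {z. Im z > - e n}"
      by (rule holomorphic_on_compose_gen[OF _ hol]) (auto simp: OmegaR_def intro!: holomorphic_intros)
    then show ?thesis unfolding H_def o_def by (intro holomorphic_intros)
  qed
  have contH: "continuous_on {-r..r} (\<lambda>x. H n k (of_real x))" for n k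
    by (intro continuous_on_compose2[OF holomorphic_on_imp_continuous_on[OF holH]] continuous_intros)
       (use e in auto)
  \<comment> \<open>The raised function is holomorphic on a convex open half plane containing the
    closed half disc, diameter included.\<close>
  have loop: "integral {-r..r} (\<lambda>x. H n k (of_real x)) = - contour_integral ?\<gamma> (H n k)" for n k
  proof -
    have conv: "convex {z. Im z > - e n}" by (rule convex_halfspace_Im_gt)
    have sub1: "closed_segment (of_real (-r)) (of_real r) \<subseteq> {z. Im z > - e n}"
      using e by (intro closed_segment_subset conv) auto
    have sub2: "path_image ?\<gamma> \<subseteq> {z. Im z > - e n}" using img e[of n] by fastforce
    have ends: "pathfinish (linepath (of_real (-r)) (of_real r)) = pathstart ?\<gamma>"
      "pathfinish ?\<gamma> = of_real (-r)" by (simp_all add: exp_eq_polar)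
    have c1: "H n k contour_integrable_on linepath (of_real (-r)) (of_real r)"
      using sub1 by (intro contour_integrable_continuous_linepath continuous_on_subset[OF holomorphic_on_imp_continuous_on[OF holH]])
    have c2: "H n k contour_integrable_on ?\<gamma>"
      using sub2 by (intro contour_integrable_continuous_part_circlepath continuous_on_subset[OF holomorphic_on_imp_continuous_on[OF holH]])
    have "(H n k has_contour_integral 0) (linepath (of_real (-r)) (of_real r) +++ ?\<gamma>)"
      by (rule Cauchy_theorem_convex_simple[OF holH conv])
         (use sub1 sub2 ends in \<open>auto intro!: valid_path_join simp: path_image_join\<close>)
    then have "contour_integral (linepath (of_real (-r)) (of_real r) +++ ?\<gamma>) (H n k) = 0"
      by (rule contour_integral_unique)
    then have "contour_integral (linepath (of_real (-r)) (of_real r)) (H n k) + contour_integral ?\<gamma> (H n k) = 0"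
      using contour_integral_join[OF c1 c2] ends by simp
    moreover have "contour_integral (linepath (of_real (-r)) (of_real r)) (H n k) = integral {-r..r} (\<lambda>x. H n k (of_real x))"
      using r by (subst contour_integral_linepath_Reals_eq) auto
    ultimately show ?thesis by (simp add: eq_neg_iff_add_eq_0)
  qed
  have ul: "uniform_limit (path_image ?\<gamma>) (\<lambda>n. H n k) (\<lambda>z. z ^ k * G z) sequentially" for k
  proof -
    define C where "C = {z::complex. r \<le> norm z \<and> norm z \<le> r + 1}"
    have "C = cball 0 (r + 1) - ball 0 r" by (auto simp: C_def)
    then have "compact C" using compact_diff[OF compact_cball open_ball] by metis
    moreover have "continuous_on C G"
      using r by (intro continuous_on_subset[OF holomorphic_on_imp_continuous_on[OF hol]]) (auto simp: C_def OmegaR_def)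
    ultimately have uc: "uniformly_continuous_on C G" by (rule compact_uniformly_continuous[rotated])
    have "uniform_limit (path_image ?\<gamma>) (\<lambda>n z. G (z + \<i> * of_real (e n))) G sequentially"
    proof (rule uniform_limitI)
      fix \<epsilon> :: real assume "\<epsilon> > 0"
      then obtain d where d: "d > 0" "\<And>x y. x \<in> C \<Longrightarrow> y \<in> C \<Longrightarrow> dist y x < d \<Longrightarrow> dist (G y) (G x) < \<epsilon>"
        using uc unfolding uniformly_continuous_on_def by metis
      have "e \<longlonglongrightarrow> 0" unfolding e_def using LIMSEQ_Suc[OF lim_inverse_n'] by (simp add: divide_inverse)
      then have "\<forall>\<^sub>F n in sequentially. e n < d" using d(1) by (rule order_tendstoD)
      then show "\<forall>\<^sub>F n in sequentially. \<forall>z\<in>path_image ?\<gamma>. dist (G (z + \<i> * of_real (e n))) (G z) < \<epsilon>"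
      proof eventually_elim
        case (elim n)
        show ?case
        proof
          fix z assume "z \<in> path_image ?\<gamma>"
          then have z: "norm z = r" "Im z \<ge> 0" using img by auto
          \<comment> \<open>Moving upwards from the closed upper half plane increases the modulus,
            so the raised circle stays in the compact annulus \<open>C\<close>, on which G is
            uniformly continuous.\<close>
          have "norm (z + \<i> * of_real (e n)) \<ge> norm z"
          proof -
            have "(Im z)\<^sup>2 \<le> (Im z + e n)\<^sup>2" using z e[of n] by (intro power_mono) auto
            then show ?thesis unfolding cmod_def by simp
          qed
          moreover have "norm (z + \<i> * of_real (e n)) \<le> r + 1"
            using norm_triangle_ineq[of z "\<i> * of_real (e n)"] z e[of n] by (simp add: norm_mult)
          ultimately have "z \<in> C" "z + \<i> * of_real (e n) \<in> C" using z by (auto simp: C_def)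
          then show "dist (G (z + \<i> * of_real (e n))) (G z) < \<epsilon>"
            using d(2) elim e[of n] by (auto simp: dist_norm norm_mult)
        qed
      qed
    qed
    moreover have "bounded ((\<lambda>z. z ^ k) ` path_image ?\<gamma>)"
      by (intro compact_imp_bounded compact_continuous_image continuous_intros compact_valid_path_image) auto
    moreover have "bounded (G ` path_image ?\<gamma>)"
    proof (intro compact_imp_bounded compact_continuous_image compact_valid_path_image)
      show "continuous_on (path_image ?\<gamma>) G"
        using img r by (intro continuous_on_subset[OF holomorphic_on_imp_continuous_on[OF hol]]) (auto simp: OmegaR_def)
    qed auto
    ultimately show ?thesis unfolding H_def by (intro uniform_lim_mult uniform_limit_const)
  qed
  have lim: "(\<lambda>n. integral {-r..r} (\<lambda>x. \<rho> n x * x ^ k)) \<longlonglongrightarrow> Re (F $ Suc k)" for k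
  proof -
    have "integral {-r..r} (\<lambda>x. \<rho> n x * x ^ k) = Im (contour_integral ?\<gamma> (H n k)) / pi" for n
    proof -
      have "((\<lambda>x. H n k (of_real x)) has_integral (- contour_integral ?\<gamma> (H n k))) {-r..r}"
        using loop[of n k] integrable_continuous_real[OF contH] by (metis integrable_integral)
      then have "((\<lambda>x. - Im (H n k (of_real x)) / pi) has_integral (- Im (- contour_integral ?\<gamma> (H n k)) / pi)) {-r..r}"
        using has_integral_linear[OF _ bounded_linear_Im, unfolded o_def]
        by (intro has_integral_divide has_integral_neg) blast
      moreover have "- Im (H n k (of_real x)) / pi = \<rho> n x * x ^ k" for x
        unfolding H_def \<rho>_def of_real_power[symmetric] by simp
      ultimately show ?thesis by (simp add: integral_unique)
    qed
    moreover have "(\<lambda>n. contour_integral ?\<gamma> (H n k)) \<longlonglongrightarrow> contour_integral ?\<gamma> (\<lambda>z. z ^ k * G z)"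
    proof (rule contour_integral_uniform_limit(2)[OF _ ul])
      show "\<forall>\<^sub>F n in sequentially. H n k contour_integrable_on ?\<gamma>"
      proof (intro always_eventually allI contour_integrable_continuous_part_circlepath)
        fix n
        have "path_image ?\<gamma> \<subseteq> {z. Im z > - e n}" using img e[of n] by fastforce
        then show "continuous_on (path_image ?\<gamma>) (H n k)"
          by (rule continuous_on_subset[OF holomorphic_on_imp_continuous_on[OF holH]])
      qed
      show "norm (vector_derivative ?\<gamma> (at t)) \<le> r * pi" for t
        using r by (simp add: vector_derivative_part_circlepath norm_mult)
    qed auto
    then have "(\<lambda>n. Im (contour_integral ?\<gamma> (H n k)) / pi) \<longlonglongrightarrow> Im (contour_integral ?\<gamma> (\<lambda>z. z ^ k * G z)) / pi"
      by (intro tendsto_intros) auto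
    ultimately show ?thesis
      using Im_contour_integral_half_circle_expansion[OF r(1) rs real r(3), of k] by simp
  qed
  have "\<exists>\<nu>. cs_prob \<nu> \<and> (\<forall>k. moment \<nu> k = Re (F $ Suc k))"
  proof (rule density_limit_measure[OF r(1) _ _ lim])
    show "continuous_on {-r..r} (\<rho> n)" for n
      using contH[of n 0] unfolding \<rho>_def H_def by (auto intro!: continuous_intros)
    show "\<rho> n x \<ge> 0" for n x unfolding \<rho>_def using Im[of "of_real x + \<i> * of_real (e n)"] e[of n]
      by (simp add: divide_nonpos_pos)
  qed (use F1 in simp)
  then obtain \<nu> where \<nu>: "cs_prob \<nu>" "\<And>k. moment \<nu> k = Re (F $ Suc k)" by blast
  have "mser \<nu> $ n = F $ n" for n
    using F1 \<nu>(2)[of "n - 1"] real[of n] by (cases n) (auto simp: mser_nth)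
  then show ?thesis using \<nu>(1) fps_ext by metis
qed

section \<open>The transformations of Stieltjes transforms\<close>

text \<open>Carries both analytic and formal data through compositions. The strict sign is what
  keeps 1 - f off the cut of the logarithm and 1 + f away from 0.\<close>

definition pick :: "(complex \<Rightarrow> complex) \<Rightarrow> complex fps \<Rightarrow> bool" where
  "pick f F \<longleftrightarrow> (\<exists>R. f holomorphic_on OmegaR R) \<and> (\<forall>z. Im z > 0 \<longrightarrow> Im (f z) < 0) \<and>
     has_inf_exp f F \<and> F $ 0 = 0 \<and> F $ 1 = 1 \<and> (\<forall>n. F $ n \<in> \<real>)"

lemma OmegaR_mono: "R \<le> R' \<Longrightarrow> OmegaR R' \<subseteq> OmegaR R"
  by (auto simp: OmegaR_def)

lemma pick_stieltjes:
  assumes "cs_prob \<mu>" shows "pick (stieltjes \<mu>) (mser \<mu>)"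
proof -
  obtain K where "supp_le \<mu> K" using cs_prob_supp[OF assms] .
  then show ?thesis unfolding pick_def
    using stieltjes_holomorphic[OF assms] stieltjes_Im_le(2)[OF assms] stieltjes_inf_exp[OF assms] mser_1[OF assms]
    by (auto simp: mser_nth)
qed

lemma pick_representation:
  assumes "pick f F" shows "\<exists>\<nu>. cs_prob \<nu> \<and> mser \<nu> = F"
  using assms unfolding pick_def
  by (elim conjE exE, intro stieltjes_representation) (auto simp: less_imp_le)

lemma fps_power_Reals:
  fixes A :: "complex fps"
  assumes "\<And>n. A $ n \<in> \<real>" shows "(A ^ k) $ n \<in> \<real>"
proof (induction k arbitrary: n)
  case (Suc k)
  then show ?case using assms by (auto simp: fps_mult_nth intro!: sum_in_Reals Reals_mult)
qed auto

lemma fps_compose_Reals: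
  fixes A B :: "complex fps"
  assumes "\<And>n. A $ n \<in> \<real>" "\<And>n. B $ n \<in> \<real>"
  shows "(A oo B) $ n \<in> \<real>"
  using assms fps_power_Reals[OF assms(2)] by (auto simp: fps_compose_nth intro!: sum_in_Reals Reals_mult)

section \<open>The function \<phi> and principal branches\<close>

definition phi :: "real \<Rightarrow> complex \<Rightarrow> complex" where
  "phi q w = (1 - (1 - w) powr complex_of_real q) / complex_of_real q"

definition Phi :: "real \<Rightarrow> complex fps" where
  "Phi q = Abs_fps (\<lambda>n. if n = 0 then 0 else - of_real ((q gchoose n) * (- 1) ^ n / q))"

lemma complex_of_real_gchoose: "complex_of_real (q gchoose n) = of_real q gchoose n"
  by (simp add: gbinomial_prod_rev)

lemma Phi_expansion:
  assumes "q \<noteq> 0" shows "phi q has_fps_expansion Phi q"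
proof -
  have 1: "(\<lambda>x. (1 + x) powr complex_of_real q) has_fps_expansion fps_binomial (of_real q)"
    by (rule has_fps_expansion_binomial_complex)
  have "((\<lambda>x. (1 + x) powr complex_of_real q) \<circ> (\<lambda>x. - x)) has_fps_expansion
     (fps_binomial (of_real q) oo (- fps_X))"
    by (rule has_fps_expansion_compose[OF 1]) (auto intro!: fps_expansion_intros)
  then have "(\<lambda>w. (1 - ((\<lambda>x. (1 + x) powr complex_of_real q) \<circ> (\<lambda>x. - x)) w) * (1 / of_real q)) has_fps_expansion
     (1 - (fps_binomial (of_real q) oo (- fps_X))) * fps_const (1 / of_real q)"
    by (intro has_fps_expansion_cmult_right has_fps_expansion_diff has_fps_expansion_1)
  also have "(\<lambda>w. (1 - ((\<lambda>x. (1 + x) powr complex_of_real q) \<circ> (\<lambda>x. - x)) w) * (1 / of_real q)) = phi q"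
    by (simp add: phi_def fun_eq_iff)
  also have "(1 - (fps_binomial (of_real q) oo (- fps_X))) * fps_const (1 / complex_of_real q) = Phi q"
  proof (rule fps_ext)
    fix n
    have "(fps_binomial (complex_of_real q) oo (- fps_X)) = Abs_fps (\<lambda>n. (-1) ^ n * fps_binomial (complex_of_real q) $ n)"
      using fps_compose_linear[of "fps_binomial (complex_of_real q)" "-1"]
      by (simp flip: fps_const_neg)
    then show "((1 - (fps_binomial (of_real q) oo (- fps_X))) * fps_const (1 / complex_of_real q)) $ n = Phi q $ n"
      by (simp add: Phi_def complex_of_real_gchoose mult.commute del: fps_compose_uminus)
  qed
  finally show ?thesis .
qed

text \<open>The bound keeps a Ln w inside the strip on which \<open>Ln\<close> inverts
  \<open>exp\<close>.\<close>

lemma powr_powr_cancel: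
  fixes w :: complex
  assumes "w \<noteq> 0" "\<bar>a * Im (Ln w)\<bar> < pi" "a * b = 1"
  shows "(w powr of_real a) powr of_real b = w"
proof -
  have "Ln (exp (of_real a * Ln w)) = of_real a * Ln w"
    using assms(2) by (intro Ln_exp) (auto simp: abs_less_iff)
  then have "(w powr of_real a) powr of_real b = exp (of_real b * (of_real a * Ln w))"
    using assms(1) by (simp add: powr_def)
  also have "of_real b * (of_real a * Ln w) = of_real (a * b) * Ln w" by simp
  finally show ?thesis using assms by simp
qed

text \<open>Both bases tend to 1, so their arguments become small enough for the powers q and 1/q to
  cancel on principal branches, however large 1/q is. The general f lets the relations for both maps
  use the same equivalence.\<close>

lemma eventually_powr_iff:
  fixes f g :: "complex \<Rightarrow> complex"
  assumes q: "q \<noteq> 0" "\<bar>q\<bar> < 1" and f: "(f \<longlongrightarrow> 0) F" and g: "(g \<longlongrightarrow> 0) F"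
  shows "(\<forall>\<^sub>F z in F. 1 - f z = (1 - of_real q * g z) powr of_real (1 / q)) \<longleftrightarrow> (\<forall>\<^sub>F z in F. g z = phi q (f z))"
proof
  have lim: "((\<lambda>z. a * Im (Ln (1 - h z))) \<longlongrightarrow> a * Im (Ln (1 - 0))) F" if "(h \<longlongrightarrow> 0) F" for h and a :: real
    by (intro tendsto_intros that) auto
  have ev: "\<forall>\<^sub>F z in F. \<bar>a * Im (Ln (1 - h z))\<bar> < pi \<and> 1 - h z \<noteq> 0" if h: "(h \<longlongrightarrow> 0) F" for h and a :: real
  proof (rule eventually_conj)
    show "\<forall>\<^sub>F z in F. \<bar>a * Im (Ln (1 - h z))\<bar> < pi"
      by (rule order_tendstoD(2)[OF tendsto_rabs[OF lim[OF h]]]) simp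
    have "\<forall>\<^sub>F z in F. dist (h z) 0 < 1" using tendstoD[OF h, of 1] by simp
    then show "\<forall>\<^sub>F z in F. 1 - h z \<noteq> 0" by eventually_elim auto
  qed
  have g': "((\<lambda>z. of_real q * g z) \<longlongrightarrow> 0) F" using tendsto_mult[OF tendsto_const g, of "of_real q"] by simp
  {
    assume *: "\<forall>\<^sub>F z in F. 1 - f z = (1 - of_real q * g z) powr of_real (1 / q)"
    then show "\<forall>\<^sub>F z in F. g z = phi q (f z)" using ev[OF g', of "1 / q"]
    proof eventually_elim
      case (elim z)
      have "(1 - f z) powr of_real q = 1 - of_real q * g z"
        unfolding elim(1) by (rule powr_powr_cancel) (use elim q in auto)
      then show ?case using q by (simp add: phi_def)
    qed
  next
    assume *: "\<forall>\<^sub>F z in F. g z = phi q (f z)"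
    then show "\<forall>\<^sub>F z in F. 1 - f z = (1 - of_real q * g z) powr of_real (1 / q)" using ev[OF f, of q]
    proof eventually_elim
      case (elim z)
      have "1 - of_real q * g z = (1 - f z) powr of_real q" using elim q by (simp add: phi_def)
      then show ?case using powr_powr_cancel[of "1 - f z" q "1 / q"] elim q by simp
    qed
  }
qed

text \<open>The argument of 1 - w lies in (0, pi); multiplied by q it has a sine of the sign of q
  because |q| < 1. The division by q in \<phi> makes the result negative for either sign.\<close>

lemma phi_Im_neg:
  assumes q: "q \<noteq> 0" "\<bar>q\<bar> < 1" and w: "Im w < 0"
  shows "Im (phi q w) < 0"
proof -
  define v where "v = 1 - w"
  have v: "Im v > 0" "v \<noteq> 0" using w by (auto simp: v_def)
  have a: "0 < Im (Ln v)" "Im (Ln v) < pi" using Im_Ln_pos_lt_imp[of v] v Im_Ln_pos_lt[of v] by auto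
  have eq: "Im (v powr of_real q) = exp (q * Re (Ln v)) * sin (q * Im (Ln v))"
    using v by (simp add: powr_def Im_exp)
  have Im: "Im (phi q w) = - Im (v powr of_real q) / q"
    unfolding phi_def v_def[symmetric] by (simp add: Im_divide_of_real)
  show ?thesis
  proof (cases "q > 0")
    case True
    have "q * Im (Ln v) < 1 * pi" using a q True by (intro mult_strict_mono) auto
    then have "sin (q * Im (Ln v)) > 0" using a True by (intro sin_gt_zero) auto
    then show ?thesis unfolding Im eq using True by (simp add: divide_neg_pos)
  next
    case False
    then have qn: "q < 0" using q by simp
    have "- q * Im (Ln v) < 1 * pi" using a q qn by (intro mult_strict_mono) auto
    then have "sin (- q * Im (Ln v)) > 0" using a qn by (intro sin_gt_zero) (auto simp: mult_neg_pos)
    then have "sin (q * Im (Ln v)) < 0" by simp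
    then have "Im (v powr of_real q) < 0" unfolding eq by (simp add: mult_pos_neg)
    then show ?thesis unfolding Im using qn by (simp add: divide_neg_neg)
  qed
qed

lemma Phi_0 [simp]: "Phi q $ 0 = 0" by (simp add: Phi_def)

lemma Phi_1: "q \<noteq> 0 \<Longrightarrow> Phi q $ 1 = 1" by (simp add: Phi_def)

lemma Phi_Reals: "Phi q $ n \<in> \<real>" by (simp add: Phi_def)

lemma fps_compose_nth_1:
  fixes A B :: "complex fps"
  assumes "A $ 0 = 0" "B $ 0 = 0" shows "(A oo B) $ 1 = A $ 1 * B $ 1"
  using assms by (simp add: fps_compose_nth)

lemma pick_phi:
  assumes q: "q \<noteq> 0" "\<bar>q\<bar> < 1" and f: "pick f F"
  shows "pick (\<lambda>z. phi q (f z)) (Phi q oo F)"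
proof -
  obtain R where R: "f holomorphic_on OmegaR R" using f by (auto simp: pick_def)
  have fF: "has_inf_exp f F" "F $ 0 = 0" "F $ 1 = 1" "\<And>n. F $ n \<in> \<real>" and Im: "\<And>z. Im z > 0 \<Longrightarrow> Im (f z) < 0"
    using f by (auto simp: pick_def)
  have "\<forall>\<^sub>F z in at_infinity. dist (f z) 0 < 1"
    using tendstoD[OF has_inf_exp_tendsto[OF fF(1)], of 1] fF(2) by simp
  then obtain b where b: "\<And>z. norm z \<ge> b \<Longrightarrow> norm (f z) < 1" by (auto simp: eventually_at_infinity)
  have "(\<lambda>z. phi q (f z)) holomorphic_on OmegaR (max R b)"
    unfolding phi_def
  proof (intro holomorphic_intros holomorphic_on_subset[OF R])
    show "OmegaR (max R b) \<subseteq> OmegaR R" by (rule OmegaR_mono) simp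
    fix z assume "z \<in> OmegaR (max R b)"
    \<comment> \<open>Two reasons for avoiding the cut: a nonzero imaginary part in the upper half
      plane, and a positive real part near infinity.\<close>
    then consider "Im z > 0" | "norm (f z) < 1" using b[of z] by (auto simp: OmegaR_def)
    then show "1 - f z \<notin> \<real>\<^sub>\<le>\<^sub>0"
    proof cases
      case 1
      then have "Im (1 - f z) \<noteq> 0" using Im[of z] by auto
      then show ?thesis using complex_nonpos_Reals_iff by blast
    next
      case 2
      then have "Re (1 - f z) > 0" using abs_Re_le_cmod[of "f z"] by auto
      then show ?thesis using complex_nonpos_Reals_iff by (metis not_le)
    qed
  qed (use q in auto)
  moreover have "has_inf_exp (\<lambda>z. phi q (f z)) (Phi q oo F)"
    by (rule has_inf_exp_compose[OF fF(1,2) Phi_expansion[OF q(1)]])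
  moreover have "(Phi q oo F) $ 1 = 1" using fps_compose_nth_1[of "Phi q" F] fF(2,3) Phi_1[OF q(1)] by simp
  ultimately show ?thesis
    unfolding pick_def using phi_Im_neg[OF q] Im fF fps_compose_Reals[of "Phi q" F, OF Phi_Reals]
    by (auto simp: fps_compose_nth)
qed

text \<open>Expansion of \<open>1 - 1/(1 + f(z - 1))\<close> in terms of that of \<open>f\<close>.\<close>

definition Bser :: "complex fps \<Rightarrow> complex fps" where
  "Bser F = (1 - inverse (1 + fps_X)) oo (F oo (fps_X * inverse (1 - fps_X)))"

lemma shift_inf_exp: "has_inf_exp (\<lambda>z. inverse (z - 1)) (fps_X * inverse (1 - fps_X))"
proof -
  have "(\<lambda>u::complex. u * inverse (1 - u)) has_fps_expansion (fps_X * inverse (1 - fps_X))"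
    by (intro fps_expansion_intros) simp
  also have "(\<lambda>u::complex. u * inverse (1 - u)) =
     (\<lambda>u. if u = 0 then (fps_X * inverse (1 - fps_X)) $ 0 else inverse (inverse u - 1))"
  proof
    fix u :: complex
    show "u * inverse (1 - u) = (if u = 0 then (fps_X * inverse (1 - fps_X)) $ 0 else inverse (inverse u - 1))"
      by (cases "u = 1") (auto simp: field_simps)
  qed
  finally show ?thesis unfolding has_inf_exp_def .
qed

text \<open>With this function in the role of G, the relation defining \<lambda> turns into the one
  defining \<nu>, since 1 minus it is the reciprocal of 1 + f(z - 1). The sign of the imaginary part
  survives because inversion and negation each reverse it.\<close>

lemma pick_shift:
  assumes f: "pick f F"
  shows "pick (\<lambda>z. 1 - inverse (1 + f (z - 1))) (Bser F)"
proof -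
  obtain R where R: "f holomorphic_on OmegaR R" using f by (auto simp: pick_def)
  have fF: "has_inf_exp f F" "F $ 0 = 0" "F $ 1 = 1" "\<And>n. F $ n \<in> \<real>" and Im: "\<And>z. Im z > 0 \<Longrightarrow> Im (f z) < 0"
    using f by (auto simp: pick_def)
  have "\<forall>\<^sub>F z in at_infinity. dist (f z) 0 < 1"
    using tendstoD[OF has_inf_exp_tendsto[OF fF(1)], of 1] fF(2) by simp
  then obtain b where b: "\<And>z. norm z \<ge> b \<Longrightarrow> norm (f z) < 1" by (auto simp: eventually_at_infinity)
  \<comment> \<open>The extra 1 absorbs the translation of the argument.\<close>
  define R' where "R' = max R b + 1"
  have norm: "norm (z - 1) > max R b" if "norm z > R'" for z :: complex
    using norm_triangle_ineq2[of z 1] that unfolding R'_def norm_one by linarith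
  have nz: "1 + f (z - 1) \<noteq> 0" if "z \<in> OmegaR R'" for z
  proof (cases "Im z > 0")
    case True
    then have "Im (1 + f (z - 1)) \<noteq> 0" using Im[of "z - 1"] by simp
    then show ?thesis by (metis zero_complex.sel(2))
  next
    case False
    then have "norm (f (z - 1)) < 1" using that norm[of z] b[of "z - 1"] by (auto simp: OmegaR_def)
    then show ?thesis by (metis add.commute add_eq_0_iff less_irrefl norm_minus_cancel norm_one)
  qed
  have "(\<lambda>z. f (z - 1)) holomorphic_on OmegaR R'"
  proof -
    have "(f \<circ> (\<lambda>z. z - 1)) holomorphic_on OmegaR R'"
      using norm by (intro holomorphic_on_compose_gen[OF _ R]) (fastforce simp: OmegaR_def intro!: holomorphic_intros)+
    then show ?thesis by (simp add: o_def)
  qed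
  then have hol: "(\<lambda>z. 1 - inverse (1 + f (z - 1))) holomorphic_on OmegaR R'"
    using nz by (intro holomorphic_intros) auto
  let ?P = "fps_X * inverse (1 - fps_X) :: complex fps"
  have "\<forall>\<^sub>F z in at_infinity. z - 1 \<noteq> (0::complex)"
    unfolding eventually_at_infinity by (intro exI[of _ 2]) auto
  then have e1: "has_inf_exp (\<lambda>z. f (z - 1)) (F oo ?P)"
    by (intro has_inf_exp_compose_inf[OF fF(1) shift_inf_exp]) auto
  have "(\<lambda>w::complex. 1 - inverse (1 + w)) has_fps_expansion (1 - inverse (1 + fps_X))"
    by (intro fps_expansion_intros) simp
  then have e2: "has_inf_exp (\<lambda>z. 1 - inverse (1 + f (z - 1))) (Bser F)"
    unfolding Bser_def using fF by (intro has_inf_exp_compose[OF e1]) (auto simp: fps_compose_nth)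
  have geo: "inverse (1 - fps_X :: complex fps) = Abs_fps (\<lambda>_. 1)"
    using fps_inverse_gp by (metis fps_inverse_idempotent fps_inverse_gp' one_neq_zero fps_nth_Abs_fps)
  have geo2: "inverse (1 + fps_X :: complex fps) = Abs_fps (\<lambda>n. (-1) ^ n)"
    using fps_inverse_fps_X_plus1 by (metis add.commute)
  have P_Reals: "?P $ n \<in> \<real>" for n unfolding geo by auto
  have Q_Reals: "(1 - inverse (1 + fps_X) :: complex fps) $ n \<in> \<real>" for n unfolding geo2 by auto
  have P1: "?P $ 0 = 0" "?P $ 1 = 1" unfolding geo by auto
  have Q1: "(1 - inverse (1 + fps_X) :: complex fps) $ 0 = 0" "(1 - inverse (1 + fps_X) :: complex fps) $ 1 = 1" unfolding geo2 by auto
  have FP: "(F oo ?P) $ 0 = 0" "(F oo ?P) $ 1 = 1"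
    using fF fps_compose_nth_1[of F ?P] P1 by (auto simp: fps_compose_nth)
  have B1: "Bser F $ 0 = 0" "Bser F $ 1 = 1"
    unfolding Bser_def using FP Q1 fps_compose_nth_1[OF Q1(1) FP(1)] by (auto simp: fps_compose_nth)
  have B_Reals: "Bser F $ n \<in> \<real>" for n
    unfolding Bser_def by (intro fps_compose_Reals Q_Reals P_Reals fF)
  have "Im (1 - inverse (1 + f (z - 1))) < 0" if "Im z > 0" for z
  proof -
    define v where "v = 1 + f (z - 1)"
    have v: "Im v < 0" using Im[of "z - 1"] that by (simp add: v_def)
    then have "(Re v)\<^sup>2 + (Im v)\<^sup>2 > 0" by (simp add: sum_power2_gt_zero_iff)
    then have "Im (inverse v) > 0" using v by (simp add: divide_neg_pos)
    then show ?thesis unfolding v_def[symmetric] by simp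
  qed
  then show ?thesis unfolding pick_def using hol e2 B1 B_Reals by blast
qed

section \<open>Free convolution by subordination\<close>

lemma has_inf_exp_add: "has_inf_exp f F \<Longrightarrow> has_inf_exp g G \<Longrightarrow> has_inf_exp (\<lambda>z. f z + g z) (F + G)"
  unfolding has_inf_exp_def by (drule (1) has_fps_expansion_add) (simp add: if_distrib if_distribR cong: if_cong)

lemma has_inf_exp_mult: "has_inf_exp f F \<Longrightarrow> has_inf_exp g G \<Longrightarrow> has_inf_exp (\<lambda>z. f z * g z) (F * G)"
  unfolding has_inf_exp_def by (drule (1) has_fps_expansion_mult) (simp add: if_distrib if_distribR cong: if_cong)

lemma has_inf_exp_const: "has_inf_exp (\<lambda>_. c) (fps_const c)"
proof -
  have "(\<lambda>u::complex. if u = 0 then fps_const c $ 0 else c) = (\<lambda>_. c)" by auto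
  then show ?thesis unfolding has_inf_exp_def by simp
qed

lemma has_inf_exp_inverse:
  "has_inf_exp f F \<Longrightarrow> F $ 0 \<noteq> 0 \<Longrightarrow> has_inf_exp (\<lambda>z. inverse (f z)) (inverse F)"
  unfolding has_inf_exp_def by (drule (1) has_fps_expansion_inverse) (simp add: if_distrib if_distribR cong: if_cong)

lemma has_inf_exp_X: "has_inf_exp (\<lambda>z. inverse z) fps_X"
proof -
  have "(\<lambda>u::complex. if u = 0 then fps_X $ 0 else inverse (inverse u)) = (\<lambda>u. u)" by auto
  then show ?thesis unfolding has_inf_exp_def by (simp add: has_fps_expansion_fps_X)
qed

lemma has_inf_exp_shift:
  assumes "has_inf_exp f F" "F $ 0 = 0"
  shows "has_inf_exp (\<lambda>z. z * f z) (fps_shift 1 F)"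
proof -
  have F: "fps_conv_radius F > 0" "\<forall>\<^sub>F z in at_infinity. f z = eval_fps F (inverse z)"
    using assms by (auto simp: has_inf_exp_iff)
  have sub: "subdegree F \<ge> 1 \<or> F = 0" using assms(2)
    by (metis One_nat_def Suc_leI not_gr_zero subdegree_eq_0_iff)
  obtain s :: real where s: "s > 0" "ereal s < fps_conv_radius F"
    using F ereal_dense2[of 0 "fps_conv_radius F"] by auto
  have "\<forall>\<^sub>F z::complex in at_infinity. norm z \<ge> 1 / s + 1" unfolding eventually_at_infinity by blast
  then have "\<forall>\<^sub>F z in at_infinity. z * f z = eval_fps (fps_shift 1 F) (inverse z)"
    using F(2)
  proof eventually_elim
    case (elim z)
    have z: "norm z > 1 / s" using elim(1) by linarith
    then have "norm z > 0" using s by (meson divide_pos_pos less_trans zero_less_one)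
    then have "norm (inverse z) < s" "z \<noteq> 0" using s z by (auto simp: norm_divide field_simps)
    then have "ereal (norm (inverse z)) < fps_conv_radius F" using s(2) by (meson less_ereal.simps(1) less_trans)
    then have "eval_fps (fps_shift 1 F) (inverse z) = eval_fps F (inverse z) / inverse z ^ 1"
      using eval_fps_shift[of 1 F "inverse z"] sub \<open>z \<noteq> 0\<close> by (cases "F = 0") auto
    then show ?case using elim(2) by (simp add: divide_inverse mult.commute)
  qed
  then show ?thesis using F(1) unfolding has_inf_exp_iff by simp
qed

text \<open>Removable singularity at infinity. It provides the expansion of the subordination
  function, which arises as a limit and has no explicit series.\<close>

lemma bounded_holomorphic_inf_exp:
  assumes R: "R > 0" and hol: "f holomorphic_on {z. norm z > R}" and bd: "\<And>z. norm z > R \<Longrightarrow> norm (f z) \<le> B"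
  shows "\<exists>F. has_inf_exp f F"
proof -
  define g where "g u = f (inverse u)" for u
  let ?S = "ball (0::complex) (1 / R)"
  have lt: "norm (inverse u) > R" if "u \<in> ?S - {0}" for u
    using that R by (simp add: norm_inverse) (simp add: field_simps norm_divide)
  have "(f \<circ> inverse) holomorphic_on (?S - {0})"
    by (rule holomorphic_on_compose_gen[OF _ hol]) (use lt in \<open>auto intro!: holomorphic_intros\<close>)
  then have holg: "g holomorphic_on (?S - {0})" by (simp add: g_def[abs_def] o_def)
  have "\<forall>\<^sub>F u in at 0. u \<in> ?S - {0}"
    using R by (intro eventually_at_in_open) auto
  then have "\<forall>\<^sub>F u in at 0. norm (g u) \<le> B"
    by eventually_elim (use lt bd in \<open>auto simp: g_def\<close>)
  then obtain k where k: "k holomorphic_on ?S" "\<And>z. z \<in> ?S - {0} \<Longrightarrow> k z = g z"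
    using holomorphic_on_extend_bounded[OF holg] R by auto
  have kF: "k has_fps_expansion fps_expansion k 0"
    using k(1) R by (intro has_fps_expansion_fps_expansion[OF open_ball[of 0 "1 / R"]]) auto
  have "has_inf_exp f (fps_expansion k 0)"
    unfolding has_inf_exp_def
  proof (rule has_fps_expansion_cong[THEN iffD1, rotated -1, OF kF])
    have k0: "k 0 = fps_expansion k 0 $ 0" using has_fps_expansion_imp_0_eq_fps_nth_0[OF kF] .
    have "\<forall>\<^sub>F u in nhds 0. u \<in> ?S" using R by (intro eventually_nhds_in_open) auto
    then show "\<forall>\<^sub>F u in nhds 0. k u = (if u = 0 then fps_expansion k 0 $ 0 else f (inverse u))"
      by eventually_elim (use k(2) k0 in \<open>auto simp: g_def\<close>)
  qed simp
  then show ?thesis by blast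
qed

text \<open>Conjugating the coefficients yields another expansion of the same function, and
  expansions are unique.\<close>

lemma has_inf_exp_Reals:
  assumes f: "has_inf_exp f F" and sym: "\<forall>\<^sub>F z in at_infinity. f (cnj z) = cnj (f z)"
  shows "F $ n \<in> \<real>"
proof -
  define F' where "F' = Abs_fps (\<lambda>n. cnj (F $ n))"
  have rad: "fps_conv_radius F' = fps_conv_radius F"
    unfolding fps_conv_radius_def F'_def using conv_radius_norm[of "\<lambda>n. cnj (F $ n)"] conv_radius_norm[of "fps_nth F"]
    by simp
  have F: "fps_conv_radius F > 0" "\<forall>\<^sub>F z in at_infinity. f z = eval_fps F (inverse z)"
    using f by (auto simp: has_inf_exp_iff)
  obtain s :: real where s: "s > 0" "ereal s < fps_conv_radius F"
    using F ereal_dense2[of 0 "fps_conv_radius F"] by auto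
  have ev: "eval_fps F' u = cnj (eval_fps F (cnj u))" if "norm u < s" for u
  proof -
    have "ereal (norm (cnj u)) < fps_conv_radius F" using that s(2) by (simp) (meson less_ereal.simps(1) less_trans)
    then have "(\<lambda>n. F $ n * cnj u ^ n) sums eval_fps F (cnj u)" by (rule sums_eval_fps)
    then have "(\<lambda>n. cnj (F $ n * cnj u ^ n)) sums cnj (eval_fps F (cnj u))" by (simp only: sums_cnj)
    then show ?thesis by (simp add: F'_def eval_fps_def sums_iff)
  qed
  have "\<forall>\<^sub>F z in at_infinity. f (cnj z) = eval_fps F (inverse (cnj z))"
    using F(2) unfolding eventually_at_infinity by (metis complex_mod_cnj)
  moreover have "\<forall>\<^sub>F z::complex in at_infinity. norm z \<ge> 1 / s + 1" unfolding eventually_at_infinity by blast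
  ultimately have "\<forall>\<^sub>F z in at_infinity. f z = eval_fps F' (inverse z)"
    using sym
  proof eventually_elim
    case (elim z)
    have z: "norm z > 1 / s" using elim(2) by linarith
    then have "norm z > 0" using s by (meson divide_pos_pos less_trans zero_less_one)
    then have "norm (inverse z) < s" using s z by (simp add: norm_divide field_simps)
    then show ?case using ev[of "inverse z"] elim by (metis complex_cnj_cnj complex_cnj_inverse)
  qed
  then have "has_inf_exp f F'" using F(1) rad unfolding has_inf_exp_iff by simp
  then have "F = F'" using has_inf_exp_unique[OF f] by auto
  then have "F $ n = cnj (F $ n)" by (metis F'_def fps_nth_Abs_fps)
  then show ?thesis by (metis Reals_cnj_iff)
qed

text \<open>The reciprocal of G without its linear part: bounded near infinity, and with nonnegative
  imaginary part in the upper half plane.\<close>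

definition hfun :: "real measure \<Rightarrow> complex \<Rightarrow> complex" where
  "hfun \<mu> z = inverse (stieltjes \<mu> z) - z"

lemma hfun_cnj: "hfun \<mu> (cnj z) = cnj (hfun \<mu> z)"
  by (simp add: hfun_def stieltjes_cnj)

lemma hfun_Im:
  assumes "cs_prob \<mu>" "Im z > 0" shows "Im (hfun \<mu> z) \<ge> 0"
proof -
  define g where "g = stieltjes \<mu> z"
  have g: "Im z * norm g ^ 2 \<le> - Im g" "Im g < 0" using stieltjes_Im_le[OF assms] by (auto simp: g_def)
  then have "g \<noteq> 0" by auto
  then have "norm g ^ 2 > 0" by simp
  then have "Im z \<le> - Im g / norm g ^ 2" using g(1) by (simp only: pos_le_divide_eq)
  then show ?thesis by (simp add: hfun_def g_def[symmetric] cmod_power2)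
qed

text \<open>Written as z (1/(z G) - 1): the series of z G has constant term 1 and is invertible,
  unlike that of G, and the bracket has no constant term.\<close>

lemma hfun_inf_exp:
  assumes "cs_prob \<mu>" shows "\<exists>H. has_inf_exp (hfun \<mu>) H"
proof -
  define M where "M = fps_shift 1 (mser \<mu>)"
  have M0: "M $ 0 = 1" using mser_1[OF assms] by (simp add: M_def)
  have "has_inf_exp (\<lambda>z. z * stieltjes \<mu> z) M"
    unfolding M_def by (rule has_inf_exp_shift[OF stieltjes_inf_exp[OF assms]]) simp
  then have "has_inf_exp (\<lambda>z. inverse (z * stieltjes \<mu> z) + (-1)) (inverse M + fps_const (-1))"
    using M0 by (intro has_inf_exp_add has_inf_exp_const has_inf_exp_inverse) auto
  then have "has_inf_exp (\<lambda>z. z * (inverse (z * stieltjes \<mu> z) + (-1))) (fps_shift 1 (inverse M + fps_const (-1)))"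
    by (rule has_inf_exp_shift) (use M0 in simp)
  moreover have "\<forall>\<^sub>F z in at_infinity. z * (inverse (z * stieltjes \<mu> z) + (-1)) = hfun \<mu> z"
    unfolding eventually_at_infinity by (intro exI[of _ 1]) (auto simp: hfun_def field_simps)
  ultimately show ?thesis using has_inf_exp_cong by blast
qed

lemma stieltjes_nonzero:
  assumes "cs_prob \<mu>"
  obtains R where "\<And>z. z \<in> OmegaR R \<Longrightarrow> stieltjes \<mu> z \<noteq> 0"
proof -
  have "has_inf_exp (\<lambda>z. z * stieltjes \<mu> z) (fps_shift 1 (mser \<mu>))"
    by (rule has_inf_exp_shift[OF stieltjes_inf_exp[OF assms]]) simp
  then have "((\<lambda>z. z * stieltjes \<mu> z) \<longlongrightarrow> 1) at_infinity"
    using has_inf_exp_tendsto mser_1[OF assms] by fastforce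
  then have "\<forall>\<^sub>F z in at_infinity. z * stieltjes \<mu> z \<noteq> 0"
    by (rule tendsto_imp_eventually_ne) simp
  then obtain b where "\<And>z. norm z \<ge> b \<Longrightarrow> stieltjes \<mu> z \<noteq> 0" by (auto simp: eventually_at_infinity)
  moreover have "stieltjes \<mu> z \<noteq> 0" if "Im z > 0" for z
    using stieltjes_Im_le(2)[OF assms that] by auto
  ultimately have "stieltjes \<mu> z \<noteq> 0" if "z \<in> OmegaR b" for z
    using that by (auto simp: OmegaR_def dest: less_imp_le)
  then show ?thesis using that by blast
qed

text \<open>The Lipschitz estimate is made in u = 1/z, where the domain is a convex disc; going back
  gains the factor 1/(|z| |w|), which beats any Lipschitz constant far out.\<close>

lemma hfun_large:
  assumes \<mu>: "cs_prob \<mu>"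
  shows "\<exists>R B. R > 0 \<and> B \<ge> 0 \<and> hfun \<mu> holomorphic_on OmegaR R \<and> stieltjes \<mu> holomorphic_on OmegaR R \<and>
    (\<forall>z\<in>OmegaR R. stieltjes \<mu> z \<noteq> 0) \<and>
    (\<forall>z. norm z > R \<longrightarrow> norm (hfun \<mu> z) \<le> B) \<and>
    (\<forall>z w. norm z > R \<longrightarrow> norm w > R \<longrightarrow> norm (hfun \<mu> z - hfun \<mu> w) \<le> norm (z - w) / 2)"
proof -
  obtain K where K: "supp_le \<mu> K" using cs_prob_supp[OF \<mu>] .
  obtain R1 where R1: "\<And>z. z \<in> OmegaR R1 \<Longrightarrow> stieltjes \<mu> z \<noteq> 0" using stieltjes_nonzero[OF \<mu>] by blast
  obtain H where H: "has_inf_exp (hfun \<mu>) H" using hfun_inf_exp[OF \<mu>] by blast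
  then obtain b where b: "\<And>z. norm z \<ge> b \<Longrightarrow> hfun \<mu> z = eval_fps H (inverse z)"
    by (auto simp: has_inf_exp_iff eventually_at_infinity)
  obtain s :: real where s: "s > 0" "ereal s < fps_conv_radius H"
    using H ereal_dense2[of 0 "fps_conv_radius H"] unfolding has_inf_exp_iff by auto
  have sub: "ereal (norm u) < fps_conv_radius H" if "u \<in> cball 0 s" for u
    using that s(2) by (simp) (meson ereal_less_eq(3) le_less_trans)
  have cs: "compact (eval_fps H ` cball 0 s)" "compact (eval_fps (fps_deriv H) ` cball 0 s)"
  proof -
    have sub': "ereal (norm u) < fps_conv_radius (fps_deriv H)" if "u \<in> cball 0 s" for u
      using sub[OF that] fps_conv_radius_deriv[of H] by (rule less_le_trans)
    show "compact (eval_fps H ` cball 0 s)" "compact (eval_fps (fps_deriv H) ` cball 0 s)"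
      by (auto intro!: compact_continuous_image continuous_on_eval_fps' simp: sub sub')
  qed
  obtain B where B: "\<And>u. norm u \<le> s \<Longrightarrow> norm (eval_fps H u) \<le> B"
    using compact_imp_bounded[OF cs(1)] unfolding bounded_iff by (metis imageI mem_cball_0)
  obtain L where L: "\<And>u. norm u \<le> s \<Longrightarrow> norm (eval_fps (fps_deriv H) u) \<le> L"
    using compact_imp_bounded[OF cs(2)] unfolding bounded_iff by (metis imageI mem_cball_0)
  have L0: "L \<ge> 0" using order_trans[OF norm_ge_zero L[of 0]] s by simp
  have B0: "B \<ge> 0" using order_trans[OF norm_ge_zero B[of 0]] s by simp
  have lip: "norm (eval_fps H u - eval_fps H v) \<le> L * norm (u - v)" if "norm u \<le> s" "norm v \<le> s" for u v
  proof (rule field_differentiable_bound[of "cball 0 s" "eval_fps H" "eval_fps (fps_deriv H)"])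
    fix x assume "x \<in> cball (0::complex) s"
    then show "(eval_fps H has_field_derivative eval_fps (fps_deriv H) x) (at x within cball 0 s)"
      using sub by (intro has_field_derivative_eval_fps) auto
    show "norm (eval_fps (fps_deriv H) x) \<le> L" using L \<open>x \<in> cball 0 s\<close> by auto
  qed (use that in auto)
  \<comment> \<open>\<open>K\<close> serves holomorphy and \<open>R1\<close> nonvanishing;
    \<open>b\<close> and \<open>1 / s\<close> bring 1/z into the disc of the series; 1 and
    \<open>2 * L\<close> together give |z| |w| \<ge> 2 L, hence the Lipschitz constant 1/2.\<close>
  define R where "R = Max {1, K, R1, b, 1 / s, 2 * L}"
  have R: "R \<ge> 1" "R \<ge> K" "R \<ge> R1" "R \<ge> b" "R \<ge> 1 / s" "R \<ge> 2 * L" by (auto simp: R_def)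
  have inv: "norm (inverse z) \<le> s" if "norm z > R" for z :: complex
  proof -
    have "1 / s \<le> norm z" using that R by simp
    then have "inverse (norm z) \<le> inverse (1 / s)" using s by (intro le_imp_inverse_le) auto
    then show ?thesis by (simp add: norm_inverse)
  qed
  have hH: "hfun \<mu> z = eval_fps H (inverse z)" if "norm z > R" for z using b[of z] that R by simp
  have "norm (hfun \<mu> z - hfun \<mu> w) \<le> norm (z - w) / 2" if zw: "norm z > R" "norm w > R" for z w
  proof -
    have nz: "z \<noteq> 0" "w \<noteq> 0" using zw R by auto
    have "norm (hfun \<mu> z - hfun \<mu> w) \<le> L * norm (inverse z - inverse w)"
      using hH zw lip inv by simp
    also have "inverse z - inverse w = (w - z) / (z * w)" using nz by (simp add: field_simps)
    also have "norm \<dots> = norm (z - w) / (norm z * norm w)" by (simp add: norm_divide norm_mult norm_minus_commute)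
    also have "L * (norm (z - w) / (norm z * norm w)) \<le> norm (z - w) / 2"
    proof -
      have "2 * L \<le> R * 1" using R by simp
      also have "\<dots> \<le> norm z * norm w" using zw R by (intro mult_mono) auto
      finally have le: "2 * L \<le> norm z * norm w" .
      have "norm z * norm w > 0" using nz by simp
      then show ?thesis using mult_right_mono[OF le norm_ge_zero[of "z - w"]] by (simp add: field_simps)
    qed
    finally show ?thesis .
  qed
  moreover have "norm (hfun \<mu> z) \<le> B" if "norm z > R" for z using hH[OF that] B inv[OF that] by simp
  moreover have hs: "stieltjes \<mu> holomorphic_on OmegaR R"
    using stieltjes_holomorphic[OF \<mu> K] OmegaR_mono[OF R(2)] holomorphic_on_subset by blast
  moreover have nz: "\<forall>z\<in>OmegaR R. stieltjes \<mu> z \<noteq> 0" using R1 OmegaR_mono[OF R(3)] by blast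
  moreover have "hfun \<mu> holomorphic_on OmegaR R"
    unfolding hfun_def[abs_def] using hs nz by (intro holomorphic_intros) auto
  ultimately show ?thesis using R(1) B0 by (intro exI[of _ R] exI[of _ B]) auto
qed

text \<open>Large z are covered by the expansion, the rest of the half plane is compact. This is the
  bound on the iterates away from infinity.\<close>

lemma hfun_bounded_half_plane:
  assumes \<mu>: "cs_prob \<mu>" and e: "e > 0"
  shows "\<exists>B. \<forall>z. Im z \<ge> e \<longrightarrow> norm (hfun \<mu> z) \<le> B"
proof -
  obtain R B where RB: "hfun \<mu> holomorphic_on OmegaR R" "\<And>z. norm z > R \<Longrightarrow> norm (hfun \<mu> z) \<le> B"
    using hfun_large[OF \<mu>] by metis
  have "compact (cball 0 R \<inter> {z. Im z \<ge> e})" by (intro compact_Int_closed closed_halfspace_Im_ge) auto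
  then have "compact (hfun \<mu> ` (cball 0 R \<inter> {z. Im z \<ge> e}))"
    by (intro compact_continuous_image continuous_on_subset[OF holomorphic_on_imp_continuous_on[OF RB(1)]])
       (use e in \<open>auto simp: OmegaR_def\<close>)
  then have "bounded (hfun \<mu> ` (cball 0 R \<inter> {z. Im z \<ge> e}))" by (rule compact_imp_bounded)
  then obtain B' where B': "\<And>z. norm z \<le> R \<Longrightarrow> Im z \<ge> e \<Longrightarrow> norm (hfun \<mu> z) \<le> B'"
    unfolding bounded_iff by (metis (mono_tags, lifting) IntI imageI mem_Collect_eq mem_cball_0)
  have "norm (hfun \<mu> z) \<le> max B B'" if "Im z \<ge> e" for z
    using RB(2)[of z] B'[of z] that by (cases "norm z > R") auto
  then show ?thesis by blast
qed

section \<open>The subordination function\<close>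

primrec subord_iter :: "real measure \<Rightarrow> real measure \<Rightarrow> nat \<Rightarrow> complex \<Rightarrow> complex" where
  "subord_iter \<mu> \<nu> 0 z = z"
| "subord_iter \<mu> \<nu> (Suc n) z = z + hfun \<nu> (z + hfun \<mu> (subord_iter \<mu> \<nu> n z))"

lemma subord_iter_cnj: "subord_iter \<mu> \<nu> n (cnj z) = cnj (subord_iter \<mu> \<nu> n z)"
  by (induction n) (simp_all add: hfun_cnj flip: complex_cnj_add)

lemma subord_iter_Im:
  assumes "cs_prob \<mu>" "cs_prob \<nu>" "Im z > 0"
  shows "Im (subord_iter \<mu> \<nu> n z) \<ge> Im z" "Im (z + hfun \<mu> (subord_iter \<mu> \<nu> n z)) \<ge> Im z"
proof -
  show *: "Im (subord_iter \<mu> \<nu> n z) \<ge> Im z" for n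
  proof (induction n)
    case (Suc n)
    then have "Im (hfun \<mu> (subord_iter \<mu> \<nu> n z)) \<ge> 0" using assms by (intro hfun_Im) auto
    then have "Im (hfun \<nu> (z + hfun \<mu> (subord_iter \<mu> \<nu> n z))) \<ge> 0" using assms by (intro hfun_Im) auto
    then show ?case by simp
  qed simp
  have "Im (hfun \<mu> (subord_iter \<mu> \<nu> n z)) \<ge> 0" using *[of n] assms by (intro hfun_Im) auto
  then show "Im (z + hfun \<mu> (subord_iter \<mu> \<nu> n z)) \<ge> Im z" by simp
qed

text \<open>Away from infinity the iterates are merely a normal family, so Montel's theorem yields a
  subsequence only. Near infinity consecutive iterates approach each other geometrically, so the
  shifted subsequence has the same limit there and the fixed point equation follows.\<close>

lemma subordination:
  assumes \<mu>: "cs_prob \<mu>" and \<nu>: "cs_prob \<nu>"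
  shows "\<exists>R \<omega> B. R > 0 \<and> \<omega> holomorphic_on OmegaR R \<and> (\<forall>z. Im z > 0 \<longrightarrow> Im (\<omega> z) \<ge> Im z) \<and>
     (\<forall>z. norm z > R \<longrightarrow> norm (\<omega> z - z) \<le> B \<and> \<omega> (cnj z) = cnj (\<omega> z) \<and>
        \<omega> z = z + hfun \<nu> (z + hfun \<mu> (\<omega> z)) \<and>
        stieltjes \<mu> (\<omega> z) \<noteq> 0 \<and> stieltjes \<nu> (z + hfun \<mu> (\<omega> z)) \<noteq> 0 \<and> \<omega> z \<noteq> 0 \<and> z + hfun \<mu> (\<omega> z) \<noteq> 0) \<and>
     (\<lambda>z. stieltjes \<mu> (\<omega> z)) holomorphic_on OmegaR R"
proof -
  obtain R1 B1 where 1: "R1 > 0" "B1 \<ge> 0" "hfun \<mu> holomorphic_on OmegaR R1" "stieltjes \<mu> holomorphic_on OmegaR R1"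
    "\<And>z. z \<in> OmegaR R1 \<Longrightarrow> stieltjes \<mu> z \<noteq> 0" "\<And>z. norm z > R1 \<Longrightarrow> norm (hfun \<mu> z) \<le> B1"
    "\<And>z w. norm z > R1 \<Longrightarrow> norm w > R1 \<Longrightarrow> norm (hfun \<mu> z - hfun \<mu> w) \<le> norm (z - w) / 2"
    using hfun_large[OF \<mu>] by auto
  obtain R2 B2 where 2: "R2 > 0" "B2 \<ge> 0" "hfun \<nu> holomorphic_on OmegaR R2" "stieltjes \<nu> holomorphic_on OmegaR R2"
    "\<And>z. z \<in> OmegaR R2 \<Longrightarrow> stieltjes \<nu> z \<noteq> 0" "\<And>z. norm z > R2 \<Longrightarrow> norm (hfun \<nu> z) \<le> B2"
    "\<And>z w. norm z > R2 \<Longrightarrow> norm w > R2 \<Longrightarrow> norm (hfun \<nu> z - hfun \<nu> w) \<le> norm (z - w) / 2"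
    using hfun_large[OF \<nu>] by auto
  define B where "B = max B1 B2"
  define R0 where "R0 = max R1 R2"
  \<comment> \<open>Points at distance at most \<open>B\<close> from some z with |z| >
    \<open>R\<close> are still beyond \<open>R0\<close>, so the estimates for both h apply to all
    iterates.\<close>
  define R where "R = R0 + B"
  have B: "B \<ge> 0" "B1 \<le> B" "B2 \<le> B" using 1(2) by (auto simp: B_def)
  have R0: "R0 > 0" "R1 \<le> R0" "R2 \<le> R0" using 1(1) by (auto simp: R0_def)
  let ?w = "subord_iter \<mu> \<nu>"
  define v where "v n z = z + hfun \<mu> (?w n z)" for n z
  have far: "norm x > R0" if "norm z > R" "norm (x - z) \<le> B" for x z :: complex
    using norm_triangle_ineq2[of z x] that unfolding R_def by (simp add: norm_minus_commute)
  have wv: "norm (?w n z - z) \<le> B \<and> norm (v n z - z) \<le> B" if z: "norm z > R" for n z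
  proof -
    have vb: "norm (v n z - z) \<le> B" if "norm (?w n z - z) \<le> B" for n
      using far[OF z that] 1(6)[of "?w n z"] R0 B by (simp add: v_def)
    have "norm (?w n z - z) \<le> B"
    proof (induction n)
      case (Suc n)
      have "norm (v n z) > R0" using vb[OF Suc] far[OF z] by blast
      then show ?case using 2(6)[of "v n z"] R0 B by (simp add: v_def)
    qed (use B in simp)
    then show ?thesis using vb by blast
  qed
  have wO: "?w n z \<in> OmegaR R0" and vO: "v n z \<in> OmegaR R0" if "z \<in> OmegaR R" for n z
  proof -
    show "?w n z \<in> OmegaR R0"
      using that subord_iter_Im(1)[OF \<mu> \<nu>, of z n] wv[of z n] far[of z "?w n z"] by (auto simp: OmegaR_def)
    show "v n z \<in> OmegaR R0"
      using that subord_iter_Im(2)[OF \<mu> \<nu>, of z n] wv[of z n] far[of z "v n z"] by (auto simp: OmegaR_def v_def)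
  qed
  have h1: "hfun \<mu> holomorphic_on OmegaR R0" using 1(3) OmegaR_mono[OF R0(2)] holomorphic_on_subset by blast
  have h2: "hfun \<nu> holomorphic_on OmegaR R0" using 2(3) OmegaR_mono[OF R0(3)] holomorphic_on_subset by blast
  have hol: "?w n holomorphic_on OmegaR R" for n
  proof (induction n)
    case 0
    have "?w 0 = (\<lambda>z. z)" by auto
    then show ?case by simp
  next
    case (Suc n)
    have "(hfun \<mu> \<circ> ?w n) holomorphic_on OmegaR R"
      by (rule holomorphic_on_compose_gen[OF Suc h1]) (use wO in auto)
    then have "v n holomorphic_on OmegaR R" unfolding v_def o_def by (intro holomorphic_intros)
    then have "(hfun \<nu> \<circ> v n) holomorphic_on OmegaR R"
      by (rule holomorphic_on_compose_gen[OF _ h2]) (use vO in auto)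
    then have "(\<lambda>z. z + (hfun \<nu> \<circ> v n) z) holomorphic_on OmegaR R" by (intro holomorphic_intros)
    moreover have "?w (Suc n) = (\<lambda>z. z + (hfun \<nu> \<circ> v n) z)" by (auto simp: v_def)
    ultimately show ?case by simp
  qed
  have bounded: "\<exists>C. \<forall>h\<in>range ?w. \<forall>z\<in>K. norm (h z) \<le> C" if K: "compact K" "K \<subseteq> OmegaR R" for K
  proof -
    obtain b where b: "\<And>z. z \<in> K \<Longrightarrow> norm z \<le> b" using compact_imp_bounded[OF K(1)] by (auto simp: bounded_iff)
    \<comment> \<open>Outside this part the iterates stay within \<open>B\<close> of z. The part
      itself is a compact subset of the upper half plane, hence at some height at least e > 0, and
      the argument of the outer h never drops below that height.\<close>
    define K' where "K' = K \<inter> cball 0 R"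
    have cK': "compact K'" unfolding K'_def by (intro compact_Int_closed K) auto
    have K'Im: "Im z > 0" if "z \<in> K'" for z using that K(2) by (auto simp: K'_def OmegaR_def)
    obtain e where e: "e > 0" "\<And>z. z \<in> K' \<Longrightarrow> Im z \<ge> e"
    proof (cases "K' = {}")
      case False
      then obtain x where "x \<in> K'" "\<forall>y\<in>K'. Im x \<le> Im y"
        using continuous_attains_inf[OF cK' False, of Im] continuous_on_Im[OF continuous_on_id] by auto
      then show ?thesis using that[of "Im x"] K'Im by auto
    qed (use that[of 1] in auto)
    obtain C where C: "\<And>z. Im z \<ge> e \<Longrightarrow> norm (hfun \<nu> z) \<le> C" using hfun_bounded_half_plane[OF \<nu> e(1)] by blast
    have "norm (?w n z) \<le> b + max B (max C 0)" if z: "z \<in> K" for n z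
    proof (cases "norm z > R")
      case True
      have "norm (?w n z) \<le> norm z + norm (?w n z - z)" using norm_triangle_ineq[of z "?w n z - z"] by simp
      then show ?thesis using wv[OF True, of n] b[OF z] by linarith
    next
      case False
      then have zK': "z \<in> K'" using z by (auto simp: K'_def)
      show ?thesis
      proof (cases n)
        case 0 then show ?thesis using b[OF z] B by simp
      next
        case (Suc m)
        have "Im (v m z) \<ge> e" using subord_iter_Im(2)[OF \<mu> \<nu> K'Im[OF zK'], of m] e(2)[OF zK'] by (simp add: v_def)
        then have "norm (hfun \<nu> (v m z)) \<le> C" by (rule C)
        then show ?thesis using norm_triangle_ineq[of z "hfun \<nu> (v m z)"] b[OF z] Suc by (simp add: v_def)
      qed
    qed
    then show ?thesis by blast
  qed
  obtain \<omega> r where \<omega>: "\<omega> holomorphic_on OmegaR R" and r: "strict_mono (r :: nat \<Rightarrow> nat)"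
    and lim: "\<And>z. z \<in> OmegaR R \<Longrightarrow> (\<lambda>n. ?w (r n) z) \<longlonglongrightarrow> \<omega> z"
  proof (rule Montel[OF open_OmegaR[of R], of "range ?w" ?w])
    show "h holomorphic_on OmegaR R" if "h \<in> range ?w" for h using that hol by auto
    show "\<exists>C. \<forall>h\<in>range ?w. \<forall>z\<in>K. norm (h z) \<le> C" if "compact K" "K \<subseteq> OmegaR R" for K
      using bounded[OF that] .
  next
    fix g s assume "g holomorphic_on OmegaR R" "strict_mono (s :: nat \<Rightarrow> nat)"
      "\<And>z. z \<in> OmegaR R \<Longrightarrow> (\<lambda>n. ?w (s n) z) \<longlonglongrightarrow> g z"
    then show thesis by (rule that)
  qed auto
  have Im\<omega>: "Im (\<omega> z) \<ge> Im z" if "Im z > 0" for z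
  proof (rule tendsto_lowerbound)
    show "(\<lambda>n. Im (?w (r n) z)) \<longlonglongrightarrow> Im (\<omega> z)" by (intro tendsto_Im lim) (use that in \<open>simp add: OmegaR_def\<close>)
  qed (use subord_iter_Im(1)[OF \<mu> \<nu> that] in auto)
  have \<omega>B: "norm (\<omega> z - z) \<le> B" if "norm z > R" for z
  proof (rule tendsto_upperbound)
    show "(\<lambda>n. norm (?w (r n) z - z)) \<longlonglongrightarrow> norm (\<omega> z - z)" by (intro tendsto_intros lim) (use that in \<open>simp add: OmegaR_def\<close>)
  qed (use wv[OF that] in auto)
  have \<omega>cnj: "\<omega> (cnj z) = cnj (\<omega> z)" if "norm z > R" for z
  proof (rule LIMSEQ_unique)
    show "(\<lambda>n. ?w (r n) (cnj z)) \<longlonglongrightarrow> \<omega> (cnj z)" by (rule lim) (use that in \<open>simp add: OmegaR_def\<close>)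
    show "(\<lambda>n. ?w (r n) (cnj z)) \<longlonglongrightarrow> cnj (\<omega> z)"
      unfolding subord_iter_cnj by (intro tendsto_cnj lim) (use that in \<open>simp add: OmegaR_def\<close>)
  qed
  have \<omega>O: "\<omega> z \<in> OmegaR R0" if "z \<in> OmegaR R" for z
    using that Im\<omega>[of z] \<omega>B[of z] far[of z "\<omega> z"] by (auto simp: OmegaR_def)
  have \<omega>2far: "norm (z + hfun \<mu> (\<omega> z)) > R0" if "norm z > R" for z
    using far[OF that \<omega>B[OF that]] 1(6)[of "\<omega> z"] R0 B by (intro far[OF that]) auto
  have fixed: "\<omega> z = z + hfun \<nu> (z + hfun \<mu> (\<omega> z))" if z: "norm z > R" for z
  proof -
    have zO: "z \<in> OmegaR R" using z by (simp add: OmegaR_def)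
    have wfar: "norm (?w n z) > R0" "norm (v n z) > R0" for n using wv[OF z, of n] far[OF z] by auto
    have diff: "norm (?w (Suc n) z - ?w n z) \<le> B * (1 / 2) ^ n" for n
    proof (induction n)
      case 0 then show ?case using wv[OF z, of 1] by simp
    next
      case (Suc n)
      have "norm (?w (Suc (Suc n)) z - ?w (Suc n) z) = norm (hfun \<nu> (v (Suc n) z) - hfun \<nu> (v n z))"
        by (simp add: v_def)
      moreover have "norm (hfun \<nu> (v (Suc n) z) - hfun \<nu> (v n z)) \<le> norm (v (Suc n) z - v n z) / 2"
        using 2(7)[of "v (Suc n) z" "v n z"] wfar(2)[of n] wfar(2)[of "Suc n"] R0 by simp
      moreover have "norm (v (Suc n) z - v n z) = norm (hfun \<mu> (?w (Suc n) z) - hfun \<mu> (?w n z))" by (simp add: v_def)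
      moreover have "norm (hfun \<mu> (?w (Suc n) z) - hfun \<mu> (?w n z)) \<le> norm (?w (Suc n) z - ?w n z) / 2"
        using 1(7)[of "?w (Suc n) z" "?w n z"] wfar(1)[of n] wfar(1)[of "Suc n"] R0 by (simp del: subord_iter.simps)
      moreover have "norm (?w (Suc n) z - ?w n z) \<ge> 0" by simp
      ultimately have "norm (?w (Suc (Suc n)) z - ?w (Suc n) z) \<le> norm (?w (Suc n) z - ?w n z) / 2" by linarith
      then show ?case using Suc by (simp del: subord_iter.simps)
    qed
    have "(\<lambda>n. B * (1 / 2) ^ n) \<longlonglongrightarrow> B * 0" by (intro tendsto_intros LIMSEQ_power_zero) simp
    then have lim0: "(\<lambda>n. B * (1 / 2) ^ n) \<longlonglongrightarrow> 0" by simp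
    \<comment> \<open>Lets the limit along \<open>r n\<close> be transferred to
      \<open>Suc (r n)\<close>, which need not belong to the subsequence.\<close>
    have d0: "(\<lambda>n. ?w (Suc n) z - ?w n z) \<longlonglongrightarrow> 0"
      by (rule Lim_null_comparison[OF always_eventually lim0]) (rule allI, rule diff)
    then have "(\<lambda>n. ?w (Suc (r n)) z - ?w (r n) z) \<longlonglongrightarrow> 0"
      using LIMSEQ_subseq_LIMSEQ[OF d0 r] by (simp only: o_def)
    then have "(\<lambda>n. ?w (r n) z + (?w (Suc (r n)) z - ?w (r n) z)) \<longlonglongrightarrow> \<omega> z + 0"
      by (intro tendsto_add lim zO)
    then have A: "(\<lambda>n. ?w (Suc (r n)) z) \<longlonglongrightarrow> \<omega> z" by (simp del: subord_iter.simps)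
    have c1: "isCont (hfun \<mu>) (\<omega> z)"
      using h1 \<omega>O[OF zO] open_OmegaR holomorphic_on_imp_continuous_on continuous_on_eq_continuous_at by blast
    have c2: "isCont (hfun \<nu>) (z + hfun \<mu> (\<omega> z))"
      using h2 \<omega>2far[OF z] open_OmegaR holomorphic_on_imp_continuous_on continuous_on_eq_continuous_at
      by (metis (mono_tags, lifting) OmegaR_def UnI2 mem_Collect_eq)
    have "(\<lambda>n. ?w (Suc (r n)) z) \<longlonglongrightarrow> z + hfun \<nu> (z + hfun \<mu> (\<omega> z))"
      unfolding subord_iter.simps
      by (intro tendsto_add tendsto_const isCont_tendsto_compose[OF c2] isCont_tendsto_compose[OF c1] lim zO)
    then show ?thesis using A LIMSEQ_unique by blast
  qed
  have "(stieltjes \<mu> \<circ> \<omega>) holomorphic_on OmegaR R"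
    by (rule holomorphic_on_compose_gen[OF \<omega> 1(4)]) (use \<omega>O OmegaR_mono[OF R0(2)] in blast)
  then have holG: "(\<lambda>z. stieltjes \<mu> (\<omega> z)) holomorphic_on OmegaR R" by (simp add: o_def)
  have nz: "stieltjes \<mu> (\<omega> z) \<noteq> 0 \<and> stieltjes \<nu> (z + hfun \<mu> (\<omega> z)) \<noteq> 0 \<and> \<omega> z \<noteq> 0 \<and> z + hfun \<mu> (\<omega> z) \<noteq> 0"
    if z: "norm z > R" for z
  proof -
    have far1: "norm (\<omega> z) > R0" using far[OF z \<omega>B[OF z]] .
    have "\<omega> z \<in> OmegaR R1" "z + hfun \<mu> (\<omega> z) \<in> OmegaR R2" using far1 \<omega>2far[OF z] R0 by (auto simp: OmegaR_def)
    moreover have "\<omega> z \<noteq> 0" "z + hfun \<mu> (\<omega> z) \<noteq> 0" using far1 \<omega>2far[OF z] R0 by (auto simp del: add_eq_0_iff)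
    ultimately show ?thesis using 1(5) 2(5) by blast
  qed
  show ?thesis
    by (intro exI[of _ R] exI[of _ \<omega>] exI[of _ B] conjI allI impI)
       (use R0 B \<omega> Im\<omega> \<omega>B \<omega>cnj fixed nz holG in \<open>auto simp: R_def\<close>)
qed

section \<open>Sums of R-transforms are R-transforms of measures\<close>

lemma has_inf_exp_inverse_perturbed:
  assumes "has_inf_exp d D"
  shows "has_inf_exp (\<lambda>z. inverse (z + d z)) (fps_X * inverse (1 + fps_X * D))"
proof -
  have "has_inf_exp (\<lambda>z. inverse z * inverse (1 + inverse z * d z)) (fps_X * inverse (fps_const 1 + fps_X * D))"
    by (intro has_inf_exp_mult has_inf_exp_X has_inf_exp_inverse has_inf_exp_add has_inf_exp_const assms) simp
  moreover have "\<forall>\<^sub>F z in at_infinity. inverse z * inverse (1 + inverse z * d z) = inverse (z + d z)"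
    unfolding eventually_at_infinity
  proof (intro exI[of _ 1] allI impI)
    fix z :: complex assume "1 \<le> norm z"
    then have "z \<noteq> 0" by auto
    then have "z * (1 + inverse z * d z) = z + d z" by (simp add: field_simps)
    then show "inverse z * inverse (1 + inverse z * d z) = inverse (z + d z)"
      by (metis inverse_mult_distrib)
  qed
  ultimately show ?thesis using has_inf_exp_cong by fastforce
qed

text \<open>The relation g = u (1 + g R(g)) with u replaced by a series P; for the expansion P of
  1/\<omega> it describes G(\<omega>(z)).\<close>

lemma mser_compose_R_eq:
  assumes \<mu>: "moment \<mu> 0 = 1" and P: "P $ 0 = 0" and F: "F = mser \<mu> oo P"
  shows "F = P * ((1 + fps_X * Rc \<mu>) oo F)"
proof -
  have "F = (fps_X * ((1 + fps_X * Rc \<mu>) oo mser \<mu>)) oo P" using F mser_R_eq[OF \<mu>] by metis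
  also have "\<dots> = P * (((1 + fps_X * Rc \<mu>) oo mser \<mu>) oo P)"
    using P by (simp add: fps_compose_mult_distrib)
  also have "((1 + fps_X * Rc \<mu>) oo mser \<mu>) oo P = (1 + fps_X * Rc \<mu>) oo F"
    unfolding F by (rule fps_compose_assoc[symmetric]) (use P in \<open>simp_all add: mser_nth\<close>)
  finally show ?thesis .
qed

text \<open>For G = G_\<mu>(\<omega>) = G_\<nu>(\<omega>2) one has \<omega> + \<omega>2 = z + 1/G,
  while the R-transform relations read \<omega> = A1/G and \<omega>2 = A2/G. Adding them gives z G =
  A1 + A2 - 1, the relation for the sum of the R-transforms.\<close>

lemma free_conv_ex:
  assumes \<mu>: "cs_prob \<mu>" and \<nu>: "cs_prob \<nu>"
  shows "\<exists>\<rho>. cs_prob \<rho> \<and> Rc \<rho> = Rc \<mu> + Rc \<nu>"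
proof -
  obtain R \<omega> B where R: "R > 0" and hol: "\<omega> holomorphic_on OmegaR R" and Im: "\<forall>z. Im z > 0 \<longrightarrow> Im (\<omega> z) \<ge> Im z"
    and at_large: "\<forall>z. norm z > R \<longrightarrow> norm (\<omega> z - z) \<le> B \<and> \<omega> (cnj z) = cnj (\<omega> z) \<and>
        \<omega> z = z + hfun \<nu> (z + hfun \<mu> (\<omega> z)) \<and>
        stieltjes \<mu> (\<omega> z) \<noteq> 0 \<and> stieltjes \<nu> (z + hfun \<mu> (\<omega> z)) \<noteq> 0 \<and> \<omega> z \<noteq> 0 \<and> z + hfun \<mu> (\<omega> z) \<noteq> 0"
    and holG: "(\<lambda>z. stieltjes \<mu> (\<omega> z)) holomorphic_on OmegaR R"
    using subordination[OF \<mu> \<nu>] by (elim exE conjE)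
  have B: "\<And>z. norm z > R \<Longrightarrow> norm (\<omega> z - z) \<le> B" and cnj: "\<And>z. norm z > R \<Longrightarrow> \<omega> (cnj z) = cnj (\<omega> z)"
    and fixed: "\<And>z. norm z > R \<Longrightarrow> \<omega> z = z + hfun \<nu> (z + hfun \<mu> (\<omega> z))"
    and nz: "\<And>z. norm z > R \<Longrightarrow> stieltjes \<mu> (\<omega> z) \<noteq> 0" "\<And>z. norm z > R \<Longrightarrow> stieltjes \<nu> (z + hfun \<mu> (\<omega> z)) \<noteq> 0"
      "\<And>z. norm z > R \<Longrightarrow> \<omega> z \<noteq> 0" "\<And>z. norm z > R \<Longrightarrow> z + hfun \<mu> (\<omega> z) \<noteq> 0"
    using at_large by blast+
  have large: "\<forall>\<^sub>F z in at_infinity. Q z" if "\<And>z. norm z > R \<Longrightarrow> Q z" for Q :: "complex \<Rightarrow> bool"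
    unfolding eventually_at_infinity using that by (intro exI[of _ "R + 1"]) auto
  define \<omega>2 where "\<omega>2 z = z + hfun \<mu> (\<omega> z)" for z
  define G where "G z = stieltjes \<mu> (\<omega> z)" for z
  have \<omega>2G: "\<omega> z + \<omega>2 z = z + inverse (G z)" for z by (simp add: \<omega>2_def G_def hfun_def)
  have \<omega>3G: "stieltjes \<nu> (\<omega>2 z) = G z" if "norm z > R" for z
  proof -
    have "\<omega> z = z + (inverse (stieltjes \<nu> (\<omega>2 z)) - \<omega>2 z)"
      using fixed[OF that] by (simp add: \<omega>2_def hfun_def)
    then have "\<omega> z + \<omega>2 z = z + inverse (stieltjes \<nu> (\<omega>2 z))" by (metis add_diff_eq diff_add_cancel)
    then show ?thesis using \<omega>2G[of z] by simp
  qed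
  have "(\<lambda>z. \<omega> z - z) holomorphic_on {z. norm z > R}"
    by (intro holomorphic_intros holomorphic_on_subset[OF hol]) (auto simp: OmegaR_def)
  then obtain D where D: "has_inf_exp (\<lambda>z. \<omega> z - z) D"
    using bounded_holomorphic_inf_exp[of R "\<lambda>z. \<omega> z - z" B] R B by blast
  define P1 where "P1 = fps_X * inverse (1 + fps_X * D)"
  have P1: "has_inf_exp (\<lambda>z. inverse (\<omega> z)) P1"
    using has_inf_exp_inverse_perturbed[OF D] by (simp add: P1_def)
  have P1_nth: "P1 $ 0 = 0" "P1 $ 1 = 1" by (simp_all add: P1_def)
  obtain H where H: "has_inf_exp (hfun \<mu>) H" using hfun_inf_exp[OF \<mu>] by blast
  have "has_inf_exp (\<lambda>z. hfun \<mu> (\<omega> z)) (H oo P1)"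
    by (rule has_inf_exp_compose_inf[OF H P1 P1_nth(1) large[OF nz(3)]])
  define P2 where "P2 = fps_X * inverse (1 + fps_X * (H oo P1))"
  have P2: "has_inf_exp (\<lambda>z. inverse (\<omega>2 z)) P2"
    using has_inf_exp_inverse_perturbed[OF \<open>has_inf_exp (\<lambda>z. hfun \<mu> (\<omega> z)) (H oo P1)\<close>] by (simp add: P2_def \<omega>2_def)
  have P2_nth: "P2 $ 0 = 0" "P2 $ 1 = 1" by (simp_all add: P2_def)
  define F where "F = mser \<mu> oo P1"
  have GF: "has_inf_exp G F" unfolding G_def F_def
    by (rule has_inf_exp_compose_inf[OF stieltjes_inf_exp[OF \<mu>] P1 P1_nth(1) large[OF nz(3)]])
  have "has_inf_exp (\<lambda>z. stieltjes \<nu> (\<omega>2 z)) (mser \<nu> oo P2)"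
    by (rule has_inf_exp_compose_inf[OF stieltjes_inf_exp[OF \<nu>] P2 P2_nth(1) large]) (use nz(4) in \<open>simp add: \<omega>2_def\<close>)
  then have F2: "F = mser \<nu> oo P2"
    by (rule has_inf_exp_unique[symmetric, OF _ GF large[OF \<omega>3G]])
  \<comment> \<open>The identity \<omega> + \<omega>2 = z + 1/G with denominators cleared, because
    each of its terms has a pole at infinity.\<close>
  have rel: "(P1 + P2) * (fps_X * F) = P1 * P2 * (F + fps_X)"
  proof (rule has_inf_exp_unique)
    show "has_inf_exp (\<lambda>z. (inverse (\<omega> z) + inverse (\<omega>2 z)) * (inverse z * G z)) ((P1 + P2) * (fps_X * F))"
      by (intro has_inf_exp_mult has_inf_exp_add P1 P2 GF has_inf_exp_X)
    show "has_inf_exp (\<lambda>z. inverse (\<omega> z) * inverse (\<omega>2 z) * (G z + inverse z)) (P1 * P2 * (F + fps_X))"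
      by (intro has_inf_exp_mult has_inf_exp_add P1 P2 GF has_inf_exp_X)
    show "\<forall>\<^sub>F z in at_infinity. (inverse (\<omega> z) + inverse (\<omega>2 z)) * (inverse z * G z) =
        inverse (\<omega> z) * inverse (\<omega>2 z) * (G z + inverse z)"
    proof (rule large)
      fix z :: complex assume z: "norm z > R"
      have n: "\<omega> z \<noteq> 0" "\<omega>2 z \<noteq> 0" "G z \<noteq> 0" "z \<noteq> 0" using nz z R by (auto simp: \<omega>2_def G_def)
      have "(inverse (\<omega> z) + inverse (\<omega>2 z)) * (inverse z * G z) = inverse (\<omega> z) * inverse (\<omega>2 z) * ((\<omega> z + \<omega>2 z) * (inverse z * G z))"
        using n by (simp add: field_simps)
      also have "(\<omega> z + \<omega>2 z) * (inverse z * G z) = G z + inverse z"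
        unfolding \<omega>2G using n by (simp add: field_simps)
      finally show "(inverse (\<omega> z) + inverse (\<omega>2 z)) * (inverse z * G z) =
        inverse (\<omega> z) * inverse (\<omega>2 z) * (G z + inverse z)" .
    qed
  qed
  define A1 where "A1 = (1 + fps_X * Rc \<mu>) oo F"
  define A2 where "A2 = (1 + fps_X * Rc \<nu>) oo F"
  have FA: "F = P1 * A1" "F = P2 * A2"
    unfolding A1_def A2_def using mser_compose_R_eq[OF moment_0[OF \<mu>] P1_nth(1)] mser_compose_R_eq[OF moment_0[OF \<nu>] P2_nth(1)] F_def F2 by blast+
  have F_nth: "F $ 0 = 0" "F $ 1 = 1"
    unfolding F_def using fps_compose_nth_1[of "mser \<mu>" P1] P1_nth mser_1[OF \<mu>] by auto
  have "P1 * P2 * F = P1 * P2 * (fps_X * (A1 + A2 - 1))"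
  proof -
    have "P1 * P2 * (fps_X * (A1 + A2 - 1)) = fps_X * (P2 * (P1 * A1) + P1 * (P2 * A2) - P1 * P2)"
      by (simp add: algebra_simps)
    also have "\<dots> = fps_X * (P2 * F + P1 * F - P1 * P2)" by (simp only: FA[symmetric])
    also have "\<dots> = (P1 + P2) * (fps_X * F) - fps_X * (P1 * P2)" by (simp add: algebra_simps)
    also have "\<dots> = P1 * P2 * F" unfolding rel by (simp add: algebra_simps)
    finally show ?thesis by (rule sym)
  qed
  moreover have "P1 * P2 \<noteq> 0" using P1_nth P2_nth by auto
  ultimately have "F = fps_X * (A1 + A2 - 1)" using mult_left_cancel by blast
  also have "A1 + A2 - 1 = (1 + fps_X * (Rc \<mu> + Rc \<nu>)) oo F"
    by (simp add: A1_def A2_def fps_compose_add_distrib distrib_left)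
  finally have FR: "F = fps_X * ((1 + fps_X * (Rc \<mu> + Rc \<nu>)) oo F)" .
  have "pick G F"
    unfolding pick_def
  proof (intro conjI allI impI GF F_nth)
    show "\<exists>R. G holomorphic_on OmegaR R" using holG by (auto simp: G_def[abs_def])
    show "Im (G z) < 0" if "Im z > 0" for z
      unfolding G_def using Im that by (intro stieltjes_Im_le(2)[OF \<mu>]) (auto intro: less_le_trans)
    show "F $ n \<in> \<real>" for n
      by (rule has_inf_exp_Reals[OF GF large]) (use cnj in \<open>simp add: G_def stieltjes_cnj\<close>)
  qed
  then obtain \<rho> where "cs_prob \<rho>" "mser \<rho> = F" using pick_representation by blast
  then show ?thesis using mser_R_unique[OF moment_0] FR by metis
qed

section \<open>R-transforms and the theorem\<close>

text \<open>With w = \<phi>(v), the relation for \<mu> is v = u (1 + v r), and that for \<beta>,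
  read at v in place of u, is w = v (1 + w s). Eliminating the outer v gives w = u (1 + w (s + r)),
  where r = R_\<mu>(v) is a function of w through v = \<phi>^-1(w).\<close>

lemma Rc_Phi:
  assumes q: "q \<noteq> 0" and m0: "moment \<mu> 0 = 1" "moment \<nu> 0 = 1" "moment \<beta> 0 = 1"
    and \<nu>: "mser \<nu> = Phi q oo mser \<mu>" and \<beta>: "mser \<beta> = Phi q"
  shows "Rc \<nu> = Rc \<beta> + (Rc \<mu> oo fps_inv (Phi q))"
proof -
  define v where "v = mser \<mu>"
  define w where "w = mser \<nu>"
  define r where "r = Rc \<mu> oo v"
  define s where "s = Rc \<beta> oo w"
  have "v $ 1 \<noteq> 0" using m0 by (simp add: v_def mser_nth)
  then have v0: "v $ 0 = 0" "v \<noteq> 0" and w0: "w $ 0 = 0" by (auto simp: v_def w_def)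
  have P: "Phi q $ 0 = 0" "Phi q $ 1 \<noteq> 0" using Phi_1[OF q] by auto
  have inv0: "fps_inv (Phi q) $ 0 = 0" by (simp add: fps_inv_def)
  have vw: "fps_inv (Phi q) oo w = v"
  proof -
    have "fps_inv (Phi q) oo w = (fps_inv (Phi q) oo Phi q) oo v"
      unfolding w_def \<nu> v_def[symmetric] by (rule fps_compose_assoc) (use v0 P in auto)
    then show ?thesis using fps_inv[OF P] v0 by simp
  qed
  have eq_v: "v = fps_X * (1 + v * r)"
  proof -
    have "v = fps_X * ((1 + fps_X * Rc \<mu>) oo v)" unfolding v_def by (rule mser_R_eq[OF m0(1)])
    also have "(1 + fps_X * Rc \<mu>) oo v = 1 + v * r"
      using v0 by (simp add: r_def fps_compose_add_distrib fps_compose_mult_distrib)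
    finally show ?thesis .
  qed
  have eq_w: "w = v * (1 + w * s)"
  proof -
    have "w = v * ((1 + fps_X * Rc \<beta>) oo w)"
      by (rule mser_compose_R_eq[OF m0(3) v0(1)]) (simp add: \<beta> \<nu> w_def v_def)
    also have "(1 + fps_X * Rc \<beta>) oo w = 1 + w * s"
      using w0 by (simp add: s_def fps_compose_add_distrib fps_compose_mult_distrib)
    finally show ?thesis .
  qed
  define S where "S = Rc \<beta> + (Rc \<mu> oo fps_inv (Phi q))"
  have "S oo w = s + r"
  proof -
    have "(Rc \<mu> oo fps_inv (Phi q)) oo w = Rc \<mu> oo (fps_inv (Phi q) oo w)"
      by (rule fps_compose_assoc[symmetric]) (use w0 inv0 in auto)
    then show ?thesis by (simp add: S_def s_def r_def vw fps_compose_add_distrib)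
  qed
  then have Sw: "(1 + fps_X * S) oo w = 1 + w * (s + r)"
    using w0 by (simp add: fps_compose_add_distrib fps_compose_mult_distrib)
  have "v * w = v * (fps_X * (1 + w * (s + r)))"
  proof -
    have "v * (fps_X * (1 + w * (s + r))) = fps_X * (v * (1 + w * s) + w * (v * r))" by (simp add: algebra_simps)
    also have "\<dots> = fps_X * (w + w * (v * r))" by (simp only: eq_w[symmetric])
    also have "\<dots> = w * (fps_X * (1 + v * r))" by (simp add: algebra_simps)
    also have "\<dots> = w * v" by (simp only: eq_v[symmetric])
    also have "\<dots> = v * w" by (rule mult.commute)
    finally show ?thesis by (rule sym)
  qed
  then have "w = fps_X * ((1 + fps_X * S) oo w)" using v0 Sw by (metis mult_left_cancel)
  then show ?thesis using mser_R_unique[OF m0(2)] by (simp add: w_def S_def)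
qed

lemma fps_shift_props:
  defines "P \<equiv> fps_X * inverse (1 - fps_X) :: complex fps"
  shows "P $ 0 = 0" "P $ 1 = 1" "(1 - fps_X) * P = fps_X"
proof -
  show "P $ 0 = 0" "P $ 1 = 1" by (simp_all add: P_def)
  have "(1 - fps_X) * inverse (1 - fps_X :: complex fps) = 1" by (rule inverse_mult_eq_1') simp
  then show "(1 - fps_X) * P = fps_X" by (simp add: P_def mult.left_commute)
qed

text \<open>Put y = v/(1 + v), where v is the translated transform. From v = P (1 + v r) and (1 - u)
  P = u follows v = u (1 + v + v r), and division by 1 + v gives y = u (1 + y r). Since P(y) = y/(1
  - y) = v, the series r is R_\<mu>(P(y)).\<close>

lemma Rc_Bser:
  assumes m0: "moment \<mu> 0 = 1" "moment \<eta> 0 = 1" and \<eta>: "mser \<eta> = Bser (mser \<mu>)"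
  shows "Rc \<eta> = Rc \<mu> oo (fps_X * inverse (1 - fps_X))"
proof -
  define P :: "complex fps" where "P = fps_X * inverse (1 - fps_X)"
  note Pp = fps_shift_props[folded P_def]
  define v where "v = mser \<mu> oo P"
  define y where "y = mser \<eta>"
  define r where "r = Rc \<mu> oo v"
  have v0: "v $ 0 = 0" and y0: "y $ 0 = 0" by (simp_all add: v_def y_def)
  have v1: "(1 + v) $ 0 \<noteq> 0" using v0 by simp
  have y_eq: "y = 1 - inverse (1 + v)"
    unfolding y_def \<eta> Bser_def P_def[symmetric] v_def[symmetric]
    using v0 by (simp add: fps_compose_sub_distrib fps_inverse_compose fps_compose_add_distrib)
  have yv: "(1 + v) * y = v" using inverse_mult_eq_1'[OF v1] by (simp add: y_eq right_diff_distrib)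
  have eq_v: "v = P * (1 + v * r)"
  proof -
    have "v = P * ((1 + fps_X * Rc \<mu>) oo v)" by (rule mser_compose_R_eq[OF m0(1) Pp(1) v_def])
    also have "(1 + fps_X * Rc \<mu>) oo v = 1 + v * r"
      using v0 by (simp add: r_def fps_compose_add_distrib fps_compose_mult_distrib)
    finally show ?thesis .
  qed
  have Py: "P oo y = v"
  proof -
    have "P oo y = y * inverse (1 - y)" unfolding P_def
      using y0 by (simp add: fps_compose_mult_distrib fps_inverse_compose fps_compose_sub_distrib)
    also have "1 - y = inverse (1 + v)" by (simp add: y_eq)
    also have "inverse (inverse (1 + v)) = 1 + v" using v1 by (rule fps_inverse_idempotent)
    finally show ?thesis using yv by (simp add: mult.commute)
  qed
  have Sy: "(1 + fps_X * (Rc \<mu> oo P)) oo y = 1 + y * r"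
  proof -
    have "(Rc \<mu> oo P) oo y = Rc \<mu> oo (P oo y)" by (rule fps_compose_assoc[symmetric]) (use y0 Pp in auto)
    then show ?thesis using y0 by (simp add: fps_compose_add_distrib fps_compose_mult_distrib Py r_def)
  qed
  have "(1 + v) * y = (1 + v) * (fps_X * (1 + y * r))"
  proof -
    have "(1 - fps_X) * v = (1 - fps_X) * P * (1 + v * r)" by (subst (1) eq_v) (simp add: mult.assoc)
    then have "(1 - fps_X) * v = fps_X * (1 + v * r)" using Pp(3) by simp
    then have "v = fps_X * (1 + v + v * r)" by (simp add: algebra_simps)
    moreover have "(1 + v) * (fps_X * (1 + y * r)) = fps_X * (1 + v + ((1 + v) * y) * r)" by (simp add: algebra_simps)
    ultimately show ?thesis using yv by metis
  qed
  moreover have "1 + v \<noteq> 0" using v1 by (metis fps_zero_nth)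
  ultimately have "y = fps_X * ((1 + fps_X * (Rc \<mu> oo P)) oo y)" using Sy by (metis mult_left_cancel)
  then show ?thesis using mser_R_unique[OF m0(2)] by (simp add: y_def P_def)
qed

section \<open>The beta distribution\<close>

lemma moment_beta_distr:
  assumes q: "\<bar>q\<bar> < 1"
  shows "moment (beta_distr (1 - q) (1 + q)) k = Beta (1 - q + real k) (1 + q) / Beta (1 - q) (1 + q)"
proof -
  define c where "c = Beta (1 - q) (1 + q)"
  have ab: "1 - q > 0" "1 + q > 0" using q by auto
  have c: "c > 0" unfolding c_def Beta_def using ab by (intro divide_pos_pos mult_pos_pos Gamma_real_pos) auto
  let ?f = "\<lambda>x. indicator {0<..<1} x * x powr (1 - q - 1) * (1 - x) powr (1 + q - 1) / c"
  let ?g = "\<lambda>x. x powr (1 - q + real k - 1) * (1 - x) powr (1 + q - 1)"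
  have "moment (beta_distr (1 - q) (1 + q)) k = (LINT x|lborel. ?f x *\<^sub>R x ^ k)"
    unfolding moment_def beta_distr_def c_def[symmetric]
    by (rule integral_density) (use c in \<open>auto simp: indicator_def\<close>)
  also have "\<dots> = (LINT x|lborel. (indicator {0..1} x *\<^sub>R ?g x) / c)"
  proof (rule Bochner_Integration.integral_cong[OF refl])
    fix x :: real
    show "?f x *\<^sub>R x ^ k = (indicator {0..1} x *\<^sub>R ?g x) / c"
    \<comment> \<open>Outside the open interval both sides vanish, at the endpoints by the
      convention \<open>0 powr a = 0\<close>; so the open interval of the density matches the closed
      one of the Beta integral.\<close>
    proof (cases "0 < x \<and> x < 1")
      case True
      then have "x powr (1 - q - 1) * x ^ k = x powr (1 - q + real k - 1)"
        by (simp add: powr_add[symmetric] powr_realpow[symmetric])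
      then show ?thesis using True by simp
    qed (auto simp: indicator_def)
  qed
  also have "\<dots> = (LINT x:{0..1}|lborel. ?g x) / c"
    unfolding set_lebesgue_integral_def by (rule integral_divide_zero)
  also have "(LINT x:{0..1}|lborel. ?g x) = Beta (1 - q + real k) (1 + q)"
    using set_borel_integral_eq_integral(2)[OF integrable_Beta[of "1 - q + real k" "1 + q"]] ab
      has_integral_Beta_real[of "1 - q + real k" "1 + q"] by (simp add: integral_unique)
  finally show ?thesis by (simp add: c_def)
qed

text \<open>Both sequences start with 1 and have the ratio (k + 1 - q)/(k + 2) of consecutive terms,
  by the recursions of the Beta function and of the binomial coefficients.\<close>

lemma mser_beta_distr:
  assumes q: "q \<noteq> 0" "\<bar>q\<bar> < 1"
  shows "mser (beta_distr (1 - q) (1 + q)) = Phi q"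
proof -
  have ab: "1 - q > 0" "1 + q > 0" using q by auto
  have c: "Beta (1 - q) (1 + q) > 0" unfolding Beta_def using ab by (intro divide_pos_pos mult_pos_pos Gamma_real_pos) auto
  have moments: "moment (beta_distr (1 - q) (1 + q)) k = - ((q gchoose Suc k) * (- 1) ^ Suc k / q)" for k
  proof (induction k)
    case 0
    then show ?case using c q by (simp add: moment_beta_distr[OF q(2)])
  next
    case (Suc k)
    let ?x = "1 - q + real k"
    have "(?x + (1 + q)) * Beta (?x + 1) (1 + q) = ?x * Beta ?x (1 + q)"
      using ab by (intro Beta_plus1_left) (auto elim!: nonpos_Ints_cases)
    then have "(real k + 2) * Beta (?x + 1) (1 + q) = ?x * Beta ?x (1 + q)" by (simp add: algebra_simps)
    then have "Beta (?x + 1) (1 + q) = ?x / (real k + 2) * Beta ?x (1 + q)" by (simp add: field_simps)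
    then have "moment (beta_distr (1 - q) (1 + q)) (Suc k) = ?x / (real k + 2) * moment (beta_distr (1 - q) (1 + q)) k"
      by (simp add: moment_beta_distr[OF q(2)] add.commute add.left_commute diff_add_eq)
    also have "\<dots> = - ((q gchoose Suc (Suc k)) * (- 1) ^ Suc (Suc k) / q)"
    proof -
      have "(q gchoose Suc (Suc k)) * (real k + 2) = (q gchoose Suc k) * (q - real (Suc k))"
        using gbinomial_mult_1[of q "Suc k"] by (simp add: algebra_simps)
      then have g: "q gchoose Suc (Suc k) = (q gchoose Suc k) * (q - real (Suc k)) / (real k + 2)"
        by (simp add: field_simps)
      show ?thesis unfolding Suc g by (simp add: field_simps) (simp add: diff_divide_distrib add_divide_distrib)
    qed
    finally show ?case .
  qed
  show ?thesis
  proof (rule fps_ext)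
    fix n show "mser (beta_distr (1 - q) (1 + q)) $ n = Phi q $ n"
      by (cases n) (simp_all add: mser_nth Phi_def moments)
  qed
qed

text \<open>Here the analytic relation is traded for a formal one: branches cancel near infinity,
  and functions agree there exactly when their expansions do. Existence, uniqueness and injectivity
  become statements on power series.\<close>

lemma P_rel_iff:
  assumes q: "q \<noteq> 0" "\<bar>q\<bar> < 1" and \<mu>: "cs_prob \<mu>"
  shows "P_rel q \<mu> \<nu> \<longleftrightarrow> cs_prob \<nu> \<and> mser \<nu> = Phi q oo mser \<mu>"
proof (cases "cs_prob \<nu>")
  case True
  have lim: "(stieltjes \<rho> \<longlongrightarrow> 0) at_infinity" if "cs_prob \<rho>" for \<rho>
    using has_inf_exp_tendsto[OF stieltjes_inf_exp[OF that]] by simp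
  have "P_rel q \<mu> \<nu> \<longleftrightarrow> (\<forall>\<^sub>F z in at_infinity. stieltjes \<nu> z = phi q (stieltjes \<mu> z))"
    unfolding P_rel_def using eventually_powr_iff[OF q lim[OF \<mu>] lim[OF True]] True by simp
  also have "\<dots> \<longleftrightarrow> mser \<nu> = Phi q oo mser \<mu>"
    by (rule has_inf_exp_eq_iff[OF stieltjes_inf_exp[OF True]
          has_inf_exp_compose[OF stieltjes_inf_exp[OF \<mu>] mser_0 Phi_expansion[OF q(1)]]])
  finally show ?thesis using True by simp
qed (simp add: P_rel_def)

lemma Q_rel_iff:
  assumes q: "q \<noteq> 0" "\<bar>q\<bar> < 1" and \<mu>: "cs_prob \<mu>"
  shows "Q_rel q \<mu> \<nu> \<longleftrightarrow> cs_prob \<nu> \<and> mser \<nu> = Phi q oo Bser (mser \<mu>)"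
proof (cases "cs_prob \<nu>")
  case True
  define f where "f z = 1 - inverse (1 + stieltjes \<mu> (z - 1))" for z
  have "pick f (Bser (mser \<mu>))" unfolding f_def by (rule pick_shift[OF pick_stieltjes[OF \<mu>]])
  then have f: "has_inf_exp f (Bser (mser \<mu>))" "Bser (mser \<mu>) $ 0 = 0" by (auto simp: pick_def)
  have limf: "(f \<longlongrightarrow> 0) at_infinity" using has_inf_exp_tendsto[OF f(1)] f(2) by simp
  have lim: "(stieltjes \<nu> \<longlongrightarrow> 0) at_infinity"
    using has_inf_exp_tendsto[OF stieltjes_inf_exp[OF True]] by simp
  \<comment> \<open>Taking reciprocals of both sides turns the exponent -1/q into 1/q.\<close>
  have "1 + stieltjes \<mu> (z - 1) = w powr complex_of_real (- 1 / q) \<longleftrightarrow> 1 - f z = w powr complex_of_real (1 / q)" for z w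
  proof -
    have e1: "w powr complex_of_real (- 1 / q) = inverse (w powr complex_of_real (1 / q))"
      by (simp add: powr_minus[symmetric])
    have e2: "1 - f z = inverse (1 + stieltjes \<mu> (z - 1))" by (simp add: f_def)
    show ?thesis unfolding e1 e2 by (metis inverse_inverse_eq)
  qed
  then have "Q_rel q \<mu> \<nu> \<longleftrightarrow> (\<forall>\<^sub>F z in at_infinity. stieltjes \<nu> z = phi q (f z))"
    unfolding Q_rel_def using eventually_powr_iff[OF q limf lim] True by simp
  also have "\<dots> \<longleftrightarrow> mser \<nu> = Phi q oo Bser (mser \<mu>)"
    by (rule has_inf_exp_eq_iff[OF stieltjes_inf_exp[OF True] has_inf_exp_compose[OF f Phi_expansion[OF q(1)]]])
  finally show ?thesis using True by simp
qed (simp add: Q_rel_def)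

section \<open>Injectivity and the two convolutions\<close>

lemma fps_compose_cancel_left:
  fixes A f g :: "complex fps"
  assumes "A $ 0 = 0" "A $ 1 \<noteq> 0" "f $ 0 = 0" "g $ 0 = 0" "A oo f = A oo g"
  shows "f = g"
proof -
  have *: "h = fps_inv A oo (A oo h)" if "h $ 0 = 0" for h
    using fps_compose_assoc[OF that assms(1), of "fps_inv A"] fps_inv[OF assms(1,2)] that by simp
  show ?thesis using *[OF assms(3)] *[OF assms(4)] assms(5) by simp
qed

lemma Bser_inject:
  assumes "F $ 0 = 0" "G $ 0 = 0" "Bser F = Bser G" shows "F = G"
proof -
  let ?P = "fps_X * inverse (1 - fps_X) :: complex fps"
  have "F oo ?P = G oo ?P"
  proof (rule fps_compose_cancel_left)
    show "(1 - inverse (1 + fps_X)) oo (F oo ?P) = (1 - inverse (1 + fps_X)) oo (G oo ?P)"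
      using assms(3) by (simp add: Bser_def)
  qed (use assms in \<open>simp_all add: fps_inverse_def numeral_2_eq_2\<close>)
  then show ?thesis using fps_compose_cancel_right fps_shift_props(1,2) by (metis one_neq_zero)
qed

lemma Rc_inject:
  assumes "cs_prob \<mu>" "cs_prob \<nu>" "Rc \<mu> = Rc \<nu>" shows "\<mu> = \<nu>"
proof (rule mser_inject[OF assms(1,2)], rule fps_functional_unique)
  show "mser \<mu> = fps_X * ((1 + fps_X * Rc \<mu>) oo mser \<mu>)" by (rule mser_R_eq[OF moment_0[OF assms(1)]])
  show "mser \<nu> = fps_X * ((1 + fps_X * Rc \<mu>) oo mser \<nu>)"
    unfolding assms(3) by (rule mser_R_eq[OF moment_0[OF assms(2)]])
qed simp

lemma free_conv_spec:
  assumes "cs_prob \<mu>" "cs_prob \<nu>"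
  shows "cs_prob (free_conv \<mu> \<nu>)" "Rc (free_conv \<mu> \<nu>) = Rc \<mu> + Rc \<nu>"
proof -
  have iff: "R_transform \<rho> = R_transform \<mu> + R_transform \<nu> \<longleftrightarrow> Rc \<rho> = Rc \<mu> + Rc \<nu>" for \<rho>
    by (simp add: Rc_def fps_eq_iff flip: of_real_add)
  have "\<exists>!\<rho>. cs_prob \<rho> \<and> R_transform \<rho> = R_transform \<mu> + R_transform \<nu>"
    unfolding iff using free_conv_ex[OF assms] Rc_inject by metis
  from theI'[OF this] show "cs_prob (free_conv \<mu> \<nu>)" "Rc (free_conv \<mu> \<nu>) = Rc \<mu> + Rc \<nu>"
    unfolding free_conv_def iff by auto
qed

lemma qconv_rel_iff:
  "qconv_rel q \<rho>1 \<rho>2 \<rho> \<longleftrightarrow> cs_prob \<rho> \<and> Rc \<rho> = Rc \<rho>1 + Rc \<rho>2 - Rc (beta_distr (1 - q) (1 + q))"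
proof -
  have "R_quant q \<rho> = R_quant q \<rho>1 + R_quant q \<rho>2 \<longleftrightarrow>
    R_transform \<rho> = R_transform \<rho>1 + R_transform \<rho>2 - R_transform (beta_distr (1 - q) (1 + q))"
    unfolding R_quant_def by (auto simp: algebra_simps)
  also have "\<dots> \<longleftrightarrow> Rc \<rho> = Rc \<rho>1 + Rc \<rho>2 - Rc (beta_distr (1 - q) (1 + q))"
    by (simp add: Rc_def fps_eq_iff flip: of_real_add of_real_diff)
  finally show ?thesis by (simp add: qconv_rel_def)
qed

lemma qconv_eqI:
  assumes "qconv_rel q \<rho>1 \<rho>2 \<rho>" shows "qconv q \<rho>1 \<rho>2 = \<rho>"
  unfolding qconv_def using assms by (intro the_equality) (auto simp: qconv_rel_iff intro!: Rc_inject)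

theorem theorem30:
  fixes q :: real
  assumes "q \<in> {-1<..<0} \<union> {0<..<1}"
  shows "(\<forall>\<mu>. cs_prob \<mu> \<longrightarrow> (\<exists>!\<nu>. P_rel q \<mu> \<nu>))
    \<and> (\<forall>\<mu>. cs_prob \<mu> \<longrightarrow> (\<exists>!la. Q_rel q \<mu> la))
    \<and> inj_on (P_map q) {\<mu>. cs_prob \<mu>}
    \<and> inj_on (Q_map q) {\<mu>. cs_prob \<mu>}
    \<and> (\<forall>\<nu>1 \<nu>2. cs_prob \<nu>1 \<and> cs_prob \<nu>2 \<longrightarrow>
         (\<exists>\<rho>. qconv_rel q (P_map q \<nu>1) (P_map q \<nu>2) \<rho>)
       \<and> (\<exists>\<rho>. qconv_rel q (Q_map q \<nu>1) (Q_map q \<nu>2) \<rho>)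
       \<and> P_map q (free_conv \<nu>1 \<nu>2) = qconv q (P_map q \<nu>1) (P_map q \<nu>2)
       \<and> Q_map q (free_conv \<nu>1 \<nu>2) = qconv q (Q_map q \<nu>1) (Q_map q \<nu>2))"
proof -
  have q: "q \<noteq> 0" "\<bar>q\<bar> < 1" using assms by auto
  define \<beta> where "\<beta> = beta_distr (1 - q) (1 + q)"
  have \<beta>: "mser \<beta> = Phi q" unfolding \<beta>_def by (rule mser_beta_distr[OF q])
  have \<beta>0: "moment \<beta> 0 = 1"
    using arg_cong[OF \<beta>, of "\<lambda>F. F $ 1"] Phi_1[OF q(1)] by (simp add: mser_nth)
  have P_ex1: "\<exists>!\<nu>. P_rel q \<mu> \<nu>" if \<mu>: "cs_prob \<mu>" for \<mu>
    unfolding P_rel_iff[OF q \<mu>]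
    using pick_representation[OF pick_phi[OF q pick_stieltjes[OF \<mu>]]] mser_inject by metis
  have Q_ex1: "\<exists>!\<nu>. Q_rel q \<mu> \<nu>" if \<mu>: "cs_prob \<mu>" for \<mu>
    unfolding Q_rel_iff[OF q \<mu>]
    using pick_representation[OF pick_phi[OF q pick_shift[OF pick_stieltjes[OF \<mu>]]]] mser_inject by metis
  have P: "cs_prob (P_map q \<mu>)" "mser (P_map q \<mu>) = Phi q oo mser \<mu>" if \<mu>: "cs_prob \<mu>" for \<mu>
    using theI'[OF P_ex1[OF \<mu>]] unfolding P_map_def P_rel_iff[OF q \<mu>] by auto
  have Q: "cs_prob (Q_map q \<mu>)" "mser (Q_map q \<mu>) = Phi q oo Bser (mser \<mu>)" if \<mu>: "cs_prob \<mu>" for \<mu>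
    using theI'[OF Q_ex1[OF \<mu>]] unfolding Q_map_def Q_rel_iff[OF q \<mu>] by auto
  have B0: "Bser (mser \<mu>) $ 0 = 0" if "cs_prob \<mu>" for \<mu>
    using pick_shift[OF pick_stieltjes[OF that]] by (simp add: pick_def)
  have Phi_cancel: "F = G" if "Phi q oo F = Phi q oo G" "F $ 0 = 0" "G $ 0 = 0" for F G
    using that Phi_1[OF q(1)] by (intro fps_compose_cancel_left[of "Phi q" F G]) auto
  have RP: "Rc (P_map q \<mu>) = Rc \<beta> + (Rc \<mu> oo fps_inv (Phi q))" if \<mu>: "cs_prob \<mu>" for \<mu>
    by (rule Rc_Phi[OF q(1) moment_0[OF \<mu>] moment_0[OF P(1)[OF \<mu>]] \<beta>0 P(2)[OF \<mu>] \<beta>])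
  have RQ: "Rc (Q_map q \<mu>) = Rc \<beta> + ((Rc \<mu> oo (fps_X * inverse (1 - fps_X))) oo fps_inv (Phi q))"
    if \<mu>: "cs_prob \<mu>" for \<mu>
  proof -
    \<comment> \<open>The auxiliary measure whose image under the first map is the image of
      \<open>\<mu>\<close> under the second; its R-transform is that of \<open>\<mu>\<close> after a
      substitution.\<close>
    obtain \<eta> where \<eta>: "cs_prob \<eta>" "mser \<eta> = Bser (mser \<mu>)"
      using pick_representation[OF pick_shift[OF pick_stieltjes[OF \<mu>]]] by blast
    have "Rc (Q_map q \<mu>) = Rc \<beta> + (Rc \<eta> oo fps_inv (Phi q))"
      by (rule Rc_Phi[OF q(1) moment_0[OF \<eta>(1)] moment_0[OF Q(1)[OF \<mu>]] \<beta>0 _ \<beta>]) (use Q(2)[OF \<mu>] \<eta> in simp)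
    then show ?thesis using Rc_Bser[OF moment_0[OF \<mu>] moment_0[OF \<eta>(1)] \<eta>(2)] by simp
  qed
  have "inj_on (P_map q) {\<mu>. cs_prob \<mu>}"
  proof (rule inj_onI)
    fix \<mu> \<nu> assume *: "\<mu> \<in> {\<mu>. cs_prob \<mu>}" "\<nu> \<in> {\<mu>. cs_prob \<mu>}" "P_map q \<mu> = P_map q \<nu>"
    then have "Phi q oo mser \<mu> = Phi q oo mser \<nu>" using P(2)[of \<mu>] P(2)[of \<nu>] by simp
    then have "mser \<mu> = mser \<nu>" by (rule Phi_cancel) simp_all
    then show "\<mu> = \<nu>" using * by (intro mser_inject) auto
  qed
  moreover have "inj_on (Q_map q) {\<mu>. cs_prob \<mu>}"
  proof (rule inj_onI)
    fix \<mu> \<nu> assume *: "\<mu> \<in> {\<mu>. cs_prob \<mu>}" "\<nu> \<in> {\<mu>. cs_prob \<mu>}" "Q_map q \<mu> = Q_map q \<nu>"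
    then have "Phi q oo Bser (mser \<mu>) = Phi q oo Bser (mser \<nu>)" using Q(2)[of \<mu>] Q(2)[of \<nu>] by simp
    then have "Bser (mser \<mu>) = Bser (mser \<nu>)" by (rule Phi_cancel) (use * B0 in auto)
    then have "mser \<mu> = mser \<nu>" by (rule Bser_inject[rotated 2]) simp_all
    then show "\<mu> = \<nu>" using * by (intro mser_inject) auto
  qed
  \<comment> \<open>Adding the two images counts R_\<beta> twice and the convolution subtracts it
    once; the remaining terms are compositions with a fixed inner series, hence additive.\<close>
  moreover have "qconv_rel q (P_map q \<nu>1) (P_map q \<nu>2) (P_map q (free_conv \<nu>1 \<nu>2))"
    "qconv_rel q (Q_map q \<nu>1) (Q_map q \<nu>2) (Q_map q (free_conv \<nu>1 \<nu>2))"
    if \<nu>: "cs_prob \<nu>1" "cs_prob \<nu>2" for \<nu>1 \<nu>2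
    unfolding qconv_rel_iff \<beta>_def[symmetric]
    by (simp_all add: P Q RP RQ \<nu> free_conv_spec[OF \<nu>] fps_compose_add_distrib)
  ultimately show ?thesis using P_ex1 Q_ex1 qconv_eqI by metis
qed

end
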